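(* Let $W$ be a restricted $\mathcal{L}^*$-module of level $\ell_{1234}$. Then there exists a $\phi$-coordinated $V_{\widehat{\mathfrak{L}^*}}(\ell_{1234},0)$-module structure $Y_W(\cdot,x)$ on $W$, uniquely determined by $$Y_W((T^m)_{-1}\mathbf{1},x)=T_m(x),\qquad Y_W((E^m)_{-1}\mathbf{1},x)=E_m(x)\qquad(m\in\mathbb{Z}).$$
   Context: The rank two twisted Heisenberg–Virasoro algebra $\mathcal{L}^*$ has basis $\{t_1^mt_2^n, E_{m,n}: (m,n)\in\mathbb{Z}^2\setminus\{(0,0)\}\}\cup\{K_1,K_2,K_3,K_4\}$, $K_i$ central, with $[t_1^mt_2^n,t_1^rt_2^s]=0$, $[t_1^mt_2^n,E_{r,s}]=(nr-ms)t_1^{m+r}t_2^{n+s}+\delta_{m+r,0}\delta_{n+s,0}(mK_1+nK_2)$, $[E_{m,n},E_{r,s}]=(nr-ms)E_{m+r,n+s}+\delta_{m+r,0}\delta_{n+s,0}(mK_3+nK_4)$ (terms with index $(0,0)$ are interpreted as $0$). Set $T_m(x)=\sum_{n\in\mathbb{Z}}t_1^mt_2^nx^{-n}$ and $E_m(x)=\sum_nE_{m,n}x^{-n}$ (omitting $(0,0)$ terms). An $\mathcal{L}^*$-module $W$ is restricted if $T_m(x),E_m(x)\in\mathrm{Hom}(W,W((x)))$ for all $m$, i.e. for each $w$, $t_1^mt_2^nw=0$ and $E_{m,n}w=0$ for $n$ sufficiently large; it has level $\ell_{1234}$ if $K_i$ acts as $\ell_i\in\mathbb{C}$. $\widehat{\mathfrak{L}^*}$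 is the Lie algebra with basis $\{T^m\otimes t^n, E^r\otimes t^s:(m,n),(r,s)\in\mathbb{Z}^2\}\cup\{K_1,\dots,K_4\}$, $K_i$ central, $[T^m\otimes t^n,T^r\otimes t^s]=0$, $[T^m\otimes t^n,E^r\otimes t^s]=(nr-ms)T^{m+r}\otimes t^{n+s-1}+m\delta_{m+r,0}\delta_{n+s+1,0}K_1+n\delta_{m+r,0}\delta_{n+s,0}K_2$, $[E^m\otimes t^n,E^r\otimes t^s]=(nr-ms)E^{m+r}\otimes t^{n+s-1}+m\delta_{m+r,0}\delta_{n+s+1,0}K_3+n\delta_{m+r,0}\delta_{n+s,0}K_4$. Write $(T^m)_n=T^m\otimes t^n$, $(E^r)_s=E^r\otimes t^s$. $V_{\widehat{\mathfrak{L}^*}}(\ell_{1234},0)=U(\widehat{\mathfrak{L}^*})\otimes_{U(\widehat{\mathfrak{L}^*}_{\ge0})}\mathbb{C}$, where $\widehat{\mathfrak{L}^*}_{\ge0}$ is spanned by $T^m\otimes t^n,E^r\otimes t^n$ ($n\ge0$) acting as $0$ and $K_i$ acting as $\ell_i$; $\mathbf{1}=1\otimes1$. It is a vertex algebra with vacuum $\mathbf{1}$, $Y((T^m)_{-1}\mathbf{1},x)=\sum_n(T^m)_nx^{-n-1}$, $Y((E^r)_{-1}\mathbf{1},x)=\sum_s(E^r)_sx^{-s-1}$, generated by $\{(T^m)_{-1}\mathbf{1},(E^r)_{-1}\mathbf{1}\}$. A $\phi$-coordinated module ($\phi(x,z)=xe^z$) for a vertex algebra $V$ is a space $W$ with a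 linear map $Y_W(\cdot,x):V\to\mathrm{Hom}(W,W((x)))$ such that $Y_W(\mathbf{1},x)=\mathbf{1}_W$ and for $u,v\in V$ there is $k\in\mathbb{N}$ with $(x_1-x_2)^kY_W(u,x_1)Y_W(v,x_2)\in\mathrm{Hom}(W,W((x_1,x_2)))$ and $(x_2e^z-x_2)^kY_W(Y(u,z)v,x_2)=((x_1-x_2)^kY_W(u,x_1)Y_W(v,x_2))|_{x_1=x_2e^z}$. *)

theory Defs
  imports Complex_Main "HOL-Library.Function_Algebras"
begin

text \<open>The operator of t1^m t2^n (resp. E_{m,n}) on W is given by a function
  act m n; index (0,0) is not a basis element and is interpreted as 0.\<close>

definition zact :: "(int \<Rightarrow> int \<Rightarrow> 'w \<Rightarrow> 'w) \<Rightarrow> int \<Rightarrow> int \<Rightarrow> 'w \<Rightarrow> ('w::zero)" where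
  "zact act m n w = (if m = 0 \<and> n = 0 then 0 else act m n w)"

definition restricted_Lstar_module ::
  "(complex \<Rightarrow> 'w::ab_group_add \<Rightarrow> 'w) \<Rightarrow> complex \<Rightarrow> complex \<Rightarrow> complex \<Rightarrow> complex \<Rightarrow>
   (int \<Rightarrow> int \<Rightarrow> 'w \<Rightarrow> 'w) \<Rightarrow> (int \<Rightarrow> int \<Rightarrow> 'w \<Rightarrow> 'w) \<Rightarrow> bool" where
  "restricted_Lstar_module sc l1 l2 l3 l4 tact eact \<longleftrightarrow>
     \<comment> \<open>each basis element acts linearly\<close>
     (\<forall>m n w w'. zact tact m n (w + w') = zact tact m n w + zact tact m n w') \<and>
     (\<forall>m n c w. zact tact m n (sc c w) = sc c (zact tact m n w)) \<and>
     (\<forall>m n w w'. zact eact m n (w + w') = zact eact m n w + zact eact m n w') \<and>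
     (\<forall>m n c w. zact eact m n (sc c w) = sc c (zact eact m n w)) \<and>
     \<comment> \<open>bracket relations, K_i acting as l_i\<close>
     (\<forall>m n r s w. (m, n) \<noteq> (0, 0) \<longrightarrow> (r, s) \<noteq> (0, 0) \<longrightarrow>
        zact tact m n (zact tact r s w) = zact tact r s (zact tact m n w)) \<and>
     (\<forall>m n r s w. (m, n) \<noteq> (0, 0) \<longrightarrow> (r, s) \<noteq> (0, 0) \<longrightarrow>
        zact tact m n (zact eact r s w) - zact eact r s (zact tact m n w) =
        sc (of_int (n * r - m * s)) (zact tact (m + r) (n + s) w) +
        (if m + r = 0 \<and> n + s = 0 then sc (of_int m * l1 + of_int n * l2) w else 0)) \<and>
     (\<forall>m n r s w. (m, n) \<noteq> (0, 0) \<longrightarrow> (r, s) \<noteq> (0, 0) \<longrightarrow>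
        zact eact m n (zact eact r s w) - zact eact r s (zact eact m n w) =
        sc (of_int (n * r - m * s)) (zact eact (m + r) (n + s) w) +
        (if m + r = 0 \<and> n + s = 0 then sc (of_int m * l3 + of_int n * l4) w else 0)) \<and>
     \<comment> \<open>restrictedness\<close>
     (\<forall>m w. \<exists>N. \<forall>n\<ge>N. zact tact m n w = 0 \<and> zact eact m n w = 0)"

text \<open>Basis of hat L*: HT m n = T^m \<otimes> t^n, HE m n = E^m \<otimes> t^n, HK1..HK4 = K_1..K_4.\<close>

datatype hb = HT int int | HE int int | HK1 | HK2 | HK3 | HK4

fun br :: "hb \<Rightarrow> hb \<Rightarrow> (complex \<times> hb) list" where
  "br (HT m n) (HE r s) =
     [(of_int (n * r - m * s), HT (m + r) (n + s - 1)),
      (if m + r = 0 \<and> n + s + 1 = 0 then of_int m else 0, HK1),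
      (if m + r = 0 \<and> n + s = 0 then of_int n else 0, HK2)]"
| "br (HE r s) (HT m n) =
     [(- of_int (n * r - m * s), HT (m + r) (n + s - 1)),
      (if m + r = 0 \<and> n + s + 1 = 0 then - of_int m else 0, HK1),
      (if m + r = 0 \<and> n + s = 0 then - of_int n else 0, HK2)]"
| "br (HE m n) (HE r s) =
     [(of_int (n * r - m * s), HE (m + r) (n + s - 1)),
      (if m + r = 0 \<and> n + s + 1 = 0 then of_int m else 0, HK3),
      (if m + r = 0 \<and> n + s = 0 then of_int n else 0, HK4)]"
| "br _ _ = []"

text \<open>Elements of the tensor algebra T(hat L*) as finitely supported coefficient functions on
  words; the word [x1,...,xk] stands for the product x1 x2 ... xk.\<close>

type_synonym tv = "hb list \<Rightarrow> complex"

definition Fin :: "tv \<Rightarrow> bool" where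
  "Fin f \<longleftrightarrow> finite {w. f w \<noteq> 0}"

definition mono :: "hb list \<Rightarrow> tv" where
  "mono p = (\<lambda>w. if w = p then 1 else 0)"

definition smul :: "complex \<Rightarrow> tv \<Rightarrow> tv" where
  "smul c f = (\<lambda>w. c * f w)"

definition lmul :: "hb \<Rightarrow> tv \<Rightarrow> tv" where
  "lmul x f = (\<lambda>w. case w of [] \<Rightarrow> 0 | y # w' \<Rightarrow> if y = x then f w' else 0)"

fun nonneg_mode :: "hb \<Rightarrow> bool" where
  "nonneg_mode (HT m n) = (n \<ge> 0)"
| "nonneg_mode (HE m n) = (n \<ge> 0)"
| "nonneg_mode _ = False"

text \<open>Jset: preimage in T(hat L*) of the left ideal U(hat L*)\<cdot>{x - chi(x) : x \<in> hat L*_{\<ge>0}},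
  i.e. the two-sided ideal defining U(hat L*) plus the left ideal generated by the
  nonnegative modes and K_i - l_i.  V(l1234,0) = T / Jset, vacuum = class of [].\<close>

inductive_set Jset :: "complex \<Rightarrow> complex \<Rightarrow> complex \<Rightarrow> complex \<Rightarrow> tv set"
  for l1 l2 l3 l4 :: complex where
  J0: "0 \<in> Jset l1 l2 l3 l4"
| Jadd: "a \<in> Jset l1 l2 l3 l4 \<Longrightarrow> b \<in> Jset l1 l2 l3 l4 \<Longrightarrow> a + b \<in> Jset l1 l2 l3 l4"
| Jsmul: "a \<in> Jset l1 l2 l3 l4 \<Longrightarrow> smul c a \<in> Jset l1 l2 l3 l4"
| Jcomm: "mono (p @ [x, y] @ q) - mono (p @ [y, x] @ q)
            - (\<Sum>(c, z)\<leftarrow>br x y. smul c (mono (p @ [z] @ q))) \<in> Jset l1 l2 l3 l4"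
| Jpos: "nonneg_mode x \<Longrightarrow> mono (p @ [x]) \<in> Jset l1 l2 l3 l4"
| JK1: "mono (p @ [HK1]) - smul l1 (mono p) \<in> Jset l1 l2 l3 l4"
| JK2: "mono (p @ [HK2]) - smul l2 (mono p) \<in> Jset l1 l2 l3 l4"
| JK3: "mono (p @ [HK3]) - smul l3 (mono p) \<in> Jset l1 l2 l3 l4"
| JK4: "mono (p @ [HK4]) - smul l4 (mono p) \<in> Jset l1 l2 l3 l4"

definition veq :: "complex \<Rightarrow> complex \<Rightarrow> complex \<Rightarrow> complex \<Rightarrow> tv \<Rightarrow> tv \<Rightarrow> bool" where
  "veq l1 l2 l3 l4 u v \<longleftrightarrow> u - v \<in> Jset l1 l2 l3 l4"

definition vac :: tv where "vac = mono []"

text \<open>The vertex algebra structure of V(l1234,0): Yv u n v is (a representative of) u_n v,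
  where Y(u,x) = sum_n u_n x^(-n-1).  The conditions are the vertex algebra axioms
  (truncation, vacuum, creation, Jacobi identity in Borcherds' component form) on T/Jset,
  plus Y((T^m)_{-1} 1, x) = sum_n (T^m)_n x^(-n-1) and likewise for E.\<close>

definition is_V_structure :: "complex \<Rightarrow> complex \<Rightarrow> complex \<Rightarrow> complex \<Rightarrow> (tv \<Rightarrow> int \<Rightarrow> tv \<Rightarrow> tv) \<Rightarrow> bool" where
  "is_V_structure l1 l2 l3 l4 Yv \<longleftrightarrow>
     (let eq = veq l1 l2 l3 l4 in
     (\<forall>u v n. Fin u \<longrightarrow> Fin v \<longrightarrow> Fin (Yv u n v)) \<and>
     (\<forall>u u' v v' n. Fin u \<longrightarrow> Fin u' \<longrightarrow> Fin v \<longrightarrow> Fin v' \<longrightarrow> eq u u' \<longrightarrow> eq v v' \<longrightarrow>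
        eq (Yv u n v) (Yv u' n v')) \<and>
     (\<forall>u u' v n. Fin u \<longrightarrow> Fin u' \<longrightarrow> Fin v \<longrightarrow> eq (Yv (u + u') n v) (Yv u n v + Yv u' n v)) \<and>
     (\<forall>u v v' n. Fin u \<longrightarrow> Fin v \<longrightarrow> Fin v' \<longrightarrow> eq (Yv u n (v + v')) (Yv u n v + Yv u n v')) \<and>
     (\<forall>c u v n. Fin u \<longrightarrow> Fin v \<longrightarrow> eq (Yv (smul c u) n v) (smul c (Yv u n v))) \<and>
     (\<forall>c u v n. Fin u \<longrightarrow> Fin v \<longrightarrow> eq (Yv u n (smul c v)) (smul c (Yv u n v))) \<and>
     (\<forall>u v. Fin u \<longrightarrow> Fin v \<longrightarrow> (\<exists>N. \<forall>n\<ge>N. eq (Yv u n v) 0)) \<and>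
     (\<forall>v n. Fin v \<longrightarrow> eq (Yv vac n v) (if n = -1 then v else 0)) \<and>
     (\<forall>u n. Fin u \<longrightarrow> n \<ge> 0 \<longrightarrow> eq (Yv u n vac) 0) \<and>
     (\<forall>u. Fin u \<longrightarrow> eq (Yv u (-1) vac) u) \<and>
     (\<forall>u v w p q r. Fin u \<longrightarrow> Fin v \<longrightarrow> Fin w \<longrightarrow>
        (\<exists>M. \<forall>M'\<ge>M.
          eq (\<Sum>i<M'. smul (of_int p gchoose i) (Yv (Yv u (r + int i) v) (p + q - int i) w))
             (\<Sum>i<M'. smul ((-1) ^ i * (of_int r gchoose i))
                 (Yv u (p + r - int i) (Yv v (q + int i) w)
                  - smul ((-1) powi r) (Yv v (q + r - int i) (Yv u (p + int i) w)))))) \<and>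
     (\<forall>m n v. Fin v \<longrightarrow> eq (Yv (mono [HT m (-1)]) n v) (lmul (HT m n) v)) \<and>
     (\<forall>m n v. Fin v \<longrightarrow> eq (Yv (mono [HE m (-1)]) n v) (lmul (HE m n) v)))"

section \<open>phi-coordinated modules, phi(x,z) = x e^z\<close>

text \<open>YW u k w is the coefficient of x^k in Y_W(u,x) w.\<close>

text \<open>Coefficient of x1^a x2^b in (x1 - x2)^K Y_W(u,x1) Y_W(v,x2) w.\<close>
definition Pc :: "(complex \<Rightarrow> 'w::ab_group_add \<Rightarrow> 'w) \<Rightarrow> (tv \<Rightarrow> int \<Rightarrow> 'w \<Rightarrow> 'w) \<Rightarrow> nat \<Rightarrow>
                  tv \<Rightarrow> tv \<Rightarrow> 'w \<Rightarrow> int \<Rightarrow> int \<Rightarrow> 'w" where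
  "Pc sc YW K u v w a b =
     (\<Sum>i\<le>K. sc (of_int ((-1) ^ (K - i) * int (K choose i)))
                (YW u (a - int i) (YW v (b - int (K - i)) w)))"

text \<open>Coefficient of z^d in (e^z - 1)^K.\<close>
definition ek :: "nat \<Rightarrow> nat \<Rightarrow> complex" where
  "ek K d = (\<Sum>i\<le>K. of_nat (K choose i) * (-1) ^ (K - i) * of_nat i ^ d) / fact d"

text \<open>Coefficient of z^c x2^p in (x2 e^z - x2)^K Y_W(Y(u,z)v, x2) w, where u_j v = 0 in V
  for j \<ge> N'.\<close>
definition phiL :: "(complex \<Rightarrow> 'w::ab_group_add \<Rightarrow> 'w) \<Rightarrow> (tv \<Rightarrow> int \<Rightarrow> tv \<Rightarrow> tv) \<Rightarrow>
                    (tv \<Rightarrow> int \<Rightarrow> 'w \<Rightarrow> 'w) \<Rightarrow> nat \<Rightarrow> tv \<Rightarrow> tv \<Rightarrow> 'w \<Rightarrow> int \<Rightarrow> int \<Rightarrow> int \<Rightarrow> 'w" where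
  "phiL sc Yv YW K u v w N' c p =
     (\<Sum>j\<in>{-c-1..<N'}. sc (ek K (nat (c + j + 1))) (YW (Yv u j v) (p - int K) w))"

text \<open>Coefficient of z^c x2^p in ((x1 - x2)^K Y_W(u,x1) Y_W(v,x2) w)|_{x1 = x2 e^z}, where the
  coefficients Pc vanish when either exponent is < N.\<close>
definition phiR :: "(complex \<Rightarrow> 'w::ab_group_add \<Rightarrow> 'w) \<Rightarrow> (tv \<Rightarrow> int \<Rightarrow> 'w \<Rightarrow> 'w) \<Rightarrow> nat \<Rightarrow>
                    tv \<Rightarrow> tv \<Rightarrow> 'w \<Rightarrow> int \<Rightarrow> int \<Rightarrow> int \<Rightarrow> 'w" where
  "phiR sc YW K u v w N c p =
     (if c < 0 then 0 else
      (\<Sum>a\<in>{N..p-N}. sc (of_int a ^ nat c / fact (nat c)) (Pc sc YW K u v w a (p - a))))"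

definition phi_coord_module ::
  "(complex \<Rightarrow> 'w::ab_group_add \<Rightarrow> 'w) \<Rightarrow> complex \<Rightarrow> complex \<Rightarrow> complex \<Rightarrow> complex \<Rightarrow>
   (tv \<Rightarrow> int \<Rightarrow> tv \<Rightarrow> tv) \<Rightarrow> (tv \<Rightarrow> int \<Rightarrow> 'w \<Rightarrow> 'w) \<Rightarrow> bool" where
  "phi_coord_module sc l1 l2 l3 l4 Yv YW \<longleftrightarrow>
     (let eq = veq l1 l2 l3 l4 in
     \<comment> \<open>Y_W is a well-defined linear map V \<rightarrow> Hom(W, W((x)))\<close>
     (\<forall>u u'. Fin u \<longrightarrow> Fin u' \<longrightarrow> eq u u' \<longrightarrow> YW u = YW u') \<and>
     (\<forall>u u' k w. Fin u \<longrightarrow> Fin u' \<longrightarrow> YW (u + u') k w = YW u k w + YW u' k w) \<and>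
     (\<forall>c u k w. Fin u \<longrightarrow> YW (smul c u) k w = sc c (YW u k w)) \<and>
     (\<forall>u k w w'. Fin u \<longrightarrow> YW u k (w + w') = YW u k w + YW u k w') \<and>
     (\<forall>u k c w. Fin u \<longrightarrow> YW u k (sc c w) = sc c (YW u k w)) \<and>
     (\<forall>u w. Fin u \<longrightarrow> (\<exists>N. \<forall>k<N. YW u k w = 0)) \<and>
     \<comment> \<open>Y_W(1,x) = 1_W\<close>
     (\<forall>k w. YW vac k w = (if k = 0 then w else 0)) \<and>
     \<comment> \<open>phi-locality and phi-associativity\<close>
     (\<forall>u v. Fin u \<longrightarrow> Fin v \<longrightarrow> (\<exists>K::nat. \<forall>w.
        (\<exists>N. \<forall>a b. (a < N \<or> b < N) \<longrightarrow> Pc sc YW K u v w a b = 0) \<and>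
        (\<forall>N N'. (\<forall>a b. (a < N \<or> b < N) \<longrightarrow> Pc sc YW K u v w a b = 0) \<longrightarrow>
                (\<forall>j\<ge>N'. eq (Yv u j v) 0) \<longrightarrow>
                (\<forall>c p. phiL sc Yv YW K u v w N' c p = phiR sc YW K u v w N c p)))))"

text \<open>Y_W((T^m)_{-1} 1, x) = T_m(x) = sum_n t1^m t2^n x^(-n), likewise for E.\<close>
definition gen_fields :: "(int \<Rightarrow> int \<Rightarrow> 'w \<Rightarrow> 'w::zero) \<Rightarrow> (int \<Rightarrow> int \<Rightarrow> 'w \<Rightarrow> 'w) \<Rightarrow>
                          (tv \<Rightarrow> int \<Rightarrow> 'w \<Rightarrow> 'w) \<Rightarrow> bool" where
  "gen_fields tact eact YW \<longleftrightarrow>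
     (\<forall>m k w. YW (mono [HT m (-1)]) k w = zact tact m (- k) w \<and>
              YW (mono [HE m (-1)]) k w = zact eact m (- k) w)"

end

theory Submission
  imports Defs "HOL-Library.Groups_Big_Fun" "HOL-Computational_Algebra.Formal_Laurent_Series"
begin

text \<open>For local fields \<open>a\<close>, \<open>b\<close> on \<open>W\<close> put \<open>z = x1/x - 1\<close> and pair \<open>a(x1) b(x) - b(x) a(x1)\<close> with powers of \<open>z\<close>,
  expanded in the two opposite domains, by taking the residue of \<open>dx1/x1\<close>. Locality kills high powers of
  \<open>z\<close>, so the pairing extends to Laurent series in \<open>z\<close>, in particular to powers of \<open>t = log (1 + z)\<close>;
  the pairing with \<open>t^n\<close> is the \<open>n\<close>-th product \<open>a_n b\<close> belonging to \<open>\<phi>(x, t) = x e^t\<close>.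

  Products of local fields are again local (Dong), and
  \<open>[a_m, b_n] c = (\<Sum>i. (m choose i) (a_i b)_(m+n-i) c)\<close>. For the generating fields \<open>T_m(x)\<close>, \<open>E_m(x)\<close> this
  reproduces the brackets of the affinized algebra, whence a linear map from its vacuum module to local
  fields. It respects the products \<open>u_n v\<close>: for \<open>v = 1\<close> because translation goes to \<open>x d/dx\<close>, and the
  step from \<open>v\<close> to \<open>a_m v\<close>, with \<open>a\<close> a generator, is the commutator formula on both sides. Substituting
  \<open>x1 = x e^t\<close> in the definition of the products gives associativity. Conversely, associativity
  determines \<open>Y_W(u_n v, x)\<close> from \<open>Y_W(u, x)\<close> and \<open>Y_W(v, x)\<close>, which gives uniqueness.\<close>

text \<open>The logarithm \<open>log y\<close> has no Laurent expansion in \<open>y\<close> at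
  infinity or at 0, so its powers cannot be paired with \<open>a(x1) b(x)\<close> and
  \<open>b(x) a(x1)\<close> directly. Integer powers of \<open>y - 1\<close> have both expansions.
  Identities are therefore proved for each power of \<open>y - 1\<close> and then summed with the
  coefficients of a Laurent series; locality makes the sum finite. Fixing the total power of
  \<open>x\<close> leaves series in the single variable \<open>y = x1/x\<close>.

  The coordinate \<open>z\<close> is not additive, and its commutator formula carries stray factors
  \<open>(1 + z)^i\<close>. Taylor expansion of the logarithm absorbs exactly these, which is why
  the products formed with \<open>t\<close> obey the ordinary commutator formula.

  The products \<open>u_n v\<close> are known only through the vertex algebra axioms and the action
  of the generators, so every compatibility statement comes from the Jacobi identity and induction
  on words. For uniqueness, the two modules may come with different exponents \<open>K\<close>;
  associativity is carried to a common exponent before coefficients are compared.\<close>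

unbundle fps_syntax

section \<open>Sums of finite support\<close>

lemma Sum_any_Sum_any_pair:
  fixes G :: "'a \<Rightarrow> 'b \<Rightarrow> 'c::comm_monoid_add"
  assumes "finite {(k, l). G k l \<noteq> 0}"
  shows "Sum_any (\<lambda>k. Sum_any (G k)) = Sum_any (\<lambda>(k, l). G k l)"
proof (rule Sum_any.cartesian_product)
  let ?S = "{(k, l). G k l \<noteq> 0}"
  show "finite (fst ` ?S \<times> snd ` ?S)" using assms by simp
  show "{a. \<exists>b. G a b \<noteq> 0} \<times> {b. \<exists>a. G a b \<noteq> 0} \<subseteq> fst ` ?S \<times> snd ` ?S"
    by (force simp: image_iff)
qed

lemma Sum_any_reindex_shift:
  fixes f :: "int \<Rightarrow> 'c::comm_monoid_add"
  shows "Sum_any (\<lambda>k. f (k + c)) = Sum_any f"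
  by (rule Sum_any.reindex_cong[symmetric, of "\<lambda>k. k + c"])
     (auto intro!: bijI injI simp: surj_def intro: exI[of _ "_ - c"] simp: algebra_simps fun_eq_iff)

lemma Sum_any_uminus:
  fixes f :: "'b \<Rightarrow> 'c::ab_group_add"
  shows "Sum_any (\<lambda>k. - f k) = - Sum_any f"
  by (simp add: Sum_any.expand_set sum_negf)

lemma Sum_any_diff:
  fixes f g :: "'b \<Rightarrow> 'c::ab_group_add"
  assumes "finite {k. f k \<noteq> 0}" "finite {k. g k \<noteq> 0}"
  shows "Sum_any (\<lambda>k. f k - g k) = Sum_any f - Sum_any g"
proof -
  have "Sum_any (\<lambda>k. f k + - g k) = Sum_any f + Sum_any (\<lambda>k. - g k)"
    using assms by (intro Sum_any.distrib) auto
  then show ?thesis by (simp add: Sum_any_uminus)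
qed

section \<open>Expansions of powers of \<open>y - 1\<close>\<close>

text \<open>\<open>cA j k\<close> and \<open>cB j k\<close> are the coefficients of \<open>y^(-k)\<close> in the expansions of \<open>(y - 1)^j\<close>
  at infinity and at 0, respectively.\<close>

definition cA :: "int \<Rightarrow> int \<Rightarrow> complex" where
  "cA j k = (if j + k \<ge> 0 then (-1) ^ nat (j + k) * (of_int j gchoose nat (j + k)) else 0)"

definition cB :: "int \<Rightarrow> int \<Rightarrow> complex" where
  "cB j k = (-1) powi j * cA j (- j - k)"

lemma cA_eq_0: "k < - j \<Longrightarrow> cA j k = 0"
  by (simp add: cA_def)

lemma cB_eq_0: "k > 0 \<Longrightarrow> cB j k = 0"
  by (simp add: cB_def cA_def)

lemma cA_0: "cA 0 k = (if k = 0 then 1 else 0)"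
  by (auto simp: cA_def gbinomial_0_left)

lemma cB_0: "cB 0 k = (if k = 0 then 1 else 0)"
  by (simp add: cB_def cA_0)

lemma cA_neg_1: "cA (-1) k = (if k \<ge> 1 then 1 else 0)"
proof -
  have "(-1 gchoose n :: complex) = (-1) ^ n" for n
    using gbinomial_minus[of "1::complex" n] by (simp flip: binomial_gbinomial)
  then show ?thesis by (auto simp: cA_def simp flip: power_mult_distrib)
qed

lemma cB_neg_1: "cB (-1) k = (if k \<le> 0 then -1 else 0)"
  by (auto simp: cB_def cA_neg_1 power_int_minus)

lemma cA_rec: "cA (j + 1) k = cA j (k + 1) - cA j k"
proof -
  consider "j + k < -1" | "j + k = -1" | "j + k \<ge> 0" by linarith
  then show ?thesis
  proof cases
    case 3
    then obtain s where s: "j + k = int s" by (metis nonneg_int_cases)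
    have "nat (j + 1 + k) = Suc s" "nat (j + (k + 1)) = Suc s" "nat (j + k) = s"
      using s by linarith+
    then show ?thesis
      using 3 gbinomial_Suc_Suc[of "of_int j :: complex" s] by (simp add: cA_def ring_distribs)
  qed (simp_all add: cA_def)
qed

lemma cB_rec: "cB (j + 1) k = cB j (k + 1) - cB j k"
proof -
  have "cA (j + 1) (- (j + 1) - k) = cA j (- j - k) - cA j (- j - (k + 1))"
    using cA_rec[of j "- (j + 1) - k"] by (smt (verit))
  moreover have "(-1 :: complex) powi (j + 1) = - ((-1) powi j)" by (simp add: power_int_add)
  ultimately show ?thesis unfolding cB_def by (simp only: ring_distribs) simp
qed

lemma cA_convolution_support: "{k. cA m k * cA n (s - k) \<noteq> 0} \<subseteq> {- m..s + n}"
  using cA_eq_0 by (auto simp: not_less) (meson cA_eq_0 not_le_imp_less, smt (verit) cA_eq_0)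

lemma finite_cA_convolution: "finite {k. cA m k * cA n (s - k) \<noteq> 0}"
  by (rule finite_subset[OF cA_convolution_support]) simp

text \<open>Coefficient form of \<open>(y - 1)^m (y - 1)^n = (y - 1)^(m + n)\<close> at infinity;
  written in binomials this is Vandermonde's identity.\<close>

lemma cA_convolution: "Sum_any (\<lambda>k. cA m k * cA n (s - k)) = cA (m + n) s"
proof -
  have "Sum_any (\<lambda>k. cA m k * cA n (s - k)) = (\<Sum>k\<in>{- m..s + n}. cA m k * cA n (s - k))"
    by (rule Sum_any.expand_superset[OF _ cA_convolution_support]) simp
  also have "\<dots> = cA (m + n) s"
  proof (cases "m + n + s \<ge> 0")
    case True
    then obtain t where t: "m + n + s = int t" by (metis nonneg_int_cases)
    have "(\<Sum>k\<in>{- m..s + n}. cA m k * cA n (s - k)) =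
        (\<Sum>i\<in>{0..t}. cA m (int i - m) * cA n (s - (int i - m)))"
      by (rule sum.reindex_bij_witness[of _ "\<lambda>i. int i - m" "\<lambda>k. nat (k + m)"]) (use t in auto)
    also have "\<dots> = (\<Sum>i\<in>{0..t}. (-1) ^ t * ((of_int m gchoose i) * (of_int n gchoose (t - i))))"
    proof (rule sum.cong[OF refl])
      fix i assume i: "i \<in> {0..t}"
      have "nat (n + (s - (int i - m))) = t - i" using t i by auto
      moreover have "n + (s - (int i - m)) \<ge> 0" using t i by auto
      ultimately show "cA m (int i - m) * cA n (s - (int i - m)) =
          (-1) ^ t * ((of_int m gchoose i) * (of_int n gchoose (t - i)))"
        using i by (simp add: cA_def flip: power_add mult.assoc)
    qed
    also have "\<dots> = (-1) ^ t * ((of_int m + of_int n) gchoose t)"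
      by (simp add: gbinomial_Vandermonde flip: sum_distrib_left)
    also have "\<dots> = cA (m + n) s" using t by (simp add: cA_def)
    finally show ?thesis .
  qed (simp add: cA_def)
  finally show ?thesis .
qed

text \<open>Under \<open>y -> 1/y\<close> the power \<open>(y - 1)^j\<close> becomes
  \<open>(-1)^j y^(-j) (y - 1)^j\<close>, which exchanges infinity and 0. This is how
  \<open>cB\<close> arises from \<open>cA\<close>, and the reflection \<open>k -> - m - k\<close>
  carries the convolution over.\<close>

lemma cB_convolution: "Sum_any (\<lambda>k. cB m k * cB n (s - k)) = cB (m + n) s"
proof -
  have "Sum_any (\<lambda>k. cB m k * cB n (s - k)) =
      Sum_any (\<lambda>k. (-1) powi (m + n) * (cA m k * cA n (- (m + n) - s - k)))"
  proof (rule Sum_any.reindex_cong[of "\<lambda>k. - m - k"])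
    show "bij (\<lambda>k::int. - m - k)" by (rule bijI') (auto intro: exI[of _ "- m - _"])
  qed (auto simp: cB_def fun_eq_iff power_int_add algebra_simps)
  also have "\<dots> = (-1) powi (m + n) * Sum_any (\<lambda>k. cA m k * cA n (- (m + n) - s - k))"
    by (rule Sum_any_right_distrib[OF finite_cA_convolution, symmetric])
  finally show ?thesis by (simp add: cA_convolution cB_def)
qed

lemma finite_cB_convolution: "finite {k. cB m k * cB n (s - k) \<noteq> 0}"
proof (rule finite_subset[of _ "{s..0}"])
  have "s - k \<le> 0 \<and> k \<le> 0" if "cB m k \<noteq> 0" "cB n (s - k) \<noteq> 0" for k
    using that by (meson cB_eq_0 not_le_imp_less)
  then show "{k. cB m k * cB n (s - k) \<noteq> 0} \<subseteq> {s..0}" by force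
qed simp

text \<open>Both sides are the coefficient of \<open>y^(-k-i)\<close> in the \<open>i\<close>-th
  divided derivative of \<open>(y - 1)^m\<close>, taken termwise on the left and in closed form on
  the right.\<close>

lemma cA_absorb: "(of_int (- k) gchoose i) * cA m k = (of_int m gchoose i) * cA (m - int i) (k + int i)"
proof (cases "m + k \<ge> 0")
  case True
  then obtain s where s: "m + k = int s" by (metis nonneg_int_cases)
  have k: "of_int (- k) = (of_int m - of_nat s :: complex)"
    using arg_cong[OF s, of "of_int :: int \<Rightarrow> complex"] by (simp add: algebra_simps)
  have "(of_int m gchoose s) * (of_int m - of_nat s gchoose i) =
      (of_int m gchoose (s + i)) * (of_nat (s + i) gchoose s :: complex)"
    using gbinomial_trinomial_revision[of s "s + i" "of_int m :: complex"] by simp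
  also have "(of_nat (s + i) gchoose s :: complex) = of_nat (s + i) gchoose i"
    using gbinomial_of_nat_symmetric[of s "s + i", where 'a = complex] by simp
  also have "(of_int m gchoose (s + i)) * (of_nat (s + i) gchoose i :: complex) =
      (of_int m gchoose i) * (of_int m - of_nat i gchoose s)"
    using gbinomial_trinomial_revision[of i "s + i" "of_int m :: complex"] by simp
  finally show ?thesis using s k by (simp add: cA_def mult.commute)
qed (simp add: cA_def)

lemma cB_absorb: "(of_int (- k) gchoose i) * cB m k = (of_int m gchoose i) * cB (m - int i) (k + int i)"
proof (cases "k \<le> 0")
  case True
  then obtain s where s: "- k = int s" by (metis neg_0_le_iff_le nonneg_int_cases)
  have k: "of_int (- k) = (of_nat s :: complex)" "k = - int s" using s by simp_all
  show ?thesis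
  proof (cases "i \<le> s")
    case True
    then have "nat (int s - int i) = s - i" by simp
    moreover have "(-1) powi m * (-1 :: complex) ^ s = (-1) powi (m - int i) * (-1) ^ (s - i)"
      using True by (simp add: power_int_diff power_diff divide_simps)
    ultimately show ?thesis
      using gbinomial_trinomial_revision[OF True, of "of_int m :: complex"] True
      by (simp add: cB_def cA_def k algebra_simps)
  next
    case False
    then show ?thesis by (simp add: cB_def cA_def k flip: binomial_gbinomial)
  qed
next
  case False
  then have "cB (m - int i) (k + int i) = 0" by (intro cB_eq_0) auto
  then show ?thesis using False by (simp add: cB_eq_0)
qed

section \<open>Residue functionals\<close>

text \<open>A function \<open>L\<close> on the integers stands for the series with coefficient \<open>L k\<close> at \<open>y^k\<close>;
  \<open>dl\<close> is then multiplication by \<open>y - 1\<close>.\<close>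

definition dl :: "(int \<Rightarrow> 'w::ab_group_add) \<Rightarrow> int \<Rightarrow> 'w" where
  "dl L k = L (k - 1) - L k"

text \<open>For a fixed power of \<open>x\<close>, the powers of \<open>y\<close> are bounded above
  in \<open>a(xy) b(x) w\<close> and below in \<open>b(x) a(xy) w\<close>. These shapes match the
  expansions at infinity and at 0, so the residues are finite sums.\<close>

definition upz :: "(int \<Rightarrow> 'w::zero) \<Rightarrow> bool" where
  "upz L \<longleftrightarrow> (\<exists>U. \<forall>k>U. L k = 0)"

definition dnz :: "(int \<Rightarrow> 'w::zero) \<Rightarrow> bool" where
  "dnz L \<longleftrightarrow> (\<exists>U. \<forall>k<U. L k = 0)"

lemma upzI: "(\<And>k. k > U \<Longrightarrow> L k = 0) \<Longrightarrow> upz L"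
  by (auto simp: upz_def)

lemma dnzI: "(\<And>k. k < U \<Longrightarrow> L k = 0) \<Longrightarrow> dnz L"
  by (auto simp: dnz_def)

lemma upz_combine:
  assumes "upz L" "upz M" "\<And>k. L k = 0 \<Longrightarrow> M k = 0 \<Longrightarrow> N k = 0"
  shows "upz N"
proof -
  from assms(1,2) obtain U V where "\<forall>k>U. L k = 0" "\<forall>k>V. M k = 0" by (auto simp: upz_def)
  then show ?thesis by (intro upzI[of "max U V"] assms(3)) auto
qed

lemma dnz_combine:
  assumes "dnz L" "dnz M" "\<And>k. L k = 0 \<Longrightarrow> M k = 0 \<Longrightarrow> N k = 0"
  shows "dnz N"
proof -
  from assms(1,2) obtain U V where "\<forall>k<U. L k = 0" "\<forall>k<V. M k = 0" by (auto simp: dnz_def)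
  then show ?thesis by (intro dnzI[of "min U V"] assms(3)) auto
qed

lemma upz_shift: "upz L \<Longrightarrow> upz (\<lambda>k. L (k + c))"
  unfolding upz_def by (elim exE, rule_tac x = "U - c" in exI) auto

lemma dnz_shift: "dnz L \<Longrightarrow> dnz (\<lambda>k. L (k + c))"
  unfolding dnz_def by (elim exE, rule_tac x = "U - c" in exI) auto

lemma upz_dl: "upz L \<Longrightarrow> upz (dl L)"
  by (rule upz_combine[OF upz_shift[of L "-1"]]) (auto simp: dl_def)

lemma dnz_dl: "dnz L \<Longrightarrow> dnz (dl L)"
  by (rule dnz_combine[OF dnz_shift[of L "-1"]]) (auto simp: dl_def)

lemma upz_dl_pow: "upz L \<Longrightarrow> upz ((dl ^^ n) L)"
  by (induction n) (auto intro: upz_dl)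

lemma dnz_dl_pow: "dnz L \<Longrightarrow> dnz ((dl ^^ n) L)"
  by (induction n) (auto intro: dnz_dl)

lemma dl_pow_add: "(dl ^^ n) (\<lambda>k. L k + M k) = (\<lambda>k. (dl ^^ n) L k + (dl ^^ n) M k)"
  by (induction n) (auto simp: dl_def fun_eq_iff)

lemma dl_pow_diff: "(dl ^^ n) (\<lambda>k. L k - M k) = (\<lambda>k. (dl ^^ n) L k - (dl ^^ n) M k)"
  by (induction n) (auto simp: dl_def fun_eq_iff)

lemma dl_pow_shift: "(dl ^^ n) (\<lambda>k. L (k + c)) = (\<lambda>k. (dl ^^ n) L (k + c))"
  by (induction n) (auto simp: dl_def fun_eq_iff algebra_simps)

lemma dl_pow_zero: "(dl ^^ n) (\<lambda>k. 0) = (\<lambda>k. 0)"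
  by (induction n) (auto simp: dl_def fun_eq_iff)

lemma dl_pow_sum: "(dl ^^ n) (\<lambda>k. \<Sum>i\<in>I. L i k) = (\<lambda>k. \<Sum>i\<in>I. (dl ^^ n) (L i) k)"
  by (induction I rule: infinite_finite_induct) (auto simp: dl_pow_zero dl_pow_add)

lemma dl_pow_eq_0_mono:
  assumes "\<forall>k. (dl ^^ n) L k = 0" "n \<le> m"
  shows "(dl ^^ m) L k = 0"
proof -
  have "(dl ^^ m) L = (dl ^^ (m - n + n)) L" using assms(2) by simp
  also have "\<dots> = (dl ^^ (m - n)) ((dl ^^ n) L)" by (simp only: funpow_add comp_apply)
  also have "(dl ^^ n) L = (\<lambda>k. 0)" using assms(1) by auto
  finally show ?thesis by (simp add: dl_pow_zero)
qed

lemma dl_pow_commute: "(dl ^^ m) ((dl ^^ n) L) = (dl ^^ n) ((dl ^^ m) L)"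
proof -
  have "(dl ^^ m) ((dl ^^ n) L) = (dl ^^ (m + n)) L" by (simp only: funpow_add comp_apply)
  also have "\<dots> = (dl ^^ (n + m)) L" by (simp only: add.commute)
  also have "\<dots> = (dl ^^ n) ((dl ^^ m) L)" by (simp only: funpow_add comp_apply)
  finally show ?thesis .
qed

text \<open>Reflection is \<open>y -> 1/y\<close>, and \<open>1/y - 1 = - (y - 1) / y\<close>: each
  factor costs a sign and a shift.\<close>

lemma dl_pow_reflect: "(dl ^^ n) (\<lambda>k. L (p - k)) k = (if even n then id else uminus) ((dl ^^ n) L (p - k + int n))"
  by (induction n arbitrary: k) (auto simp: dl_def algebra_simps)

section \<open>Linear maps and weighted sums of vector coefficients\<close>

locale complex_space = vector_space sc for sc :: "complex \<Rightarrow> 'w::ab_group_add \<Rightarrow> 'w"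
begin

definition lin :: "('w \<Rightarrow> 'w) \<Rightarrow> bool" where
  "lin h \<longleftrightarrow> (\<forall>v w. h (v + w) = h v + h w) \<and> (\<forall>c w. h (sc c w) = sc c (h w))"

lemma lin_add: "lin h \<Longrightarrow> h (v + w) = h v + h w"
  and lin_scale: "lin h \<Longrightarrow> h (sc c w) = sc c (h w)"
  by (auto simp: lin_def)

lemma lin_0: "lin h \<Longrightarrow> h 0 = 0"
  using lin_scale[of h 0 0] by simp

lemma lin_minus: "lin h \<Longrightarrow> h (- w) = - h w"
  using lin_scale[of h "-1" w] by simp

lemma lin_diff: "lin h \<Longrightarrow> h (v - w) = h v - h w"
  using lin_add[of h v "- w"] by (simp add: lin_minus)

lemma lin_sum: "lin h \<Longrightarrow> h (\<Sum>i\<in>I. f i) = (\<Sum>i\<in>I. h (f i))"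
  by (induction I rule: infinite_finite_induct) (auto simp: lin_0 lin_add)

definition wsum :: "(int \<Rightarrow> complex) \<Rightarrow> (int \<Rightarrow> 'w) \<Rightarrow> 'w" where
  "wsum \<alpha> L = Sum_any (\<lambda>k. sc (\<alpha> k) (L k))"

text \<open>\<open>Sum_any\<close> returns 0 on infinite support; this condition excludes that
  default by asking for a finite overlap of weights and series.\<close>

definition fsupp :: "(int \<Rightarrow> complex) \<Rightarrow> (int \<Rightarrow> 'w) \<Rightarrow> bool" where
  "fsupp \<alpha> L \<longleftrightarrow> finite {k. \<alpha> k \<noteq> 0 \<and> L k \<noteq> 0}"

lemma fsuppI: "(\<And>k. \<alpha> k \<noteq> 0 \<Longrightarrow> L k \<noteq> 0 \<Longrightarrow> a \<le> k \<and> k \<le> b) \<Longrightarrow> fsupp \<alpha> L"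
  unfolding fsupp_def by (rule finite_subset[of _ "{a..b}"]) auto

lemma wsum_eq:
  assumes "\<And>k. \<alpha> k \<noteq> 0 \<Longrightarrow> L k \<noteq> 0 \<Longrightarrow> k \<in> I" "finite I"
  shows "wsum \<alpha> L = (\<Sum>k\<in>I. sc (\<alpha> k) (L k))"
  unfolding wsum_def by (rule Sum_any.expand_superset) (use assms in auto)

lemma wsum_cong: "(\<And>k. \<alpha> k = \<beta> k) \<Longrightarrow> (\<And>k. L k = M k) \<Longrightarrow> wsum \<alpha> L = wsum \<beta> M"
  by (simp add: wsum_def)

lemma wsum_add:
  assumes "fsupp \<alpha> L" "fsupp \<alpha> M"
  shows "wsum \<alpha> (\<lambda>k. L k + M k) = wsum \<alpha> L + wsum \<alpha> M"
  unfolding wsum_def scale_right_distrib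
  by (rule Sum_any.distrib) (use assms in \<open>auto simp: fsupp_def\<close>)

lemma wsum_diff:
  assumes "fsupp \<alpha> L" "fsupp \<alpha> M"
  shows "wsum \<alpha> (\<lambda>k. L k - M k) = wsum \<alpha> L - wsum \<alpha> M"
  unfolding wsum_def scale_right_diff_distrib
  by (rule Sum_any_diff) (use assms in \<open>auto simp: fsupp_def\<close>)

lemma wsum_add_left:
  assumes "fsupp \<alpha> L" "fsupp \<beta> L"
  shows "wsum (\<lambda>k. \<alpha> k + \<beta> k) L = wsum \<alpha> L + wsum \<beta> L"
  unfolding wsum_def scale_left_distrib
  by (rule Sum_any.distrib) (use assms in \<open>auto simp: fsupp_def\<close>)

lemma fsupp_add_left:
  assumes "fsupp \<alpha> L" "fsupp \<beta> L"
  shows "fsupp (\<lambda>k. \<alpha> k + \<beta> k) L"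
  unfolding fsupp_def
  by (rule finite_subset[OF _ finite_UnI[OF assms[unfolded fsupp_def]]]) auto

lemma wsum_diff_left:
  assumes "fsupp \<alpha> L" "fsupp \<beta> L"
  shows "wsum (\<lambda>k. \<alpha> k - \<beta> k) L = wsum \<alpha> L - wsum \<beta> L"
  unfolding wsum_def scale_left_diff_distrib
  by (rule Sum_any_diff) (use assms in \<open>auto simp: fsupp_def\<close>)

lemma lin_wsum:
  assumes "lin h" "fsupp \<alpha> L"
  shows "h (wsum \<alpha> L) = wsum \<alpha> (\<lambda>k. h (L k))"
proof -
  have "wsum \<alpha> (\<lambda>k. h (L k)) = (\<Sum>k\<in>{k. \<alpha> k \<noteq> 0 \<and> L k \<noteq> 0}. sc (\<alpha> k) (h (L k)))"
    by (rule wsum_eq) (use assms in \<open>auto simp: fsupp_def lin_0\<close>)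
  moreover have "wsum \<alpha> L = (\<Sum>k\<in>{k. \<alpha> k \<noteq> 0 \<and> L k \<noteq> 0}. sc (\<alpha> k) (L k))"
    by (rule wsum_eq) (use assms in \<open>auto simp: fsupp_def\<close>)
  ultimately show ?thesis using assms(1) by (simp add: lin_sum lin_scale)
qed

lemma lin_sc: "lin (sc c)"
  by (simp add: lin_def scale_right_distrib mult.commute)

lemma wsum_scale: "fsupp \<alpha> L \<Longrightarrow> wsum \<alpha> (\<lambda>k. sc c (L k)) = sc c (wsum \<alpha> L)"
  by (simp add: lin_wsum[OF lin_sc])

lemma wsum_scale_left: "fsupp \<alpha> L \<Longrightarrow> wsum (\<lambda>k. c * \<alpha> k) L = sc c (wsum \<alpha> L)"
  by (simp add: lin_wsum[OF lin_sc]) (simp add: wsum_def mult.commute)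

lemma wsum_mult_swap: "wsum (\<lambda>k. \<alpha> k * \<beta> k) L = wsum \<alpha> (\<lambda>k. sc (\<beta> k) (L k))"
  by (simp add: wsum_def)

lemma wsum_shift: "wsum \<alpha> (\<lambda>k. L (k + c)) = wsum (\<lambda>k. \<alpha> (k - c)) L"
  unfolding wsum_def
  using Sum_any_reindex_shift[of "\<lambda>k. sc (\<alpha> (k - c)) (L k)" c] by simp

lemma fsupp_shift: "fsupp (\<lambda>k. \<alpha> (k + c)) L \<longleftrightarrow> fsupp \<alpha> (\<lambda>k. L (k - c))"
proof -
  have "bij_betw (\<lambda>k. k + c) {k. \<alpha> (k + c) \<noteq> 0 \<and> L k \<noteq> 0} {k. \<alpha> k \<noteq> 0 \<and> L (k - c) \<noteq> 0}"
    by (rule bij_betw_byWitness[of _ "\<lambda>k. k - c"]) auto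
  then show ?thesis unfolding fsupp_def by (rule bij_betw_finite)
qed

text \<open>Summability of the partial sums travels with the equation, since additivity asks for it
  at each insertion.\<close>

lemma wsum_sum:
  assumes "\<And>i. i \<in> I \<Longrightarrow> fsupp \<alpha> (L i)"
  shows "wsum \<alpha> (\<lambda>k. \<Sum>i\<in>I. L i k) = (\<Sum>i\<in>I. wsum \<alpha> (L i)) \<and> (finite I \<longrightarrow> fsupp \<alpha> (\<lambda>k. \<Sum>i\<in>I. L i k))"
  using assms
proof (induction I rule: infinite_finite_induct)
  case (insert i I)
  then have *: "fsupp \<alpha> (\<lambda>k. \<Sum>i\<in>I. L i k)" "fsupp \<alpha> (L i)" by auto
  moreover have "fsupp \<alpha> (\<lambda>k. L i k + (\<Sum>i\<in>I. L i k))"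
    unfolding fsupp_def
    by (rule finite_subset[OF _ finite_UnI[OF *[unfolded fsupp_def]]]) auto
  ultimately show ?case using insert by (simp add: wsum_add)
qed (auto simp: wsum_def fsupp_def)

lemma fsupp_cA: "upz L \<Longrightarrow> fsupp (cA j) L"
proof -
  assume "upz L"
  then obtain U where U: "\<forall>k>U. L k = 0" by (auto simp: upz_def)
  show ?thesis by (rule fsuppI[of _ _ "-j" U]) (meson U cA_eq_0 not_le_imp_less)
qed

lemma fsupp_cB: "dnz L \<Longrightarrow> fsupp (cB j) L"
proof -
  assume "dnz L"
  then obtain U where U: "\<forall>k<U. L k = 0" by (auto simp: dnz_def)
  show ?thesis by (rule fsuppI[of _ _ U 0]) (meson U cB_eq_0 not_le_imp_less)
qed

text \<open>The residue of \<open>(y - 1)^j (L(y) - R(y)) dy/y\<close>, where \<open>(y - 1)^j\<close> is expanded at infinity in the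
  first term and at 0 in the second.\<close>

definition Lam :: "int \<Rightarrow> (int \<Rightarrow> 'w) \<Rightarrow> (int \<Rightarrow> 'w) \<Rightarrow> 'w" where
  "Lam j L R = wsum (cA j) L - wsum (cB j) R"

lemma Lam_add:
  assumes "upz L" "dnz R" "upz L'" "dnz R'"
  shows "Lam j (\<lambda>k. L k + L' k) (\<lambda>k. R k + R' k) = Lam j L R + Lam j L' R'"
  using assms by (simp add: Lam_def wsum_add fsupp_cA fsupp_cB)

lemma Lam_diff:
  assumes "upz L" "dnz R" "upz L'" "dnz R'"
  shows "Lam j (\<lambda>k. L k - L' k) (\<lambda>k. R k - R' k) = Lam j L R - Lam j L' R'"
  using assms by (simp add: Lam_def wsum_diff fsupp_cA fsupp_cB)

lemma lin_Lam:
  assumes "upz L" "dnz R" "lin h"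
  shows "h (Lam j L R) = Lam j (\<lambda>k. h (L k)) (\<lambda>k. h (R k))"
  using assms by (simp add: Lam_def lin_diff lin_wsum fsupp_cA fsupp_cB)

lemma Lam_sum:
  assumes "\<And>i. i \<in> I \<Longrightarrow> upz (L i)" "\<And>i. i \<in> I \<Longrightarrow> dnz (R i)"
  shows "Lam j (\<lambda>k. \<Sum>i\<in>I. L i k) (\<lambda>k. \<Sum>i\<in>I. R i k) = (\<Sum>i\<in>I. Lam j (L i) (R i))"
  using assms by (simp add: Lam_def wsum_sum fsupp_cA fsupp_cB sum_subtractf)

lemma Lam_shift:
  "Lam j (\<lambda>k. L (k + c)) (\<lambda>k. R (k + c)) = wsum (\<lambda>k. cA j (k - c)) L - wsum (\<lambda>k. cB j (k - c)) R"
  by (simp add: Lam_def wsum_shift)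

text \<open>The shift is multiplication by \<open>y = (y - 1) + 1\<close>.\<close>

lemma Lam_shift_1:
  assumes "upz L" "dnz R"
  shows "Lam j (\<lambda>k. L (k - 1)) (\<lambda>k. R (k - 1)) = Lam (j + 1) L R + Lam j L R"
proof -
  have "Lam j (\<lambda>k. L (k + -1)) (\<lambda>k. R (k + -1)) =
      wsum (\<lambda>k. cA (j + 1) k + cA j k) L - wsum (\<lambda>k. cB (j + 1) k + cB j k) R"
    unfolding Lam_shift by (simp add: cA_rec cB_rec)
  also have "\<dots> = Lam (j + 1) L R + Lam j L R"
    using assms by (subst (1 2) wsum_add_left) (auto simp: Lam_def fsupp_cA fsupp_cB)
  finally show ?thesis by simp
qed

lemma Lam_dl:
  assumes "upz L" "dnz R"
  shows "Lam j (dl L) (dl R) = Lam (j + 1) L R"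
proof -
  have "Lam j (dl L) (dl R) = Lam j (\<lambda>k. L (k - 1) - L k) (\<lambda>k. R (k - 1) - R k)"
    by (simp add: dl_def[abs_def])
  also have "\<dots> = Lam j (\<lambda>k. L (k - 1)) (\<lambda>k. R (k - 1)) - Lam j L R"
    using upz_shift[of L "-1"] dnz_shift[of R "-1"] assms by (intro Lam_diff) auto
  finally show ?thesis using assms by (simp add: Lam_shift_1)
qed

text \<open>Integration by parts: \<open>- y d/dy\<close> on the series becomes
  \<open>y d/dy\<close> on \<open>(y - 1)^j\<close>, which gives
  \<open>j ((y - 1)^j + (y - 1)^(j - 1))\<close>.\<close>

lemma Lam_mult_index:
  assumes "upz L" "dnz R"
  shows "Lam j (\<lambda>k. sc (- of_int k) (L k)) (\<lambda>k. sc (- of_int k) (R k)) =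
    sc (of_int j) (Lam j L R + Lam (j - 1) L R)"
proof -
  have A: "cA j k * - of_int k = of_int j * (cA j k + cA (j - 1) k)" for k
    using cA_absorb[of k 1 j] cA_rec[of "j - 1" k] by (simp add: algebra_simps)
  have B: "cB j k * - of_int k = of_int j * (cB j k + cB (j - 1) k)" for k
    using cB_absorb[of k 1 j] cB_rec[of "j - 1" k] by (simp add: algebra_simps)
  have fA: "fsupp (\<lambda>k. cA j k + cA (j - 1) k) L"
    using assms by (intro fsupp_add_left fsupp_cA)
  have fB: "fsupp (\<lambda>k. cB j k + cB (j - 1) k) R"
    using assms by (intro fsupp_add_left fsupp_cB)
  show ?thesis
    unfolding Lam_def wsum_mult_swap[symmetric] A B wsum_scale_left[OF fA] wsum_scale_left[OF fB]
    using assms by (subst (1 2) wsum_add_left)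
      (auto simp: fsupp_cA fsupp_cB algebra_simps scale_right_distrib scale_right_diff_distrib)
qed

text \<open>For a nonnegative exponent both expansions are the same polynomial, so only
  \<open>L - R\<close> enters, and the residue against \<open>dy/y\<close> reads off the coefficient
  at 0.\<close>

lemma Lam_nat:
  assumes "upz L" "dnz R"
  shows "Lam (int n) L R = (dl ^^ n) (\<lambda>k. L k - R k) 0"
  using assms
proof (induction n arbitrary: L R)
  case 0
  have "wsum (\<lambda>k. if k = 0 then 1 else 0) M = M 0" for M
    by (subst wsum_eq[of _ _ "{0}"]) (auto split: if_splits)
  then show ?case by (simp add: Lam_def cA_0[abs_def] cB_0[abs_def])
next
  case (Suc n)
  have "Lam (int (Suc n)) L R = Lam (int n) (dl L) (dl R)"
    using Lam_dl[OF Suc.prems, of "int n"] by (simp add: add.commute)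
  also have "\<dots> = (dl ^^ n) (\<lambda>k. dl L k - dl R k) 0" by (intro Suc upz_dl dnz_dl)
  also have "(\<lambda>k. dl L k - dl R k) = dl (\<lambda>k. L k - R k)" by (auto simp: dl_def)
  finally show ?case by (simp add: funpow_swap1)
qed

section \<open>Pairs of series that become equal after multiplication by a power of
  \<open>y - 1\<close>\<close>

definition gpair :: "nat \<Rightarrow> (int \<Rightarrow> 'w) \<Rightarrow> (int \<Rightarrow> 'w) \<Rightarrow> bool" where
  "gpair K L R \<longleftrightarrow> upz L \<and> dnz R \<and> (\<forall>k. (dl ^^ K) (\<lambda>k. L k - R k) k = 0)"

lemma gpair_mono: "gpair K L R \<Longrightarrow> K \<le> K' \<Longrightarrow> gpair K' L R"
  by (auto simp: gpair_def intro: dl_pow_eq_0_mono)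

lemma gpair_add:
  assumes "gpair K L R" "gpair K L' R'"
  shows "gpair K (\<lambda>k. L k + L' k) (\<lambda>k. R k + R' k)"
proof -
  have *: "(\<lambda>k. L k + L' k - (R k + R' k)) = (\<lambda>k. (L k - R k) + (L' k - R' k))" by auto
  show ?thesis using assms unfolding gpair_def * dl_pow_add
    by (auto intro: upz_combine[of L L'] dnz_combine[of R R'])
qed

lemma upz_lin: "lin h \<Longrightarrow> upz L \<Longrightarrow> upz (\<lambda>k. h (L k))"
  unfolding upz_def by (metis lin_0)

lemma dnz_lin: "lin h \<Longrightarrow> dnz L \<Longrightarrow> dnz (\<lambda>k. h (L k))"
  unfolding dnz_def by (metis lin_0)

lemma dl_pow_lin: "lin h \<Longrightarrow> (dl ^^ n) (\<lambda>k. h (L k)) = (\<lambda>k. h ((dl ^^ n) L k))"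
  by (induction n) (auto simp: dl_def fun_eq_iff lin_diff)

lemma gpair_lin:
  assumes "gpair K L R" "lin h"
  shows "gpair K (\<lambda>k. h (L k)) (\<lambda>k. h (R k))"
  using assms dl_pow_lin[OF assms(2), of K "\<lambda>k. L k - R k"]
  by (auto simp: gpair_def upz_lin dnz_lin lin_diff lin_0)

lemma gpair_shift:
  assumes "gpair K L R"
  shows "gpair K (\<lambda>k. L (k + c)) (\<lambda>k. R (k + c))"
  using assms dl_pow_shift[of K "\<lambda>k. L k - R k" c]
  by (auto simp: gpair_def upz_shift dnz_shift)

lemma gpair_dl_pow:
  assumes "gpair K L R"
  shows "gpair K ((dl ^^ n) L) ((dl ^^ n) R)"
proof -
  have "(dl ^^ K) (\<lambda>k. (dl ^^ n) L k - (dl ^^ n) R k) = (dl ^^ n) ((dl ^^ K) (\<lambda>k. L k - R k))"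
    by (simp only: dl_pow_diff[symmetric] dl_pow_commute[of K n])
  moreover have "(dl ^^ K) (\<lambda>k. L k - R k) = (\<lambda>k. 0)" using assms by (auto simp: gpair_def)
  ultimately show ?thesis using assms by (auto simp: gpair_def dl_pow_zero upz_dl_pow dnz_dl_pow)
qed

text \<open>Multiplication by \<open>y - 1\<close> commutes with \<open>- y d/dy\<close> up to
  multiplication by \<open>y\<close>, so one extra factor makes up for one derivative.\<close>

lemma dl_pow_mult_index:
  assumes "\<forall>k. (dl ^^ n) L k = 0"
  shows "(dl ^^ Suc n) (\<lambda>k. sc (- of_int k) (L k)) k = 0"
  using assms
proof (induction n arbitrary: L k)
  case 0
  then show ?case by (simp add: dl_def)
next
  case (Suc n)
  have "dl (\<lambda>k. sc (- of_int k) (L k)) = (\<lambda>k. sc (- of_int k) (dl L k) + L (k + -1))"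
    by (auto simp: fun_eq_iff dl_def algebra_simps)
  then have "(dl ^^ Suc (Suc n)) (\<lambda>k. sc (- of_int k) (L k)) k =
      (dl ^^ Suc n) (\<lambda>k. sc (- of_int k) (dl L k)) k + (dl ^^ Suc n) L (k + -1)"
    by (subst funpow_Suc_right) (simp only: comp_apply dl_pow_add dl_pow_shift)
  moreover have "\<forall>k. (dl ^^ n) (dl L) k = 0" using Suc.prems by (simp add: funpow_swap1)
  ultimately show ?case using Suc.IH Suc.prems by simp
qed

lemma gpair_mult_index:
  assumes "gpair K L R"
  shows "gpair (Suc K) (\<lambda>k. sc (- of_int k) (L k)) (\<lambda>k. sc (- of_int k) (R k))"
  using assms dl_pow_mult_index[of K "\<lambda>k. L k - R k"]
  by (auto simp: gpair_def scale_right_diff_distrib intro: upz_combine[of L L] dnz_combine[of R R])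

lemma Lam_eq_0: "gpair K L R \<Longrightarrow> int K \<le> j \<Longrightarrow> Lam j L R = 0"
proof -
  assume *: "gpair K L R" "int K \<le> j"
  then obtain n where "j = int n" "K \<le> n" by (intro that[of "nat j"]) auto
  then show ?thesis using *(1) Lam_nat[of L R n] dl_pow_eq_0_mono[of K "\<lambda>k. L k - R k" n]
    by (auto simp: gpair_def)
qed

text \<open>\<open>dl\<close> is the forward difference in the variable \<open>- k\<close>, and a
  sequence with vanishing \<open>K\<close>-th difference is given by Newton's interpolation
  polynomial. Both sides agree at 0 and, by induction, have equal differences.\<close>

lemma newton_series:
  fixes F :: "int \<Rightarrow> 'w"
  assumes "\<forall>k. (dl ^^ K) F k = 0"
  shows "F k = (\<Sum>i<K. sc (of_int (- k) gchoose i) ((dl ^^ i) F 0))"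
  using assms
proof (induction K arbitrary: F k)
  case (Suc K)
  define G where "G = (\<lambda>k. \<Sum>i<Suc K. sc (of_int (- k) gchoose i) ((dl ^^ i) F 0))"
  have dG: "dl G k = dl F k" for k
  proof -
    have "dl G k = (\<Sum>i<Suc K. sc ((of_int (- (k - 1)) gchoose i) - (of_int (- k) gchoose i)) ((dl ^^ i) F 0))"
      by (simp only: dl_def G_def scale_left_diff_distrib sum_subtractf)
    also have "\<dots> = (\<Sum>i<K. sc ((of_int (- (k - 1)) gchoose Suc i) - (of_int (- k) gchoose Suc i)) ((dl ^^ Suc i) F 0))"
      by (subst sum.lessThan_Suc_shift) simp
    also have "\<dots> = (\<Sum>i<K. sc (of_int (- k) gchoose i) ((dl ^^ i) (dl F) 0))"
    proof (rule sum.cong[OF refl])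
      fix i
      have "(of_int (- (k - 1)) gchoose Suc i) = (of_int (- k) gchoose i) + (of_int (- k) gchoose Suc i :: complex)"
        using gbinomial_Suc_Suc[of "of_int (- k) :: complex" i] by (simp add: algebra_simps)
      then show "sc ((of_int (- (k - 1)) gchoose Suc i) - (of_int (- k) gchoose Suc i)) ((dl ^^ Suc i) F 0) =
          sc (of_int (- k) gchoose i) ((dl ^^ i) (dl F) 0)"
        by (simp add: funpow_swap1)
    qed
    also have "\<dots> = dl F k"
      by (rule Suc.IH[symmetric]) (use Suc.prems in \<open>simp add: funpow_swap1\<close>)
    finally show ?thesis .
  qed
  have step: "G (k - 1) - F (k - 1) = G k - F k" for k
    using dG[of k] by (simp add: dl_def algebra_simps)
  have G0: "G 0 = F 0" unfolding G_def by (subst sum.lessThan_Suc_shift) simp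
  have "G k - F k = 0"
  proof (induction k rule: int_induct[where k = 0])
    case base then show ?case using G0 by simp
  next
    case (step1 i) then show ?case using step[of "i + 1"] by simp
  next
    case (step2 i) then show ?case using step[of i] by simp
  qed
  then show ?case by (simp add: G_def)
qed simp

lemma gpair_newton:
  assumes "gpair K L R"
  shows "L k - R k = (\<Sum>i<K. sc (of_int (- k) gchoose i) (Lam (int i) L R))"
  using newton_series[of K "\<lambda>k. L k - R k" k] assms by (simp add: gpair_def Lam_nat)

end

section \<open>The logarithmic coordinate\<close>

text \<open>Laurent series are series in \<open>z = y - 1\<close>. The coordinate is \<open>tt = log (1 + z) = log y\<close>, and
  \<open>eD = y d/dy\<close> is the derivation with \<open>eD tt = 1\<close>.\<close>

definition tt :: "complex fls" where "tt = fps_to_fls (fps_ln 1)"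

definition tp :: "int \<Rightarrow> complex fls" where "tp n = tt powi n"

definition eD :: "complex fls \<Rightarrow> complex fls" where "eD g = (1 + fls_X) * fls_deriv g"

lemma eD_nth: "eD g $$ j = of_int j * g $$ j + of_int (j + 1) * g $$ (j + 1)"
  by (simp add: eD_def distrib_right fls_X_times_conv_shift)

lemma eD_mult: "eD (f * g) = f * eD g + eD f * g"
  by (simp add: eD_def algebra_simps)

lemma eD_const_mult: "eD (fls_const c * g) = fls_const c * eD g"
  by (simp add: eD_def algebra_simps)

lemma eD_sum: "eD (\<Sum>i\<in>I. f i) = (\<Sum>i\<in>I. eD (f i))"
  by (simp add: eD_def fls_deriv_sum sum_distrib_left)

lemma eD_tt: "eD tt = 1"
proof -
  have "(1 + fps_X :: complex fps) * inverse (1 + fps_X) = 1"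
    by (rule inverse_mult_eq_1') simp
  then have "fps_to_fls ((1 + fps_X :: complex fps) * inverse (1 + fps_X)) = 1" by simp
  then show ?thesis
    by (simp add: eD_def tt_def fls_deriv_fps_to_fls fps_ln_deriv fls_times_fps_to_fls)
qed

lemma tt_nth_1: "tt $$ 1 = 1"
  by (simp add: tt_def fps_ln_nth)

lemma tt_nonzero: "tt \<noteq> 0"
  using tt_nth_1 by fastforce

lemma tt_subdegree: "fls_subdegree tt = 1"
  by (rule fls_subdegree_eqI) (auto simp: tt_nth_1, auto simp: tt_def fps_ln_nth)

lemma tp_add: "tp (m + n) = tp m * tp n"
  by (simp add: tp_def power_int_add tt_nonzero)

lemma tp_0 [simp]: "tp 0 = 1"
  by (simp add: tp_def)

lemma tp_1: "tp 1 = tt"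
  by (simp add: tp_def)

lemma tp_nat: "tp (int n) = tt ^ n"
  by (simp add: tp_def)

lemma tp_subdegree: "fls_subdegree (tp n) = n"
  by (simp add: tp_def tt_subdegree)

lemma tp_nth_below: "j < n \<Longrightarrow> tp n $$ j = 0"
  by (simp add: tp_subdegree)

lemma tp_nth_lead: "tp n $$ n = 1"
proof -
  have "tp (n + m) $$ (n + m) = tp n $$ n * tp m $$ m" for n m
    using fls_times_base[of "tp n" "tp m"] by (simp add: tp_add tp_subdegree)
  from this[of _ 1] have step: "tp (n + 1) $$ (n + 1) = tp n $$ n" for n
    by (simp add: tp_1 tt_nth_1)
  show ?thesis
  proof (induction n rule: int_induct[where k = 0])
    case (step2 i) then show ?case using step[of "i - 1"] by simp
  qed (auto simp: step)
qed

lemma eD_tp: "eD (tp n) = of_int n * tp (n - 1)"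
proof -
  have step: "eD (tp (n + 1)) = tp n + tt * eD (tp n)" for n
    using eD_mult[of tt "tp n"] by (simp add: eD_tt tp_add tp_1 mult.commute algebra_simps)
  have shift: "tt * tp (n - 1) = tp n" for n using tp_add[of 1 "n - 1"] by (simp add: tp_1)
  show ?thesis
  proof (induction n rule: int_induct[where k = 0])
    case base then show ?case by (simp add: eD_def)
  next
    case (step1 i)
    have "eD (tp (i + 1)) = tp i + tt * (of_int i * tp (i - 1))" using step[of i] step1 by simp
    also have "tt * (of_int i * tp (i - 1)) = of_int i * tp i" by (metis shift mult.left_commute)
    finally show ?case by (simp add: distrib_right)
  next
    case (step2 i)
    have "tt * eD (tp (i - 1)) = of_int i * tp (i - 1) - tp (i - 1)"
      using step[of "i - 1"] step2 by simp
    also have "\<dots> = of_int (i - 1) * (tt * tp (i - 1 - 1))" unfolding shift by (simp add: algebra_simps)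
    finally have "tt * eD (tp (i - 1)) = tt * (of_int (i - 1) * tp (i - 1 - 1))" by (simp add: mult.left_commute)
    then show ?case using tt_nonzero by simp
  qed
qed

text \<open>The operators \<open>(d/dz)^i / i!\<close>. In the commutator formula they account for
  the factor \<open>x gchoose i\<close> that the coefficient at \<open>z^x\<close> acquires.\<close>

fun hasse :: "nat \<Rightarrow> complex fls \<Rightarrow> complex fls" where
  "hasse 0 g = g"
| "hasse (Suc i) g = fls_const (1 / of_nat (Suc i)) * fls_deriv (hasse i g)"

lemma hasse_nth: "hasse i g $$ j = (of_int (j + int i) gchoose i) * g $$ (j + int i)"
proof (induction i arbitrary: j)
  case (Suc i)
  have "of_nat (Suc i) * (of_int (j + int (Suc i)) gchoose Suc i) =
      of_int (j + 1) * (of_int (j + 1 + int i) gchoose i :: complex)"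
    using Suc_times_gbinomial[of i "of_int (j + int i) :: complex"]
      gbinomial_absorb_comp[of "of_int (j + 1 + int i) :: complex" i]
    by (simp add: algebra_simps)
  moreover have "x = 1 / of_nat (Suc i) * (of_nat (Suc i) * x)" for x :: complex
    by (simp del: of_nat_Suc)
  ultimately have "(of_int (j + int (Suc i)) gchoose Suc i) =
      1 / of_nat (Suc i) * (of_int (j + 1) * (of_int (j + 1 + int i) gchoose i :: complex))"
    by metis
  then show ?case using Suc[of "j + 1"] by (simp add: algebra_simps)
qed simp

text \<open>Both sides are the coefficient of \<open>s^j\<close> in \<open>(log y + log (1 + s))^m\<close>: the left one by Taylor expansion
  of the \<open>m\<close>-th power of the logarithm at \<open>y\<close>, the right one by the binomial theorem.\<close>

lemma hasse_tp:
  "(1 + fls_X) ^ j * hasse j (tp m) =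
    (\<Sum>i\<le>j. fls_const ((of_int m gchoose i) * tp (int i) $$ int j) * tp (m - int i))"
proof (induction j)
  case 0 then show ?case by simp
next
  case (Suc j)
  define c where "c i j = tp (int i) $$ int j" for i j
  have c0: "c 0 (Suc j) = 0" "c (Suc j) j = 0" by (auto simp: c_def tp_nth_below)
  \<comment> \<open>Compares coefficients of \<open>z^j\<close> in
    \<open>(1 + z) d/dz t^(i+1) = (i + 1) t^i\<close>. Up to factorials the numbers
    \<open>c i j\<close> are Stirling numbers of the first kind.\<close>
  have crec: "of_nat (Suc j) * c (Suc i) (Suc j) + of_nat j * c (Suc i) j = of_nat (Suc i) * c i j" for i
    using arg_cong[OF eD_tp[of "int (Suc i)"], of "\<lambda>f. f $$ int j"]
    by (simp add: eD_nth c_def algebra_simps)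
  define G where "G = (1 + fls_X) ^ j * hasse j (tp m)"
  have G: "G = (\<Sum>i\<le>j. fls_const ((of_int m gchoose i) * c i j) * tp (m - int i))"
    using Suc by (simp add: G_def c_def)
  have eX: "eD ((1 + fls_X) ^ j) = of_nat j * (1 + fls_X) ^ j"
  proof (induction j)
    case (Suc j)
    have "eD (1 + fls_X) = 1 + fls_X" by (simp add: eD_def)
    then show ?case using eD_mult[of "1 + fls_X" "(1 + fls_X) ^ j"] Suc by (simp add: algebra_simps)
  qed (simp add: eD_def)
  \<comment> \<open>Recurrence in \<open>j\<close>: the extra factor \<open>1 + z\<close> turns the
    next derivative into \<open>eD\<close>, and pulling \<open>eD\<close> in front of
    \<open>(1 + z)^j\<close> subtracts \<open>j\<close> times the old value.\<close>
  have "of_nat (Suc j) * ((1 + fls_X) ^ Suc j * hasse (Suc j) (tp m)) = (1 + fls_X) ^ j * eD (hasse j (tp m))"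
  proof -
    have "of_nat (Suc j) * fls_const (1 / of_nat (Suc j)) = (1 :: complex fls)"
      by (simp add: fls_of_nat fls_const_nonzero del: of_nat_Suc)
    then have "of_nat (Suc j) * fls_const (1 / of_nat (Suc j)) * ((1 + fls_X) ^ Suc j * fls_deriv (hasse j (tp m))) =
        (1 + fls_X) ^ Suc j * fls_deriv (hasse j (tp m))" by simp
    then show ?thesis by (simp add: eD_def mult_ac del: of_nat_Suc)
  qed
  also have "\<dots> = eD G - of_nat j * G"
    by (simp add: G_def eD_mult eX)
  also have "eD G = (\<Sum>i\<le>j. fls_const ((of_int m gchoose i) * c i j) * (of_int (m - int i) * tp (m - int i - 1)))"
    by (simp only: G eD_sum eD_const_mult eD_tp)
  also have "\<dots> = (\<Sum>i\<le>j. fls_const ((of_int m gchoose Suc i) * (of_nat (Suc i) * c i j)) * tp (m - int (Suc i)))"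
  proof (rule sum.cong[OF refl])
    fix i
    have "(of_int m gchoose i) * of_int (m - int i) = (of_int m gchoose Suc i) * (of_nat (Suc i) :: complex)"
      using gbinomial_absorb_comp[of "of_int m :: complex" i] gbinomial_absorption[of i "of_int m :: complex"]
      by (simp add: algebra_simps)
    then have "fls_const ((of_int m gchoose i) * c i j) * of_int (m - int i) =
        fls_const ((of_int m gchoose Suc i) * (of_nat (Suc i) * c i j))"
      by (simp add: fls_of_int mult.assoc mult.commute mult.left_commute)
    moreover have "m - int i - 1 = m - int (Suc i)" by simp
    ultimately show "fls_const ((of_int m gchoose i) * c i j) * (of_int (m - int i) * tp (m - int i - 1)) =
        fls_const ((of_int m gchoose Suc i) * (of_nat (Suc i) * c i j)) * tp (m - int (Suc i))"
      by (metis mult.assoc)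
  qed
  also have "\<dots> - of_nat j * G =
      of_nat (Suc j) * (\<Sum>i\<le>Suc j. fls_const ((of_int m gchoose i) * c i (Suc j)) * tp (m - int i))"
  proof -
    have cm: "of_nat n * (fls_const (x * y) * t) = fls_const (x * (of_nat n * y)) * t"
      for n x y and t :: "complex fls"
    proof -
      have "of_nat n * (fls_const (x * y) * t) = fls_const (of_nat n) * fls_const (x * y) * t"
        by (simp only: fls_of_nat mult.assoc)
      also have "\<dots> = fls_const (x * (of_nat n * y)) * t"
        by (simp only: fls_const_mult_const mult.left_commute)
      finally show ?thesis .
    qed
    have jG: "of_nat j * G = (\<Sum>i\<le>Suc j. fls_const ((of_int m gchoose i) * (of_nat j * c i j)) * tp (m - int i))"
      by (simp add: G c0 sum_distrib_left cm)
    also have "\<dots> = fls_const (of_nat j * c 0 j) * tp m +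
        (\<Sum>i\<le>j. fls_const ((of_int m gchoose Suc i) * (of_nat j * c (Suc i) j)) * tp (m - int (Suc i)))"
      by (subst sum.atMost_Suc_shift) simp
    also have "of_nat j * c 0 j = 0" by (cases j) (auto simp: c_def)
    finally have jG: "of_nat j * G = (\<Sum>i\<le>j. fls_const ((of_int m gchoose Suc i) * (of_nat j * c (Suc i) j)) * tp (m - int (Suc i)))"
      by simp
    have "of_nat (Suc j) * (\<Sum>i\<le>Suc j. fls_const ((of_int m gchoose i) * c i (Suc j)) * tp (m - int i)) =
        (\<Sum>i\<le>Suc j. fls_const ((of_int m gchoose i) * (of_nat (Suc j) * c i (Suc j))) * tp (m - int i))"
      by (simp only: sum_distrib_left cm)
    also have "\<dots> = (\<Sum>i\<le>j. fls_const ((of_int m gchoose Suc i) * (of_nat (Suc j) * c (Suc i) (Suc j))) * tp (m - int (Suc i)))"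
      by (subst sum.atMost_Suc_shift) (simp add: c0)
    also have "\<dots> = (\<Sum>i\<le>j. fls_const ((of_int m gchoose Suc i) * (of_nat (Suc i) * c i j - of_nat j * c (Suc i) j)) * tp (m - int (Suc i)))"
      by (simp add: crec[symmetric] del: of_nat_Suc)
    also have "\<dots> = (\<Sum>i\<le>j. fls_const ((of_int m gchoose Suc i) * (of_nat (Suc i) * c i j)) * tp (m - int (Suc i))) - of_nat j * G"
      unfolding jG sum_subtractf[symmetric]
      by (intro sum.cong refl) (simp add: right_diff_distrib left_diff_distrib fls_minus_const[symmetric])
    finally show ?thesis by simp
  qed
  finally show ?case
    by (simp add: c_def del: of_nat_Suc sum.atMost_Suc hasse.simps power_Suc)
qed

section \<open>Powers of \<open>e^t - 1\<close>\<close>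

lemma ek_fps: "ek K d = fps_nth ((fps_exp 1 - 1) ^ K) d"
proof -
  have "(fps_exp 1 - 1 :: complex fps) ^ K = (\<Sum>i\<le>K. of_nat (K choose i) * fps_exp 1 ^ i * (-1) ^ (K - i))"
    using binomial_ring[of "fps_exp 1 :: complex fps" "-1" K] by simp
  also have "\<dots> = (\<Sum>i\<le>K. fps_const (of_nat (K choose i) * (-1) ^ (K - i)) * fps_exp (of_nat i))"
  proof (rule sum.cong[OF refl])
    fix i
    have "(-1 :: complex fps) ^ (K - i) = fps_const ((-1) ^ (K - i))"
      by (metis fps_const_1_eq_1 fps_const_neg fps_const_power)
    then show "of_nat (K choose i) * fps_exp 1 ^ i * (-1) ^ (K - i) =
        fps_const (of_nat (K choose i) * (-1) ^ (K - i)) * fps_exp (of_nat i :: complex)"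
      by (simp add: fps_exp_power_mult fps_of_nat[symmetric] mult_ac flip: fps_const_mult)
  qed
  finally show ?thesis by (simp add: fps_sum_nth ek_def sum_divide_distrib)
qed

lemma ek_eq_0: "d < K \<Longrightarrow> ek K d = 0"
  unfolding ek_fps by (rule fps_pow_nth_below_subdegree[THEN trans[rotated]] startsby_zero_power_prefix[rule_format]) auto

lemma ek_lead: "ek K K = 1"
  using startsby_zero_power_nth_same[of "fps_exp 1 - 1 :: complex fps" K] by (simp add: ek_fps)

text \<open>Substituting \<open>t = log (1 + z)\<close> into \<open>(e^t - 1)^K\<close> gives
  \<open>z^K\<close>. Cutting the sum at \<open>d < nat M\<close> is exact below order
  \<open>M\<close> because \<open>t^d\<close> starts with \<open>z^d\<close>.\<close>

lemma X_power_tp_expansion: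
  assumes "n < M"
  shows "(fls_X ^ K - (\<Sum>d<nat M. fls_const (ek K d) * tp (int d))) $$ n = 0"
proof (cases "n < 0")
  case True
  then show ?thesis by (simp add: fls_nth_sum tp_nth_below)
next
  case False
  then obtain n' where n': "n = int n'" by (metis nonneg_int_cases not_less)
  let ?F = "fps_exp 1 - 1 :: complex fps" and ?T = "fps_ln 1 :: complex fps"
  have "?F ^ K oo ?T = (?F oo ?T) ^ K"
    by (rule fps_compose_power[symmetric]) simp
  also have "?F oo ?T = fps_X"
    by (simp add: fps_ln_fps_exp_inv fps_inv_fps_exp_compose)
  finally have "fps_nth (fps_X ^ K) n' = fps_nth (?F ^ K oo ?T) n'" by (simp only:)
  also have "\<dots> = (\<Sum>i=0..n'. ek K i * fps_nth (?T ^ i) n')"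
    by (simp only: ek_fps fps_compose_nth)
  also have "\<dots> = (\<Sum>i<nat M. ek K i * fps_nth (?T ^ i) n')"
  proof (rule sum.mono_neutral_left)
    show "\<forall>i\<in>{..<nat M} - {0..n'}. ek K i * fps_nth (?T ^ i) n' = 0"
      by (auto simp: startsby_zero_power_prefix)
  qed (use assms n' in auto)
  finally show ?thesis
    by (simp add: n' fls_nth_sum tp_nat tt_def fps_to_fls_power[symmetric] fps_X_power_nth)
qed

section \<open>Pairing with Laurent series\<close>

context complex_space
begin

definition LAM :: "complex fls \<Rightarrow> (int \<Rightarrow> 'w) \<Rightarrow> (int \<Rightarrow> 'w) \<Rightarrow> 'w" where
  "LAM g L R = wsum (fls_nth g) (\<lambda>j. Lam j L R)"

lemma LAM_eq_sum:
  assumes "gpair K L R" "int K \<le> hi" "lo \<le> fls_subdegree g"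
  shows "LAM g L R = (\<Sum>j\<in>{lo..<hi}. sc (g $$ j) (Lam j L R))"
  unfolding LAM_def
proof (rule wsum_eq)
  fix j assume "g $$ j \<noteq> 0" "Lam j L R \<noteq> 0"
  then show "j \<in> {lo..<hi}" using assms fls_eq0_below_subdegree[of j g] Lam_eq_0[of K L R j]
    by (metis atLeastLessThan_iff linorder_not_less order_trans)
qed simp

lemma fsupp_Lam:
  assumes "gpair K L R"
  shows "fsupp (\<lambda>j. g $$ (j + c)) (\<lambda>j. Lam j L R)"
proof (rule fsuppI[where b = "int K"])
  fix j assume "g $$ (j + c) \<noteq> 0" "Lam j L R \<noteq> 0"
  then show "fls_subdegree g - c \<le> j \<and> j \<le> int K"
    using fls_eq0_below_subdegree[of "j + c" g] Lam_eq_0[OF assms, of j]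
    by (cases "j + c < fls_subdegree g"; cases "int K \<le> j") auto
qed

lemmas fsupp_Lam0 = fsupp_Lam[where c = 0, simplified]

lemma LAM_add_left: "gpair K L R \<Longrightarrow> LAM (g + h) L R = LAM g L R + LAM h L R"
  unfolding LAM_def by (subst wsum_add_left[symmetric]) (auto simp: fsupp_Lam0 intro!: wsum_cong)

lemma LAM_diff_left: "gpair K L R \<Longrightarrow> LAM (g - h) L R = LAM g L R - LAM h L R"
  unfolding LAM_def by (subst wsum_diff_left[symmetric]) (auto simp: fsupp_Lam0 intro!: wsum_cong)

lemma LAM_const_mult: "gpair K L R \<Longrightarrow> LAM (fls_const c * g) L R = sc c (LAM g L R)"
  unfolding LAM_def by (subst wsum_scale_left[symmetric]) (auto simp: fsupp_Lam0 intro!: wsum_cong)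

lemma LAM_of_int_mult: "gpair K L R \<Longrightarrow> LAM (of_int c * g) L R = sc (of_int c) (LAM g L R)"
  using LAM_const_mult[of K L R "of_int c" g] by (simp add: fls_of_int)

lemma LAM_0: "LAM 0 L R = 0"
  by (simp add: LAM_def wsum_def)

lemma LAM_sum_left: "gpair K L R \<Longrightarrow> LAM (\<Sum>i\<in>I. g i) L R = (\<Sum>i\<in>I. LAM (g i) L R)"
  by (induction I rule: infinite_finite_induct) (auto simp: LAM_0 LAM_add_left)

lemma LAM_eq_0:
  assumes "gpair K L R" "\<And>j. j < int K \<Longrightarrow> g $$ j = 0"
  shows "LAM g L R = 0"
proof -
  have "LAM g L R = (\<Sum>j\<in>{}. sc (g $$ j) (Lam j L R))"
    unfolding LAM_def
  proof (rule wsum_eq)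
    fix j assume "g $$ j \<noteq> 0" "Lam j L R \<noteq> 0"
    then show "j \<in> {}" using assms(2)[of j] Lam_eq_0[OF assms(1), of j] by (cases "j < int K") auto
  qed simp
  then show ?thesis by simp
qed

lemma LAM_add:
  assumes "gpair K L R" "gpair K L' R'"
  shows "LAM g (\<lambda>k. L k + L' k) (\<lambda>k. R k + R' k) = LAM g L R + LAM g L' R'"
  using assms Lam_add[of L R L' R'] fsupp_Lam0[OF assms(1), of g] fsupp_Lam0[OF assms(2), of g]
  by (simp add: LAM_def gpair_def wsum_add)

lemma lin_LAM:
  assumes "gpair K L R" "lin h"
  shows "h (LAM g L R) = LAM g (\<lambda>k. h (L k)) (\<lambda>k. h (R k))"
  using assms lin_Lam[of L R h] by (simp add: LAM_def gpair_def lin_wsum fsupp_Lam0[OF assms(1)])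

lemma LAM_sum:
  assumes "\<And>i. i \<in> I \<Longrightarrow> gpair K (L i) (R i)"
  shows "LAM g (\<lambda>k. \<Sum>i\<in>I. L i k) (\<lambda>k. \<Sum>i\<in>I. R i k) = (\<Sum>i\<in>I. LAM g (L i) (R i)) \<and>
    gpair K (\<lambda>k. \<Sum>i\<in>I. L i k) (\<lambda>k. \<Sum>i\<in>I. R i k)"
  using assms
proof (induction I rule: infinite_finite_induct)
  case (insert i I)
  then show ?case using LAM_add[of K "L i" "R i"] gpair_add[of K "L i" "R i"] by simp
qed (auto simp: LAM_def Lam_def wsum_def gpair_def upz_def dnz_def dl_pow_zero)

lemma LAM_X_mult:
  assumes "gpair K L R"
  shows "LAM (fls_X * g) L R = LAM g (dl L) (dl R)"
proof -
  have "LAM g (dl L) (dl R) = wsum (fls_nth g) (\<lambda>j. Lam (j + 1) L R)"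
    using assms by (simp add: LAM_def Lam_dl gpair_def)
  also have "\<dots> = wsum (\<lambda>j. g $$ (j - 1)) (\<lambda>j. Lam j L R)"
    by (rule wsum_shift)
  finally show ?thesis by (auto simp: LAM_def fls_X_times_conv_shift intro!: wsum_cong)
qed

lemma LAM_X_power_mult:
  assumes "gpair K L R"
  shows "LAM (fls_X ^ n * g) L R = LAM g ((dl ^^ n) L) ((dl ^^ n) R)"
  using assms
proof (induction n arbitrary: g)
  case (Suc n)
  have "LAM (fls_X ^ Suc n * g) L R = LAM (fls_X ^ n * (fls_X * g)) L R"
    by (simp add: mult_ac)
  also have "\<dots> = LAM (fls_X * g) ((dl ^^ n) L) ((dl ^^ n) R)" by (rule Suc.IH[OF Suc.prems])
  finally show ?case using gpair_dl_pow[OF Suc.prems, of n] by (simp add: LAM_X_mult)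
qed simp

lemma LAM_1_plus_X_mult:
  assumes "gpair K L R"
  shows "LAM ((1 + fls_X) * g) L R = LAM g (\<lambda>k. L (k + -1)) (\<lambda>k. R (k + -1))"
proof -
  have d: "gpair K (dl L) (dl R)" using gpair_dl_pow[OF assms, of 1] by simp
  have "LAM ((1 + fls_X) * g) L R = LAM g L R + LAM g (dl L) (dl R)"
    using assms by (simp add: distrib_right LAM_add_left LAM_X_mult)
  also have "\<dots> = LAM g (\<lambda>k. L k + dl L k) (\<lambda>k. R k + dl R k)"
    by (rule LAM_add[symmetric]) (use assms d in auto)
  finally show ?thesis by (simp add: dl_def)
qed

lemma LAM_1_plus_X_power_mult:
  assumes "gpair K L R"
  shows "LAM ((1 + fls_X) ^ n * g) L R = LAM g (\<lambda>k. L (k - int n)) (\<lambda>k. R (k - int n))"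
  using assms
proof (induction n arbitrary: L R)
  case (Suc n)
  have "LAM ((1 + fls_X) ^ Suc n * g) L R = LAM ((1 + fls_X) * ((1 + fls_X) ^ n * g)) L R"
    by (simp add: mult_ac)
  also have "\<dots> = LAM g (\<lambda>k. L (k - int n + -1)) (\<lambda>k. R (k - int n + -1))"
    using Suc by (simp only: LAM_1_plus_X_mult gpair_shift)
  finally show ?case by (simp add: algebra_simps)
qed simp

text \<open>Integration by parts for \<open>eD = y d/dy\<close> with \<open>y = 1 + z\<close>; on
  single powers of \<open>z\<close> this is \<open>Lam_mult_index\<close>.\<close>

lemma LAM_eD:
  assumes "gpair K L R"
  shows "LAM (eD g) L R = LAM g (\<lambda>k. sc (- of_int k) (L k)) (\<lambda>k. sc (- of_int k) (R k))"
proof -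
  have u: "upz L" "dnz R" using assms by (auto simp: gpair_def)
  define P where "P = (\<lambda>j. sc (of_int j) (Lam j L R))"
  define Q where "Q = (\<lambda>j. sc (of_int j) (Lam (j - 1) L R))"
  have fP: "fsupp (fls_nth g) P" "fsupp (\<lambda>j. of_int j * g $$ j) (\<lambda>j. Lam j L R)"
    using fsupp_Lam0[OF assms, of g] unfolding fsupp_def P_def
    by (auto elim!: rev_finite_subset)
  have fQ1: "fsupp (\<lambda>j. g $$ (j + 1)) (\<lambda>j. sc (of_int (j + 1)) (Lam j L R))"
     "fsupp (\<lambda>j. of_int (j + 1) * g $$ (j + 1)) (\<lambda>j. Lam j L R)"
    using fsupp_Lam[OF assms, of g 1] unfolding fsupp_def
    by (auto elim!: rev_finite_subset)
  have fQ: "fsupp (fls_nth g) Q"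
    using fQ1(1) unfolding fsupp_shift Q_def by simp
  have "LAM g (\<lambda>k. sc (- of_int k) (L k)) (\<lambda>k. sc (- of_int k) (R k)) = wsum (fls_nth g) (\<lambda>j. P j + Q j)"
    unfolding LAM_def Lam_mult_index[OF u] P_def Q_def scale_right_distrib ..
  also have "\<dots> = wsum (fls_nth g) P + wsum (fls_nth g) Q"
    using fP fQ by (simp add: wsum_add)
  also have "wsum (fls_nth g) P = wsum (\<lambda>j. of_int j * g $$ j) (\<lambda>j. Lam j L R)"
    by (simp add: P_def wsum_mult_swap[symmetric] mult.commute)
  also have "wsum (fls_nth g) Q = wsum (\<lambda>j. of_int (j + 1) * g $$ (j + 1)) (\<lambda>j. Lam j L R)"
  proof -
    have "wsum (\<lambda>j. of_int j * g $$ j) (\<lambda>j. Lam (j + -1) L R) =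
        wsum (\<lambda>j. of_int (j - -1) * g $$ (j - -1)) (\<lambda>j. Lam j L R)"
      by (rule wsum_shift)
    then show ?thesis by (simp add: Q_def wsum_mult_swap[symmetric] mult.commute)
  qed
  finally show ?thesis
    unfolding LAM_def eD_nth by (subst wsum_add_left) (use fP fQ1 in auto)
qed

lemma gpair_diagonal:
  assumes "finite {k. L k \<noteq> 0}"
  shows "gpair 0 L L"
proof -
  obtain a b where ab: "\<And>k. L k \<noteq> 0 \<Longrightarrow> a \<le> k \<and> k \<le> b"
    using assms by (metis (mono_tags, lifting) Max_ge Min_le mem_Collect_eq)
  have "upz L" by (rule upzI[of b]) (use ab in force)
  moreover have "dnz L" by (rule dnzI[of a]) (use ab in force)
  ultimately show ?thesis by (simp add: gpair_def)
qed

text \<open>For a Laurent polynomial the difference of the two expansions is a residue at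
  \<open>y = 1\<close>. With \<open>y = e^t\<close> and \<open>dy/y = dt\<close>, the residue
  against \<open>t^(-1-n)\<close> is the coefficient of \<open>t^n\<close> in the sum of the
  \<open>L k e^(kt)\<close>.\<close>

lemma LAM_tp_diagonal:
  assumes "finite {k. L k \<noteq> 0}"
  shows "LAM (tp (- 1 - int n)) L L = Sum_any (\<lambda>k. sc (of_int k ^ n / fact n) (L k))"
  using assms
proof (induction n arbitrary: L)
  case 0
  note g = gpair_diagonal[OF 0]
  have ud: "upz L" "dnz L" using g by (auto simp: gpair_def)
  have "LAM (tp (- 1 - int 0)) L L = (\<Sum>j\<in>{-1..<0}. sc (tp (-1) $$ j) (Lam j L L))"
    using LAM_eq_sum[OF g, of 0 "-1" "tp (-1)"] by (simp add: tp_subdegree)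
  also have "{-1..<0} = {-1::int}" by auto
  also have "(\<Sum>j\<in>{-1}. sc (tp (-1) $$ j) (Lam j L L)) = wsum (\<lambda>k. cA (-1) k - cB (-1) k) L"
    using wsum_diff_left[OF fsupp_cA[OF ud(1)] fsupp_cB[OF ud(2)]]
    by (simp add: tp_nth_lead Lam_def)
  \<comment> \<open>The expansions of \<open>1 / (y - 1)\<close> at infinity and at 0 differ by the
    formal delta series, all of whose coefficients are 1.\<close>
  also have "(\<lambda>k. cA (-1) k - cB (-1) k) = (\<lambda>k. 1)"
    by (auto simp: cA_neg_1 cB_neg_1)
  finally show ?case by (simp add: wsum_def)
next
  case (Suc n)
  note g = gpair_diagonal[OF Suc.prems]
  have fin: "finite {k. sc (- of_int k) (L k) \<noteq> 0}"
    by (rule finite_subset[OF _ Suc.prems]) auto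
  \<comment> \<open>Differentiating \<open>t^(-1-n)\<close> produces the next negative power, and
    integration by parts turns the derivative into a factor \<open>- k\<close>.\<close>
  have "eD (tp (- 1 - int n)) = of_int (- 1 - int n) * tp (- 1 - int (Suc n))"
    by (simp only: eD_tp) (simp add: algebra_simps)
  then have "sc (of_int (- 1 - int n)) (LAM (tp (- 1 - int (Suc n))) L L) = LAM (eD (tp (- 1 - int n))) L L"
    using LAM_of_int_mult[OF g] by metis
  also have "\<dots> = Sum_any (\<lambda>k. sc (of_int k ^ n / fact n) (sc (- of_int k) (L k)))"
    using LAM_eD[OF g] Suc.IH[OF fin] by simp
  also have "\<dots> = Sum_any (\<lambda>k. sc (of_int (- 1 - int n)) (sc (of_int k ^ Suc n / fact (Suc n)) (L k)))"
  proof (rule Sum_any.cong)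
    fix k
    have "of_int k ^ n / fact n * - of_int k = of_int (- 1 - int n) * (of_int k ^ Suc n / fact (Suc n) :: complex)"
    proof -
      have "fact (Suc n) = (of_int (1 + int n)) * (fact n :: complex)" by simp
      moreover have "of_int (1 + int n) \<noteq> (0::complex)" by (simp del: of_int_add)
      moreover have "of_int (- 1 - int n) = - (of_int (1 + int n) :: complex)" by simp
      ultimately show ?thesis by (simp add: field_simps del: fact_Suc of_int_add of_int_diff)
    qed
    then show "sc (of_int k ^ n / fact n) (sc (- of_int k) (L k)) =
        sc (of_int (- 1 - int n)) (sc (of_int k ^ Suc n / fact (Suc n)) (L k))"
      by (simp only: scale_scale)
  qed
  also have "\<dots> = sc (of_int (- 1 - int n)) (Sum_any (\<lambda>k. sc (of_int k ^ Suc n / fact (Suc n)) (L k)))"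
  proof -
    have "fsupp (\<lambda>k. of_int k ^ Suc n / fact (Suc n)) L"
      unfolding fsupp_def by (rule finite_subset[OF _ Suc.prems]) auto
    from wsum_scale[OF this, of "of_int (- 1 - int n)"] show ?thesis
      unfolding wsum_def by (simp only: scale_left_commute)
  qed
  finally have "sc (of_int (- 1 - int n)) (LAM (tp (- 1 - int (Suc n))) L L) =
      sc (of_int (- 1 - int n)) (Sum_any (\<lambda>k. sc (of_int k ^ Suc n / fact (Suc n)) (L k)))" .
  moreover have "of_int (- 1 - int n) \<noteq> (0::complex)"
    by (simp add: of_int_eq_0_iff del: of_int_diff)
  ultimately show ?case using scale_left_imp_eq by blast
qed

lemma LAM_tp_diagonal_nonneg:
  assumes "finite {k. L k \<noteq> 0}" "n \<ge> 0"
  shows "LAM (tp n) L L = 0"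
  by (rule LAM_eq_0[OF gpair_diagonal[OF assms(1)]]) (use assms(2) in \<open>auto simp: tp_nth_below\<close>)

end

section \<open>Products of local fields\<close>

lemma upz_diff: "upz L \<Longrightarrow> upz M \<Longrightarrow> upz (\<lambda>k. L k - M k :: 'w::ab_group_add)"
  by (rule upz_combine[of L M]) auto

lemma dnz_diff: "dnz L \<Longrightarrow> dnz M \<Longrightarrow> dnz (\<lambda>k. L k - M k :: 'w::ab_group_add)"
  by (rule dnz_combine[of L M]) auto

type_synonym 'w field = "int \<Rightarrow> 'w \<Rightarrow> 'w"

text \<open>Multiplication by \<open>x1 - x2\<close>, and in three variables by \<open>xi - xj\<close>, on the level of coefficients.\<close>

definition D2 :: "(int \<Rightarrow> int \<Rightarrow> 'w::ab_group_add) \<Rightarrow> int \<Rightarrow> int \<Rightarrow> 'w" where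
  "D2 G k q = G (k - 1) q - G k (q - 1)"

text \<open>With \<open>y = x1/x2\<close> one has \<open>x1 - x2 = x2 (y - 1)\<close>, so on a line
  of fixed total degree powers of \<open>x1 - x2\<close> become powers of \<open>dl\<close>, each
  factor lowering the degree by one.\<close>

lemma D2_pow: "(D2 ^^ n) G k q = (dl ^^ n) (\<lambda>i. G i (k + q - int n - i)) k"
proof -
  have "(D2 ^^ n) G k (p - k) = (dl ^^ n) (\<lambda>i. G i (p - int n - i)) k" for p
  proof (induction n arbitrary: p k)
    case (Suc n)
    have "(D2 ^^ Suc n) G k (p - k) = (D2 ^^ n) G (k - 1) ((p - 1) - (k - 1)) - (D2 ^^ n) G k ((p - 1) - k)"
      by (simp add: D2_def algebra_simps)
    also have "\<dots> = (dl ^^ Suc n) (\<lambda>i. G i (p - 1 - int n - i)) k"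
      unfolding Suc by (simp add: dl_def)
    finally show ?case by (simp add: algebra_simps)
  qed simp
  from this[of "k + q"] show ?thesis by simp
qed

definition d12 :: "(int \<Rightarrow> int \<Rightarrow> int \<Rightarrow> 'w::ab_group_add) \<Rightarrow> int \<Rightarrow> int \<Rightarrow> int \<Rightarrow> 'w" where
  "d12 F k q r = F (k - 1) q r - F k (q - 1) r"

definition d13 :: "(int \<Rightarrow> int \<Rightarrow> int \<Rightarrow> 'w::ab_group_add) \<Rightarrow> int \<Rightarrow> int \<Rightarrow> int \<Rightarrow> 'w" where
  "d13 F k q r = F (k - 1) q r - F k q (r - 1)"

definition d23 :: "(int \<Rightarrow> int \<Rightarrow> int \<Rightarrow> 'w::ab_group_add) \<Rightarrow> int \<Rightarrow> int \<Rightarrow> int \<Rightarrow> 'w" where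
  "d23 F k q r = F k (q - 1) r - F k q (r - 1)"

lemma funpow_commute1:
  assumes "\<And>x. f (g x) = g (f x)"
  shows "(f ^^ n) (g x) = g ((f ^^ n) x)"
  by (induction n) (simp_all add: assms)

lemma funpow_commute2:
  assumes "\<And>x. f (g x) = g (f x)"
  shows "(f ^^ n) ((g ^^ m) x) = (g ^^ m) ((f ^^ n) x)"
proof (induction m)
  case (Suc m)
  then show ?case using funpow_commute1[of f g n "(g ^^ m) x", OF assms] by simp
qed simp

lemma d12_d13: "d12 (d13 F) = d13 (d12 F)" and d12_d23: "d12 (d23 F) = d23 (d12 F)"
  and d13_d23: "d13 (d23 F) = d23 (d13 F)"
  by (auto simp: fun_eq_iff d12_def d13_def d23_def)

lemma d23_eq: "d23 F = (\<lambda>k q r. d13 F k q r - d12 F k q r)"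
  by (auto simp: fun_eq_iff d12_def d13_def d23_def)

lemma d12_pow_diff: "(d12 ^^ n) (\<lambda>k q r. F k q r - G k q r) = (\<lambda>k q r. (d12 ^^ n) F k q r - (d12 ^^ n) G k q r)"
  and d13_pow_diff: "(d13 ^^ n) (\<lambda>k q r. F k q r - G k q r) = (\<lambda>k q r. (d13 ^^ n) F k q r - (d13 ^^ n) G k q r)"
  and d23_pow_diff: "(d23 ^^ n) (\<lambda>k q r. F k q r - G k q r) = (\<lambda>k q r. (d23 ^^ n) F k q r - (d23 ^^ n) G k q r)"
  and d23_pow_add: "(d23 ^^ n) (\<lambda>k q r. F k q r + G k q r) = (\<lambda>k q r. (d23 ^^ n) F k q r + (d23 ^^ n) G k q r)"
  by (induction n) (auto simp: d12_def d13_def d23_def fun_eq_iff)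

lemma d_pow_zero: "(d12 ^^ n) (\<lambda>k q r. 0) = (\<lambda>k q r. 0)" "(d13 ^^ n) (\<lambda>k q r. 0) = (\<lambda>k q r. 0)"
    "(d23 ^^ n) (\<lambda>k q r. 0) = (\<lambda>k q r. 0)"
  by (induction n) (auto simp: d12_def d13_def d23_def fun_eq_iff)

lemma d12_pow_D2: "(d12 ^^ n) F k q r = (D2 ^^ n) (\<lambda>k q. F k q r) k q"
  and d13_pow_D2: "(d13 ^^ n) F k q r = (D2 ^^ n) (\<lambda>k r. F k q r) k r"
  and d23_pow_D2: "(d23 ^^ n) F k q r = (D2 ^^ n) (\<lambda>q r. F k q r) q r"
  by (induction n arbitrary: k q r) (auto simp: D2_def d12_def d13_def d23_def)

text \<open>Boundedness in \<open>y = x1/x2\<close>, with the total degree in \<open>x1\<close>,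
  \<open>x2\<close> and the power of \<open>x3\<close> held fixed: the form in which
  \<open>Lam\<close> is applied to the first two of three variables.\<close>

definition upz3 :: "(int \<Rightarrow> int \<Rightarrow> int \<Rightarrow> 'w::zero) \<Rightarrow> bool" where
  "upz3 F \<longleftrightarrow> (\<forall>q r. upz (\<lambda>k. F k (q - k) r))"

definition dnz3 :: "(int \<Rightarrow> int \<Rightarrow> int \<Rightarrow> 'w::zero) \<Rightarrow> bool" where
  "dnz3 F \<longleftrightarrow> (\<forall>q r. dnz (\<lambda>k. F k (q - k) r))"

lemma upz3_d:
  assumes "upz3 F"
  shows "upz3 (d12 F)" "upz3 (d13 F)" "upz3 (d23 F)"
proof -
  have u: "upz (\<lambda>k. F k (q - k) r)" for q r using assms by (simp add: upz3_def)
  have s: "upz (\<lambda>k. F (k - 1) (q - k) r)" for q r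
    using upz_shift[OF u[of "q - 1" r], of "-1"] by (simp add: algebra_simps)
  have t: "upz (\<lambda>k. F k (q - k - 1) r)" for q r
    using u[of "q - 1" r] by (simp add: algebra_simps)
  show "upz3 (d12 F)" unfolding upz3_def d12_def by (intro allI upz_diff s t)
  show "upz3 (d13 F)" unfolding upz3_def d13_def by (intro allI upz_diff s u)
  show "upz3 (d23 F)" unfolding upz3_def d23_def by (intro allI upz_diff t u)
qed

lemma dnz3_d:
  assumes "dnz3 F"
  shows "dnz3 (d12 F)" "dnz3 (d13 F)" "dnz3 (d23 F)"
proof -
  have u: "dnz (\<lambda>k. F k (q - k) r)" for q r using assms by (simp add: dnz3_def)
  have s: "dnz (\<lambda>k. F (k - 1) (q - k) r)" for q r
    using dnz_shift[OF u[of "q - 1" r], of "-1"] by (simp add: algebra_simps)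
  have t: "dnz (\<lambda>k. F k (q - k - 1) r)" for q r
    using u[of "q - 1" r] by (simp add: algebra_simps)
  show "dnz3 (d12 F)" unfolding dnz3_def d12_def by (intro allI dnz_diff s t)
  show "dnz3 (d13 F)" unfolding dnz3_def d13_def by (intro allI dnz_diff s u)
  show "dnz3 (d23 F)" unfolding dnz3_def d23_def by (intro allI dnz_diff t u)
qed

lemma upz3_pow:
  assumes "upz3 F"
  shows "upz3 ((d12 ^^ n) F)" "upz3 ((d13 ^^ n) F)" "upz3 ((d23 ^^ n) F)"
  using assms by (induction n) (auto intro: upz3_d)

lemma dnz3_pow:
  assumes "dnz3 F"
  shows "dnz3 ((d12 ^^ n) F)" "dnz3 ((d13 ^^ n) F)" "dnz3 ((d23 ^^ n) F)"
  using assms by (induction n) (auto intro: dnz3_d)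

section \<open>Fields, locality and products\<close>

context complex_space
begin

definition fld :: "'w field \<Rightarrow> bool" where
  "fld a \<longleftrightarrow> (\<forall>k. lin (a k)) \<and> (\<forall>w. dnz (\<lambda>k. a k w))"

text \<open>Coefficients of \<open>x^p\<close> in \<open>a(xy) b(x) w\<close> and in \<open>b(x) a(xy) w\<close>, as series in \<open>y\<close>.\<close>

definition LL :: "'w field \<Rightarrow> 'w field \<Rightarrow> int \<Rightarrow> 'w \<Rightarrow> int \<Rightarrow> 'w" where
  "LL a b p w k = a k (b (p - k) w)"

definition RR :: "'w field \<Rightarrow> 'w field \<Rightarrow> int \<Rightarrow> 'w \<Rightarrow> int \<Rightarrow> 'w" where
  "RR a b p w k = b (p - k) (a k w)"

text \<open>The condition \<open>(x1 - x2)^K [a(x1), b(x2)] = 0\<close>, read along lines of fixed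
  total degree.\<close>

definition loc :: "nat \<Rightarrow> 'w field \<Rightarrow> 'w field \<Rightarrow> bool" where
  "loc K a b \<longleftrightarrow> (\<forall>p w k. (dl ^^ K) (\<lambda>k. LL a b p w k - RR a b p w k) k = 0)"

text \<open>The product belonging to the coordinate \<open>z = y - 1\<close>. A single power of
  \<open>y - 1\<close> can be paired with any two fields; locality enters when infinitely many
  powers are summed.\<close>

definition rhoj :: "int \<Rightarrow> 'w field \<Rightarrow> 'w field \<Rightarrow> int \<Rightarrow> 'w \<Rightarrow> 'w" where
  "rhoj j a b p w = Lam j (LL a b p w) (RR a b p w)"

text \<open>With \<open>x1 = x e^t\<close>, the field \<open>rho (tp n) a b\<close> is the \<open>n\<close>-th product of \<open>a\<close> and \<open>b\<close>, that is, the coefficient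
  of \<open>t^(-n-1)\<close> in the operator product \<open>Y(a, t) b\<close> of the coordinate \<open>\<phi>(x, t) = x e^t\<close>.\<close>

definition rho :: "complex fls \<Rightarrow> 'w field \<Rightarrow> 'w field \<Rightarrow> int \<Rightarrow> 'w \<Rightarrow> 'w" where
  "rho g a b p w = LAM g (LL a b p w) (RR a b p w)"

lemma fld_lin: "fld a \<Longrightarrow> lin (a k)"
  by (simp add: fld_def)

lemma fld_dnzE:
  assumes "fld a" obtains N where "\<And>k. k < N \<Longrightarrow> a k w = 0"
proof -
  have "\<exists>U. \<forall>k<U. a k w = 0" using assms by (simp add: fld_def dnz_def)
  then show thesis using that by blast
qed

lemma fld_uniform:
  assumes "fld a"
  shows "\<exists>N. \<forall>k\<in>{A..B::int}. \<forall>l<N. a l (f k) = 0"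
proof -
  have "\<forall>k. \<exists>N. \<forall>l<N. a l (f k) = 0" using assms by (auto simp: fld_def dnz_def)
  then obtain N where N: "\<forall>k. \<forall>l<N k. a l (f k) = 0" by (elim choice[elim_format] exE)
  show ?thesis
  proof (cases "A \<le> B")
    case True
    have "\<forall>k\<in>{A..B}. Min (N ` {A..B}) \<le> N k" by auto
    then show ?thesis using N by (intro exI[of _ "Min (N ` {A..B})"]) force
  qed auto
qed

lemma upz_LL: "fld a \<Longrightarrow> fld b \<Longrightarrow> upz (LL a b p w)"
proof -
  assume ab: "fld a" "fld b"
  obtain N where N: "\<And>k. k < N \<Longrightarrow> b k w = 0" using fld_dnzE[OF ab(2)] by blast
  show ?thesis by (rule upzI[of "p - N"]) (simp add: LL_def N lin_0[OF fld_lin[OF ab(1)]])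
qed

lemma dnz_RR: "fld a \<Longrightarrow> fld b \<Longrightarrow> dnz (RR a b p w)"
proof -
  assume ab: "fld a" "fld b"
  obtain N where N: "\<And>k. k < N \<Longrightarrow> a k w = 0" using fld_dnzE[OF ab(1)] by blast
  show ?thesis by (rule dnzI[of N]) (simp add: RR_def N lin_0[OF fld_lin[OF ab(2)]])
qed

lemma gpair_loc: "fld a \<Longrightarrow> fld b \<Longrightarrow> loc K a b \<Longrightarrow> gpair K (LL a b p w) (RR a b p w)"
  by (simp add: gpair_def loc_def upz_LL dnz_RR)

lemma loc_mono: "loc K a b \<Longrightarrow> K \<le> K' \<Longrightarrow> loc K' a b"
  using dl_pow_eq_0_mono[of K "\<lambda>k. LL a b p w k - RR a b p w k" K' for p w] by (simp add: loc_def)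

lemma loc_sym:
  assumes "loc K a b"
  shows "loc K b a"
  unfolding loc_def
proof (intro allI)
  fix p w k
  have "(\<lambda>k. LL b a p w k - RR b a p w k) = (\<lambda>k. sc (-1) (LL a b p w (p - k) - RR a b p w (p - k)))"
    by (auto simp: LL_def RR_def)
  then have "(dl ^^ K) (\<lambda>k. LL b a p w k - RR b a p w k) k =
      sc (-1) ((dl ^^ K) (\<lambda>k. LL a b p w (p - k) - RR a b p w (p - k)) k)"
    by (simp only: dl_pow_lin[OF lin_sc])
  also have "(dl ^^ K) (\<lambda>k. LL a b p w (p - k) - RR a b p w (p - k)) k = 0"
    using assms dl_pow_reflect[of K "\<lambda>k. LL a b p w k - RR a b p w k" p k]
    by (simp add: loc_def)
  finally show "(dl ^^ K) (\<lambda>k. LL b a p w k - RR b a p w k) k = 0" by simp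
qed

lemma loc_D2: "loc K a b \<longleftrightarrow> (\<forall>w k q. (D2 ^^ K) (\<lambda>k q. a k (b q w) - b q (a k w)) k q = 0)"
proof -
  have "(\<forall>p w k. (dl ^^ K) (\<lambda>i. a i (b (p - i) w) - b (p - i) (a i w)) k = 0) \<longleftrightarrow>
      (\<forall>w k q. (dl ^^ K) (\<lambda>i. a i (b (k + q - int K - i) w) - b (k + q - int K - i) (a i w)) k = 0)"
    (is "?A \<longleftrightarrow> ?B")
  proof
    assume B: ?B
    have "(dl ^^ K) (\<lambda>i. a i (b (p - i) w) - b (p - i) (a i w)) k = 0" for p w k
      using B[rule_format, where k = k and q = "p - k + int K"] by simp
    then show ?A by blast
  qed blast
  then show ?thesis unfolding loc_def D2_pow LL_def RR_def .
qed

text \<open>A product in \<open>t\<close> expands into many products in \<open>z\<close>, so indexed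
  combinations are the natural unit; scalar multiples and the zero field are special cases.\<close>

definition lincomb :: "'i set \<Rightarrow> ('i \<Rightarrow> complex) \<Rightarrow> ('i \<Rightarrow> 'w field) \<Rightarrow> 'w field" where
  "lincomb I x d = (\<lambda>p w. \<Sum>i\<in>I. sc (x i) (d i p w))"

lemma lin_lincomb: "(\<And>i. i \<in> I \<Longrightarrow> lin (h i)) \<Longrightarrow> lin (\<lambda>w. \<Sum>i\<in>I. sc (x i) (h i w))"
  unfolding lin_def scale_sum_right
  by (auto simp: scale_right_distrib sum.distrib mult.commute intro!: sum.cong)

lemma dnz_sum:
  assumes "finite I" "\<And>i. i \<in> I \<Longrightarrow> dnz (L i)"
  shows "dnz (\<lambda>k. \<Sum>i\<in>I. sc (x i) (L i k))"
  using assms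
proof (induction I rule: finite_induct)
  case (insert i I)
  have "dnz (L i)" "dnz (\<lambda>k. \<Sum>i\<in>I. sc (x i) (L i k))" using insert by auto
  then show ?case by (rule dnz_combine) (use insert.hyps in simp)
qed (auto simp: dnz_def)

lemma fld_lincomb:
  assumes "finite I" "\<And>i. i \<in> I \<Longrightarrow> fld (d i)"
  shows "fld (lincomb I x d)"
  unfolding fld_def lincomb_def using assms by (intro conjI allI lin_lincomb dnz_sum) (auto simp: fld_def)

lemma LL_lincomb_left: "LL (lincomb I x d) c p w = (\<lambda>k. \<Sum>i\<in>I. sc (x i) (LL (d i) c p w k))"
  by (simp add: LL_def lincomb_def fun_eq_iff)

lemma RR_lincomb_left: "fld c \<Longrightarrow> RR (lincomb I x d) c p w = (\<lambda>k. \<Sum>i\<in>I. sc (x i) (RR (d i) c p w k))"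
  by (simp add: RR_def lincomb_def fun_eq_iff lin_sum lin_scale fld_lin)

lemma LL_lincomb_right: "fld a \<Longrightarrow> LL a (lincomb I x d) p w = (\<lambda>k. \<Sum>i\<in>I. sc (x i) (LL a (d i) p w k))"
  by (simp add: LL_def lincomb_def fun_eq_iff lin_sum lin_scale fld_lin)

lemma RR_lincomb_right: "RR a (lincomb I x d) p w = (\<lambda>k. \<Sum>i\<in>I. sc (x i) (RR a (d i) p w k))"
  by (simp add: RR_def lincomb_def fun_eq_iff)

lemma loc_lincomb_left:
  assumes "fld c" "\<And>i. i \<in> I \<Longrightarrow> loc K (d i) c"
  shows "loc K (lincomb I x d) c"
  unfolding loc_def
proof (intro allI)
  fix p w k
  have "(\<lambda>k. LL (lincomb I x d) c p w k - RR (lincomb I x d) c p w k) =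
      (\<lambda>k. \<Sum>i\<in>I. sc (x i) (LL (d i) c p w k - RR (d i) c p w k))"
    using assms(1) by (simp add: LL_lincomb_left RR_lincomb_left sum_subtractf scale_right_diff_distrib)
  then show "(dl ^^ K) (\<lambda>k. LL (lincomb I x d) c p w k - RR (lincomb I x d) c p w k) k = 0"
    using assms(2) by (simp add: dl_pow_sum dl_pow_lin[OF lin_sc] loc_def)
qed

lemma rho_lincomb_left:
  assumes "fld c" "\<And>i. i \<in> I \<Longrightarrow> fld (d i)" "\<And>i. i \<in> I \<Longrightarrow> loc K (d i) c"
  shows "rho g (lincomb I x d) c = lincomb I x (\<lambda>i. rho g (d i) c)"
proof (intro ext)
  fix p w
  have g: "gpair K (LL (d i) c p w) (RR (d i) c p w)" if "i \<in> I" for i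
    using that assms by (intro gpair_loc)
  have "rho g (lincomb I x d) c p w =
      (\<Sum>i\<in>I. LAM g (\<lambda>k. sc (x i) (LL (d i) c p w k)) (\<lambda>k. sc (x i) (RR (d i) c p w k)))"
    unfolding rho_def LL_lincomb_left RR_lincomb_left[OF assms(1)]
    by (rule LAM_sum[THEN conjunct1]) (rule gpair_lin[OF g lin_sc])
  also have "\<dots> = lincomb I x (\<lambda>i. rho g (d i) c) p w"
    using lin_LAM[OF g lin_sc] by (simp add: lincomb_def rho_def)
  finally show "rho g (lincomb I x d) c p w = lincomb I x (\<lambda>i. rho g (d i) c) p w" .
qed

lemma rho_lincomb_right:
  assumes "fld a" "\<And>i. i \<in> I \<Longrightarrow> fld (d i)" "\<And>i. i \<in> I \<Longrightarrow> loc K a (d i)"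
  shows "rho g a (lincomb I x d) = lincomb I x (\<lambda>i. rho g a (d i))"
proof (intro ext)
  fix p w
  have g: "gpair K (LL a (d i) p w) (RR a (d i) p w)" if "i \<in> I" for i
    using that assms by (intro gpair_loc)
  have "rho g a (lincomb I x d) p w =
      (\<Sum>i\<in>I. LAM g (\<lambda>k. sc (x i) (LL a (d i) p w k)) (\<lambda>k. sc (x i) (RR a (d i) p w k)))"
    unfolding rho_def LL_lincomb_right[OF assms(1)] RR_lincomb_right
    by (rule LAM_sum[THEN conjunct1]) (rule gpair_lin[OF g lin_sc])
  also have "\<dots> = lincomb I x (\<lambda>i. rho g a (d i)) p w"
    using lin_LAM[OF g lin_sc] by (simp add: lincomb_def rho_def)
  finally show "rho g a (lincomb I x d) p w = lincomb I x (\<lambda>i. rho g a (d i)) p w" .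
qed

lemma rhoj_lincomb_right:
  assumes "fld a" "\<And>i. i \<in> I \<Longrightarrow> fld (d i)"
  shows "rhoj j a (lincomb I x d) = lincomb I x (\<lambda>i. rhoj j a (d i))"
proof (intro ext)
  fix p w
  have "rhoj j a (lincomb I x d) p w =
      (\<Sum>i\<in>I. Lam j (\<lambda>k. sc (x i) (LL a (d i) p w k)) (\<lambda>k. sc (x i) (RR a (d i) p w k)))"
    unfolding rhoj_def LL_lincomb_right[OF assms(1)] RR_lincomb_right
    by (rule Lam_sum) (auto intro!: upz_lin[OF lin_sc] dnz_lin[OF lin_sc] upz_LL dnz_RR assms)
  also have "\<dots> = lincomb I x (\<lambda>i. rhoj j a (d i)) p w"
    using lin_Lam[OF upz_LL dnz_RR lin_sc] assms by (simp add: lincomb_def rhoj_def)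
  finally show "rhoj j a (lincomb I x d) p w = lincomb I x (\<lambda>i. rhoj j a (d i)) p w" .
qed

lemma lin_rhoj:
  assumes "fld a" "fld b"
  shows "lin (rhoj j a b p)"
proof -
  have LL_add: "LL a b p (v + w) = (\<lambda>k. LL a b p v k + LL a b p w k)"
    and RR_add: "RR a b p (v + w) = (\<lambda>k. RR a b p v k + RR a b p w k)" for v w
    using assms by (auto simp: LL_def RR_def fun_eq_iff lin_add fld_lin)
  have LL_sc: "LL a b p (sc c w) = (\<lambda>k. sc c (LL a b p w k))"
    and RR_sc: "RR a b p (sc c w) = (\<lambda>k. sc c (RR a b p w k))" for c w
    using assms by (auto simp: LL_def RR_def fun_eq_iff lin_scale fld_lin)
  show ?thesis
    unfolding lin_def rhoj_def LL_add RR_add LL_sc RR_sc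
    using assms by (auto simp: Lam_add upz_LL dnz_RR lin_Lam[OF _ _ lin_sc, symmetric])
qed

lemma dnz_rhoj:
  assumes "fld a" "fld b"
  shows "dnz (\<lambda>p. rhoj j a b p w)"
proof -
  obtain Nb where Nb: "\<And>k. k < Nb \<Longrightarrow> b k w = 0" using fld_dnzE[OF assms(2)] by blast
  obtain Na where Na: "\<And>k. k < Na \<Longrightarrow> a k w = 0" using fld_dnzE[OF assms(1)] by blast
  obtain N where N: "\<And>k l. k \<in> {Na..0} \<Longrightarrow> l < N \<Longrightarrow> b l (a k w) = 0"
    using fld_uniform[OF assms(2), of Na 0 "\<lambda>k. a k w"] by blast
  show ?thesis
  \<comment> \<open>In the first sum \<open>k \<ge> - j\<close>, so \<open>b\<close> is taken at an
    index below \<open>Nb\<close>. In the second \<open>Na \<le> k \<le> 0\<close>, and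
    \<open>N\<close> bounds \<open>b\<close> uniformly on these finitely many vectors.\<close>
  proof (rule dnzI[of "min (Nb - j) (N + Na)"])
    fix p assume p: "p < min (Nb - j) (N + Na)"
    have "wsum (cA j) (LL a b p w) = (\<Sum>k\<in>{}. sc (cA j k) (LL a b p w k))"
    proof (rule wsum_eq)
      fix k assume k: "cA j k \<noteq> 0" "LL a b p w k \<noteq> 0"
      from k(1) have "k \<ge> - j" by (meson cA_eq_0 not_le_imp_less)
      then have "LL a b p w k = 0" using p lin_0[OF fld_lin[OF assms(1)]] by (simp add: LL_def Nb)
      with k show "k \<in> {}" by simp
    qed simp
    moreover have "wsum (cB j) (RR a b p w) = (\<Sum>k\<in>{}. sc (cB j k) (RR a b p w k))"
    proof (rule wsum_eq)
      fix k assume k: "cB j k \<noteq> 0" "RR a b p w k \<noteq> 0"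
      from k(1) have "k \<le> 0" by (meson cB_eq_0 not_le_imp_less)
      moreover have "k \<ge> Na"
      proof (rule ccontr)
        assume "\<not> k \<ge> Na"
        then have "RR a b p w k = 0" using lin_0[OF fld_lin[OF assms(2)]] by (simp add: RR_def Na)
        with k show False by simp
      qed
      ultimately have "RR a b p w k = 0" using p N[of k "p - k"] by (simp add: RR_def)
      with k show "k \<in> {}" by simp
    qed simp
    ultimately show "rhoj j a b p w = 0" by (simp add: rhoj_def Lam_def)
  qed
qed

lemma fld_rhoj: "fld a \<Longrightarrow> fld b \<Longrightarrow> fld (rhoj j a b)"
  using lin_rhoj dnz_rhoj unfolding fld_def by blast

lemma rho_eq_lincomb:
  assumes "fld a" "fld b" "loc K a b" "int K \<le> hi" "lo \<le> fls_subdegree g"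
  shows "rho g a b = lincomb {lo..<hi} (fls_nth g) (\<lambda>j. rhoj j a b)"
  using LAM_eq_sum[OF gpair_loc[OF assms(1-3)] assms(4,5)]
  by (simp add: rho_def lincomb_def rhoj_def fun_eq_iff)

lemma fld_rho: "fld a \<Longrightarrow> fld b \<Longrightarrow> loc K a b \<Longrightarrow> fld (rho g a b)"
  by (subst rho_eq_lincomb[of a b K, OF _ _ _ order_refl order_refl])
     (auto intro!: fld_lincomb fld_rhoj)

text \<open>Dong's lemma: write \<open>(x2 - x3)^(N+K)\<close> as \<open>(x2 - x3)^K ((x1 - x3) - (x1 - x2))^N\<close>; in each term of
  the expansion some factor is raised to a power that kills the commutator.\<close>

lemma loc_rhoj:
  assumes "fld a" "fld b" "fld c" "loc K a b" "loc K a c" "loc K b c"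
  shows "loc (3 * K + nat (- j)) (rhoj j a b) c"
  unfolding loc_D2
proof (intro allI)
  fix w q0 r0
  define F1 F2 F3 F4 where "F1 = (\<lambda>k q r. a k (b q (c r w)))" and "F2 = (\<lambda>k q r. b q (a k (c r w)))"
    and "F3 = (\<lambda>k q r. c r (a k (b q w)))" and "F4 = (\<lambda>k q r. c r (b q (a k w)))"
  \<comment> \<open>\<open>P\<close> and \<open>Q\<close> are the commutators of \<open>ab\<close>
    and \<open>ba\<close> with \<open>c\<close>. They agree after multiplication by
    \<open>(x1 - x2)^K\<close>, and each is killed by
    \<open>(x1 - x3)^K (x2 - x3)^K\<close>.\<close>
  define P Q where "P = (\<lambda>k q r. F1 k q r - F3 k q r)" and "Q = (\<lambda>k q r. F2 k q r - F4 k q r)"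
  define NN where "NN F F' q r = Lam j (\<lambda>k. F k (q - k) r) (\<lambda>k. F' k (q - k) r)" for F F' q and r :: int
  note ln = fld_lin[OF assms(1)] fld_lin[OF assms(2)] fld_lin[OF assms(3)]
  have lab: "(D2 ^^ K) (\<lambda>k q. a k (b q v) - b q (a k v)) k q = 0"
    and lac: "(D2 ^^ K) (\<lambda>k q. a k (c q v) - c q (a k v)) k q = 0"
    and lbc: "(D2 ^^ K) (\<lambda>k q. b k (c q v) - c q (b k v)) k q = 0" for v k q
    using assms(4-6) by (auto simp: loc_D2)
  have D2_lin: "(D2 ^^ n) (\<lambda>k q. h (G k q)) k q = h ((D2 ^^ n) G k q)" if "lin h" for h n G k q
    unfolding D2_pow dl_pow_lin[OF that] ..
  have uF: "upz3 F1" "upz3 F3" and dF: "dnz3 F2" "dnz3 F4"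
    using upz_LL[OF assms(1,2)] dnz_RR[OF assms(1,2)] upz_lin[OF ln(3) upz_LL[OF assms(1,2)]]
      dnz_lin[OF ln(3) dnz_RR[OF assms(1,2)]]
    unfolding upz3_def dnz3_def F1_def F2_def F3_def F4_def LL_def RR_def by auto
  have uP: "upz3 P" and dQ: "dnz3 Q"
    using uF dF unfolding upz3_def dnz3_def P_def Q_def
    by (auto intro!: upz_diff dnz_diff)
  have PQ0: "(d12 ^^ K) (\<lambda>k q r. P k q r - Q k q r) = (\<lambda>k q r. 0)"
  proof -
    let ?P1 = "\<lambda>k q r. a k (b q (c r w)) - b q (a k (c r w))" and ?P2 = "\<lambda>k q r. c r (a k (b q w) - b q (a k w))"
    have "(\<lambda>k q r. P k q r - Q k q r) = (\<lambda>k q r. ?P1 k q r - ?P2 k q r)"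
      by (auto simp: P_def Q_def F1_def F2_def F3_def F4_def lin_diff[OF ln(3)] fun_eq_iff)
    moreover have "(d12 ^^ K) ?P1 = (\<lambda>k q r. 0)"
      by (simp add: fun_eq_iff d12_pow_D2 lab)
    moreover have "(d12 ^^ K) ?P2 = (\<lambda>k q r. 0)"
      by (simp add: fun_eq_iff d12_pow_D2 lab D2_lin[OF ln(3)] lin_0[OF ln(3)])
    ultimately show ?thesis by (simp only: d12_pow_diff[of K ?P1 ?P2]) simp
  qed
  have P0: "(d13 ^^ K) ((d23 ^^ K) P) = (\<lambda>k q r. 0)"
  proof -
    let ?P1 = "\<lambda>k q r. a k (b q (c r w) - c r (b q w))" and ?P2 = "\<lambda>k q r. a k (c r (b q w)) - c r (a k (b q w))"
    have "P = (\<lambda>k q r. ?P1 k q r + ?P2 k q r)"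
      by (auto simp: P_def F1_def F3_def lin_diff[OF ln(1)] fun_eq_iff)
    moreover have "(d23 ^^ K) ?P1 = (\<lambda>k q r. 0)"
      by (simp add: fun_eq_iff d23_pow_D2 lbc D2_lin[OF ln(1)] lin_0[OF ln(1)])
    moreover have "(d13 ^^ K) ?P2 = (\<lambda>k q r. 0)"
      by (simp add: fun_eq_iff d13_pow_D2 lac)
    ultimately show ?thesis
      by (simp add: d23_pow_add funpow_commute2[of d13 d23, OF d13_d23] d_pow_zero)
  qed
  have Q0: "(d13 ^^ K) ((d23 ^^ K) Q) = (\<lambda>k q r. 0)"
  proof -
    let ?P1 = "\<lambda>k q r. b q (a k (c r w) - c r (a k w))" and ?P2 = "\<lambda>k q r. b q (c r (a k w)) - c r (b q (a k w))"
    have "Q = (\<lambda>k q r. ?P1 k q r + ?P2 k q r)"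
      by (auto simp: Q_def F2_def F4_def lin_diff[OF ln(2)] fun_eq_iff)
    moreover have "(d13 ^^ K) ?P1 = (\<lambda>k q r. 0)"
      by (simp add: fun_eq_iff d13_pow_D2 lac D2_lin[OF ln(2)] lin_0[OF ln(2)])
    moreover have "(d23 ^^ K) ?P2 = (\<lambda>k q r. 0)"
      by (simp add: fun_eq_iff d23_pow_D2 lbc)
    ultimately show ?thesis
      by (simp add: d23_pow_add) (simp add: funpow_commute2[of d13 d23, OF d13_d23] d_pow_zero)
  qed
  have NN_d12: "Lam i (\<lambda>k. (d12 ^^ n) F k (q - k) r) (\<lambda>k. (d12 ^^ n) F' k (q - k) r) =
      Lam (i + int n) (\<lambda>k. F k (q - int n - k) r) (\<lambda>k. F' k (q - int n - k) r)"
    if "upz3 F" "dnz3 F'" for i n F F' q r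
  proof (induction n arbitrary: i q)
    case (Suc n)
    have "(\<lambda>k. (d12 ^^ Suc n) G k (q - k) r) = dl (\<lambda>k. (d12 ^^ n) G k (q - 1 - k) r)" for G :: "int \<Rightarrow> int \<Rightarrow> int \<Rightarrow> 'w"
      by (auto simp: fun_eq_iff dl_def d12_def algebra_simps)
    then have "Lam i (\<lambda>k. (d12 ^^ Suc n) F k (q - k) r) (\<lambda>k. (d12 ^^ Suc n) F' k (q - k) r) =
        Lam (i + 1) (\<lambda>k. (d12 ^^ n) F k (q - 1 - k) r) (\<lambda>k. (d12 ^^ n) F' k (q - 1 - k) r)"
      using upz3_pow(1)[OF that(1), of n] dnz3_pow(1)[OF that(2), of n]
      by (simp only: Lam_dl upz3_def dnz3_def)
    also have "\<dots> = Lam (i + int (Suc n)) (\<lambda>k. F k (q - int (Suc n) - k) r) (\<lambda>k. F' k (q - int (Suc n) - k) r)"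
      unfolding Suc.IH by (simp add: algebra_simps)
    finally show ?case .
  qed simp
  \<comment> \<open>One factor \<open>(x2 - x3)^K\<close> is set aside. Among the remaining factors,
    once rewritten, either \<open>K\<close> are \<open>x1 - x3\<close> and kill both terms, or
    enough are \<open>x1 - x2\<close> to raise the exponent \<open>j\<close> to at least
    \<open>K\<close>.\<close>
  have key: "NN ((d12 ^^ i) ((d13 ^^ m) ((d23 ^^ N) ((d23 ^^ K) P))))
      ((d12 ^^ i) ((d13 ^^ m) ((d23 ^^ N) ((d23 ^^ K) Q)))) q r = 0"
    if "i + m + N \<ge> 2 * K + nat (- j)" for i m N q r
    using that
  proof (induction N arbitrary: i m)
    case 0
    show ?case
    proof (cases "m \<ge> K")
      case True
      then have "(d13 ^^ m) F = (d13 ^^ (m - K)) ((d13 ^^ K) F)" for F :: "int \<Rightarrow> int \<Rightarrow> int \<Rightarrow> 'w"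
        using fun_cong[OF funpow_add[of "m - K" K d13], of F] by simp
      then show ?thesis
        by (simp add: P0 Q0 d_pow_zero NN_def Lam_def wsum_def)
    next
      case False
      then have i: "int K \<le> j + int i" using 0 by linarith
      define P' Q' where "P' = (d13 ^^ m) ((d23 ^^ K) P)" and "Q' = (d13 ^^ m) ((d23 ^^ K) Q)"
      have u: "upz3 P'" "dnz3 Q'" unfolding P'_def Q'_def using uP dQ by (auto intro: upz3_pow dnz3_pow)
      have PQ': "(d12 ^^ K) (\<lambda>k q r. P' k q r - Q' k q r) = (\<lambda>k q r. 0)"
      proof -
        have "(\<lambda>k q r. P' k q r - Q' k q r) = (d13 ^^ m) ((d23 ^^ K) (\<lambda>k q r. P k q r - Q k q r))"
          by (simp add: P'_def Q'_def d13_pow_diff d23_pow_diff)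
        then show ?thesis
          by (simp add: funpow_commute2[of d12 d13, OF d12_d13] funpow_commute2[of d12 d23, OF d12_d23] PQ0 d_pow_zero)
      qed
      have "gpair K (\<lambda>k. P' k (q - int i - k) r) (\<lambda>k. Q' k (q - int i - k) r)"
        unfolding gpair_def
      proof (intro conjI allI)
        show "upz (\<lambda>k. P' k (q - int i - k) r)" "dnz (\<lambda>k. Q' k (q - int i - k) r)"
          using u by (auto simp: upz3_def dnz3_def)
        fix k
        have "(d12 ^^ K) (\<lambda>k q r. P' k q r - Q' k q r) k (q - int i + int K - k) r = 0"
          by (simp add: PQ')
        then show "(dl ^^ K) (\<lambda>k. P' k (q - int i - k) r - Q' k (q - int i - k) r) k = 0"
          by (simp add: d12_pow_D2 D2_pow algebra_simps)
      qed
      from Lam_eq_0[OF this i] show ?thesis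
        by (simp add: NN_def NN_d12[OF u] flip: P'_def Q'_def)
    qed
  next
    case (Suc N)
    let ?P = "(d23 ^^ N) ((d23 ^^ K) P)" and ?Q = "(d23 ^^ N) ((d23 ^^ K) Q)"
    have split: "(d12 ^^ i) ((d13 ^^ m) (d23 X)) =
        (\<lambda>k q r. (d12 ^^ i) ((d13 ^^ Suc m) X) k q r - (d12 ^^ Suc i) ((d13 ^^ m) X) k q r)" for X :: "int \<Rightarrow> int \<Rightarrow> int \<Rightarrow> 'w"
    proof -
      have "(d13 ^^ m) (d12 X) = d12 ((d13 ^^ m) X)" by (rule funpow_commute1) (simp add: d12_d13)
      then show ?thesis by (simp add: d23_eq d13_pow_diff d12_pow_diff funpow_swap1)
    qed
    have u: "upz3 ((d12 ^^ i) ((d13 ^^ m) ?P))" "dnz3 ((d12 ^^ i) ((d13 ^^ m) ?Q))" for i m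
      using uP dQ by (intro upz3_pow dnz3_pow; simp)+
    have "NN ((d12 ^^ i) ((d13 ^^ m) (d23 ?P))) ((d12 ^^ i) ((d13 ^^ m) (d23 ?Q))) q r =
        NN ((d12 ^^ i) ((d13 ^^ Suc m) ?P)) ((d12 ^^ i) ((d13 ^^ Suc m) ?Q)) q r -
        NN ((d12 ^^ Suc i) ((d13 ^^ m) ?P)) ((d12 ^^ Suc i) ((d13 ^^ m) ?Q)) q r"
      unfolding split NN_def
      by (rule Lam_diff) (use u[of i "Suc m"] u[of "Suc i" m] in \<open>simp_all only: upz3_def dnz3_def\<close>)
    also have "\<dots> = 0" using Suc.IH[of i "Suc m"] Suc.IH[of "Suc i" m] Suc.prems by simp
    finally show ?case by simp
  qed
  have NN_d23: "NN ((d23 ^^ n) P) ((d23 ^^ n) Q) q r = (D2 ^^ n) (NN P Q) q r" for n q r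
  proof (induction n arbitrary: q r)
    case (Suc n)
    have u: "upz3 ((d23 ^^ n) P)" "dnz3 ((d23 ^^ n) Q)"
      using uP dQ by (auto intro: upz3_pow dnz3_pow)
    have "NN ((d23 ^^ Suc n) P) ((d23 ^^ Suc n) Q) q r =
        Lam j (\<lambda>k. (d23 ^^ n) P k (q - 1 - k) r - (d23 ^^ n) P k (q - k) (r - 1))
              (\<lambda>k. (d23 ^^ n) Q k (q - 1 - k) r - (d23 ^^ n) Q k (q - k) (r - 1))"
      by (simp add: NN_def d23_def algebra_simps)
    also have "\<dots> = NN ((d23 ^^ n) P) ((d23 ^^ n) Q) (q - 1) r - NN ((d23 ^^ n) P) ((d23 ^^ n) Q) q (r - 1)"
      unfolding NN_def by (rule Lam_diff) (use u in \<open>simp_all add: upz3_def dnz3_def\<close>)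
    finally show ?case by (simp add: Suc.IH D2_def)
  qed simp
  have "(\<lambda>q r. rhoj j a b q (c r w) - c r (rhoj j a b q w)) = NN P Q"
  proof (intro ext)
    fix q r
    have "c r (rhoj j a b q w) = Lam j (\<lambda>k. F3 k (q - k) r) (\<lambda>k. F4 k (q - k) r)"
      unfolding rhoj_def lin_Lam[OF upz_LL[OF assms(1,2)] dnz_RR[OF assms(1,2)] ln(3)]
      by (simp add: F3_def F4_def LL_def RR_def)
    moreover have "rhoj j a b q (c r w) = Lam j (\<lambda>k. F1 k (q - k) r) (\<lambda>k. F2 k (q - k) r)"
      by (simp add: rhoj_def F1_def F2_def LL_def[abs_def] RR_def[abs_def])
    ultimately show "rhoj j a b q (c r w) - c r (rhoj j a b q w) = NN P Q q r"
      using uF dF unfolding NN_def P_def Q_def by (subst Lam_diff) (auto simp: upz3_def dnz3_def)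
  qed
  then have "(D2 ^^ (2 * K + nat (- j) + K)) (\<lambda>q r. rhoj j a b q (c r w) - c r (rhoj j a b q w)) q0 r0 =
      NN ((d23 ^^ (2 * K + nat (- j) + K)) P) ((d23 ^^ (2 * K + nat (- j) + K)) Q) q0 r0"
    by (simp add: NN_d23)
  also have "\<dots> = 0"
    using key[of 0 0 "2 * K + nat (- j)" q0 r0] by (simp only: funpow_add comp_apply) simp
  moreover have "3 * K + nat (- j) = 2 * K + nat (- j) + K" by simp
  ultimately show "(D2 ^^ (3 * K + nat (- j))) (\<lambda>q r. rhoj j a b q (c r w) - c r (rhoj j a b q w)) q0 r0 = 0"
    by (simp only:)
qed

lemma loc_rho:
  assumes "fld a" "fld b" "fld c" "loc K a b" "loc K a c" "loc K b c"
  shows "\<exists>K'. loc K' (rho g a b) c"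
proof
  \<comment> \<open>The exponent grows with \<open>- j\<close>, so the lowest power of
    \<open>z\<close> in \<open>g\<close> decides.\<close>
  show "loc (3 * K + nat (- fls_subdegree g)) (rho g a b) c"
    unfolding rho_eq_lincomb[OF assms(1,2,4) order_refl order_refl]
    by (intro loc_lincomb_left assms loc_mono[OF loc_rhoj[OF assms]]) auto
qed

end

section \<open>The commutator formula\<close>

lemma fls_times_nth_below:
  fixes f h :: "complex fls"
  assumes "\<And>j. j < A \<Longrightarrow> f $$ j = 0" "\<And>j. j < B \<Longrightarrow> h $$ j = 0" "j < A + B"
  shows "(f * h) $$ j = 0"
proof (cases "f = 0 \<or> h = 0")
  case False
  then have "A \<le> fls_subdegree f" "B \<le> fls_subdegree h"
    using assms by (auto intro: fls_subdegree_geI)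
  then show ?thesis using assms(3) by (intro fls_times_nth_eq0) auto
qed auto

section \<open>Double sums and iterated products\<close>

context complex_space
begin

definition fin2 :: "(int \<Rightarrow> complex) \<Rightarrow> (int \<Rightarrow> complex) \<Rightarrow> (int \<Rightarrow> int \<Rightarrow> 'w) \<Rightarrow> bool" where
  "fin2 \<alpha> \<beta> F \<longleftrightarrow> finite {(k, l). \<alpha> k \<noteq> 0 \<and> \<beta> l \<noteq> 0 \<and> F k l \<noteq> 0}"

definition wsum2 :: "(int \<Rightarrow> complex) \<Rightarrow> (int \<Rightarrow> complex) \<Rightarrow> (int \<Rightarrow> int \<Rightarrow> 'w) \<Rightarrow> 'w" where
  "wsum2 \<alpha> \<beta> F = Sum_any (\<lambda>(k, l). sc (\<alpha> k * \<beta> l) (F k l))"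

lemma fin2I:
  assumes "\<And>k l. \<alpha> k \<noteq> 0 \<Longrightarrow> \<beta> l \<noteq> 0 \<Longrightarrow> F k l \<noteq> 0 \<Longrightarrow> A \<le> k \<and> k \<le> B \<and> C \<le> l \<and> l \<le> D"
  shows "fin2 \<alpha> \<beta> F"
  unfolding fin2_def by (rule finite_subset[of _ "{A..B} \<times> {C..D}"]) (use assms in auto)

lemma fin2_mono:
  assumes "fin2 \<alpha> \<beta> F" "\<And>k l. \<alpha>' k \<noteq> 0 \<Longrightarrow> F' k l \<noteq> 0 \<Longrightarrow> \<alpha> k \<noteq> 0 \<and> F k l \<noteq> 0"
  shows "fin2 \<alpha>' \<beta> F'"
  using assms(1) unfolding fin2_def by (rule rev_finite_subset) (use assms(2) in auto)

lemma fin2_swap: "fin2 \<alpha> \<beta> F \<Longrightarrow> fin2 \<beta> \<alpha> (\<lambda>l k. F k l)"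
proof -
  assume "fin2 \<alpha> \<beta> F"
  then have "finite (prod.swap ` {(k, l). \<alpha> k \<noteq> 0 \<and> \<beta> l \<noteq> 0 \<and> F k l \<noteq> 0})" by (simp add: fin2_def)
  then show ?thesis unfolding fin2_def by (rule rev_finite_subset) (auto simp: image_iff)
qed

lemma wsum2_swap: "wsum2 \<alpha> \<beta> F = wsum2 \<beta> \<alpha> (\<lambda>l k. F k l)"
  unfolding wsum2_def
proof (rule Sum_any.reindex_cong[of prod.swap])
  show "bij (prod.swap :: int \<times> int \<Rightarrow> int \<times> int)" by simp
qed (auto simp: fun_eq_iff mult.commute)

lemma finite_wsum2: "fin2 \<alpha> \<beta> F \<Longrightarrow> finite {x. (case x of (k, l) \<Rightarrow> sc (\<alpha> k * \<beta> l) (F k l)) \<noteq> 0}"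
  unfolding fin2_def by (erule rev_finite_subset) auto

lemma wsum2_diff:
  assumes "fin2 \<alpha> \<beta> F" "fin2 \<alpha> \<beta> G"
  shows "wsum2 \<alpha> \<beta> (\<lambda>k l. F k l - G k l) = wsum2 \<alpha> \<beta> F - wsum2 \<alpha> \<beta> G"
proof -
  have "wsum2 \<alpha> \<beta> (\<lambda>k l. F k l - G k l) =
      Sum_any (\<lambda>x. (case x of (k, l) \<Rightarrow> sc (\<alpha> k * \<beta> l) (F k l)) - (case x of (k, l) \<Rightarrow> sc (\<alpha> k * \<beta> l) (G k l)))"
    unfolding wsum2_def by (auto intro!: Sum_any.cong simp: scale_right_diff_distrib)
  also have "\<dots> = wsum2 \<alpha> \<beta> F - wsum2 \<alpha> \<beta> G"
    unfolding wsum2_def by (rule Sum_any_diff[OF finite_wsum2[OF assms(1)] finite_wsum2[OF assms(2)]])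
  finally show ?thesis .
qed

lemma wsum2_add:
  assumes "fin2 \<alpha> \<beta> F" "fin2 \<alpha> \<beta> G"
  shows "wsum2 \<alpha> \<beta> (\<lambda>k l. F k l + G k l) = wsum2 \<alpha> \<beta> F + wsum2 \<alpha> \<beta> G \<and> fin2 \<alpha> \<beta> (\<lambda>k l. F k l + G k l)"
proof
  have "wsum2 \<alpha> \<beta> (\<lambda>k l. F k l + G k l) =
      Sum_any (\<lambda>x. (case x of (k, l) \<Rightarrow> sc (\<alpha> k * \<beta> l) (F k l)) + (case x of (k, l) \<Rightarrow> sc (\<alpha> k * \<beta> l) (G k l)))"
    unfolding wsum2_def by (auto intro!: Sum_any.cong simp: scale_right_distrib)
  also have "\<dots> = wsum2 \<alpha> \<beta> F + wsum2 \<alpha> \<beta> G"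
    unfolding wsum2_def by (rule Sum_any.distrib[OF finite_wsum2[OF assms(1)] finite_wsum2[OF assms(2)]])
  finally show "wsum2 \<alpha> \<beta> (\<lambda>k l. F k l + G k l) = wsum2 \<alpha> \<beta> F + wsum2 \<alpha> \<beta> G" .
  show "fin2 \<alpha> \<beta> (\<lambda>k l. F k l + G k l)"
    unfolding fin2_def by (rule finite_subset[OF _ finite_UnI[OF assms[unfolded fin2_def]]]) auto
qed

lemma wsum2_sum:
  assumes "finite I" "\<And>i. i \<in> I \<Longrightarrow> fin2 \<alpha> \<beta> (F i)"
  shows "wsum2 \<alpha> \<beta> (\<lambda>k l. \<Sum>i\<in>I. F i k l) = (\<Sum>i\<in>I. wsum2 \<alpha> \<beta> (F i)) \<and> fin2 \<alpha> \<beta> (\<lambda>k l. \<Sum>i\<in>I. F i k l)"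
  using assms
proof (induction I rule: finite_induct)
  case (insert i I)
  then show ?case using wsum2_add[of \<alpha> \<beta> "F i" "\<lambda>k l. \<Sum>i\<in>I. F i k l"] by simp
qed (auto simp: wsum2_def fin2_def case_prod_beta)

lemma wsum_wsum:
  assumes "fin2 \<alpha> \<beta> F"
  shows "wsum \<alpha> (\<lambda>k. wsum \<beta> (F k)) = wsum2 \<alpha> \<beta> F" "fsupp \<alpha> (\<lambda>k. wsum \<beta> (F k))"
    "\<alpha> k \<noteq> 0 \<Longrightarrow> fsupp \<beta> (F k)"
proof -
  let ?S = "{(k, l). \<alpha> k \<noteq> 0 \<and> \<beta> l \<noteq> 0 \<and> F k l \<noteq> 0}"
  have fin: "finite ?S" using assms by (simp add: fin2_def)
  show f: "fsupp \<beta> (F k)" if "\<alpha> k \<noteq> 0" for k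
    unfolding fsupp_def by (rule finite_subset[OF _ finite_imageI[OF fin, of snd]]) (use that in force)
  show "fsupp \<alpha> (\<lambda>k. wsum \<beta> (F k))"
    unfolding fsupp_def
  proof (rule finite_subset[OF _ finite_imageI[OF fin, of fst]], safe)
    fix k assume "\<alpha> k \<noteq> 0" "wsum \<beta> (F k) \<noteq> 0"
    from this(2) obtain l where "sc (\<beta> l) (F k l) \<noteq> 0"
      unfolding wsum_def by (rule Sum_any.not_neutral_obtains_not_neutral)
    then show "k \<in> fst ` ?S" using \<open>\<alpha> k \<noteq> 0\<close> by (force simp: image_iff)
  qed
  have "sc (\<alpha> k) (wsum \<beta> (F k)) = Sum_any (\<lambda>l. sc (\<alpha> k * \<beta> l) (F k l))" for k
  proof (cases "\<alpha> k = 0")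
    case False
    from wsum_scale[OF f[OF this], of "\<alpha> k"] show ?thesis
      by (simp add: wsum_def mult.commute)
  qed simp
  then have "wsum \<alpha> (\<lambda>k. wsum \<beta> (F k)) = Sum_any (\<lambda>k. Sum_any (\<lambda>l. sc (\<alpha> k * \<beta> l) (F k l)))"
    by (simp add: wsum_def[of \<alpha>])
  also have "\<dots> = wsum2 \<alpha> \<beta> F"
    unfolding wsum2_def by (rule Sum_any_Sum_any_pair) (rule finite_subset[OF _ fin], auto)
  finally show "wsum \<alpha> (\<lambda>k. wsum \<beta> (F k)) = wsum2 \<alpha> \<beta> F" .
qed

lemma wsum2_convolution:
  assumes "fin2 \<alpha> \<beta> (\<lambda>k l. H (k + l))"
  shows "wsum2 \<alpha> \<beta> (\<lambda>k l. H (k + l)) = wsum (\<lambda>s. Sum_any (\<lambda>k. \<alpha> k * \<beta> (s - k))) H"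
proof -
  let ?S = "{(k, l). \<alpha> k \<noteq> 0 \<and> \<beta> l \<noteq> 0 \<and> H (k + l) \<noteq> 0}"
  have fin: "finite ?S" using assms by (simp add: fin2_def)
  have "wsum2 \<alpha> \<beta> (\<lambda>k l. H (k + l)) = Sum_any (\<lambda>(s, k). sc (\<alpha> k * \<beta> (s - k)) (H s))"
    unfolding wsum2_def
  proof (rule Sum_any.reindex_cong[of "\<lambda>(s, k). (k, s - k)"])
    show "bij (\<lambda>(s, k). (k :: int, s - k))"
      by (rule bij_betw_byWitness[of _ "\<lambda>(k, l). (k + l, k)"]) auto
  qed (auto simp: fun_eq_iff)
  also have "\<dots> = Sum_any (\<lambda>s. Sum_any (\<lambda>k. sc (\<alpha> k * \<beta> (s - k)) (H s)))"
  proof (rule Sum_any_Sum_any_pair[symmetric])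
    show "finite {(s, k). sc (\<alpha> k * \<beta> (s - k)) (H s) \<noteq> 0}"
      by (rule finite_subset[OF _ finite_imageI[OF fin, of "\<lambda>(k, l). (k + l, k)"]])
         (force simp: image_iff)
  qed
  also have "(\<lambda>s. Sum_any (\<lambda>k. sc (\<alpha> k * \<beta> (s - k)) (H s))) = (\<lambda>s. sc (Sum_any (\<lambda>k. \<alpha> k * \<beta> (s - k))) (H s))"
  proof
    fix s
    show "Sum_any (\<lambda>k. sc (\<alpha> k * \<beta> (s - k)) (H s)) = sc (Sum_any (\<lambda>k. \<alpha> k * \<beta> (s - k))) (H s)"
    proof (cases "H s = 0")
      case False
      then have "{k. sc (\<alpha> k * \<beta> (s - k)) (H s) \<noteq> 0} = {k. \<alpha> k * \<beta> (s - k) \<noteq> 0}" by auto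
      then show ?thesis by (simp add: Sum_any.expand_set scale_sum_left)
    qed simp
  qed
  finally show ?thesis by (simp add: wsum_def)
qed

text \<open>The expansions bound \<open>k\<close> and \<open>l\<close> below, and truncation of
  \<open>c\<close> bounds \<open>k + l\<close> above. \<open>G\<close> abstracts from the order of
  the two outer operators, since both orders occur in a commutator.\<close>

lemma fin2_AA: "fld c \<Longrightarrow> (\<And>k l v. G k l 0 = 0) \<Longrightarrow> fin2 (cA m) (cA n) (\<lambda>k l. G k l (c (p - k - l) w))"
proof -
  assume c: "fld c" and G: "\<And>k l v. G k l 0 = 0"
  obtain N where N: "\<And>k. k < N \<Longrightarrow> c k w = 0" using fld_dnzE[OF c] by blast
  show ?thesis
  proof (rule fin2I[of _ _ _ "- m" "p - N + n" "- n" "p - N + m"])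
    fix k l assume *: "cA m k \<noteq> 0" "cA n l \<noteq> 0" "G k l (c (p - k - l) w) \<noteq> 0"
    have "- m \<le> k" "- n \<le> l" using * by (meson cA_eq_0 not_le_imp_less)+
    moreover have "\<not> p - k - l < N" using * N G by metis
    ultimately show "- m \<le> k \<and> k \<le> p - N + n \<and> - n \<le> l \<and> l \<le> p - N + m" by auto
  qed
qed

text \<open>\<open>cA\<close> bounds \<open>k\<close> below and \<open>cB\<close> bounds
  \<open>l\<close> above. Truncation of \<open>b\<close> bounds \<open>l\<close> below, and a
  uniform truncation of \<open>c\<close> on the finitely many vectors \<open>b l w\<close> then
  bounds \<open>k\<close> above.\<close>

lemma fin2_AB: "fld b \<Longrightarrow> fld c \<Longrightarrow> (\<And>k. G k 0 = 0) \<Longrightarrow> fin2 (cA m) (cB n) (\<lambda>k l. G k (c (p - k - l) (b l w)))"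
proof -
  assume bc: "fld b" "fld c" and G: "\<And>k. G k 0 = 0"
  obtain N where N: "\<And>k. k < N \<Longrightarrow> b k w = 0" using fld_dnzE[OF bc(1)] by blast
  obtain M where M: "\<And>k l. k \<in> {N..0} \<Longrightarrow> l < M \<Longrightarrow> c l (b k w) = 0"
    using fld_uniform[OF bc(2), of N 0 "\<lambda>k. b k w"] by blast
  show ?thesis
  proof (rule fin2I[of _ _ _ "- m" "p - M - N" N 0])
    fix k l assume *: "cA m k \<noteq> 0" "cB n l \<noteq> 0" "G k (c (p - k - l) (b l w)) \<noteq> 0"
    have 1: "- m \<le> k" "l \<le> 0" using * by (meson cA_eq_0 cB_eq_0 not_le_imp_less)+
    have 2: "N \<le> l"
    proof (rule ccontr)
      assume "\<not> N \<le> l"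
      with * G N lin_0[OF fld_lin[OF bc(2)]] show False by simp
    qed
    with 1 have "\<not> p - k - l < M" using * M[of l "p - k - l"] G by auto
    with 1 2 show "- m \<le> k \<and> k \<le> p - M - N \<and> N \<le> l \<and> l \<le> 0" by auto
  qed
qed

lemma fin2_BB: "fld a \<Longrightarrow> fld b \<Longrightarrow> (\<And>k l. G k l 0 = 0) \<Longrightarrow> fin2 (cB m) (cB n) (\<lambda>k l. G k l (b l (a k w)))"
proof -
  assume ab: "fld a" "fld b" and G: "\<And>k l. G k l 0 = 0"
  obtain N where N: "\<And>k. k < N \<Longrightarrow> a k w = 0" using fld_dnzE[OF ab(1)] by blast
  obtain M where M: "\<And>k l. k \<in> {N..0} \<Longrightarrow> l < M \<Longrightarrow> b l (a k w) = 0"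
    using fld_uniform[OF ab(2), of N 0 "\<lambda>k. a k w"] by blast
  show ?thesis
  proof (rule fin2I[of _ _ _ N 0 M 0])
    fix k l assume *: "cB m k \<noteq> 0" "cB n l \<noteq> 0" "G k l (b l (a k w)) \<noteq> 0"
    have 1: "k \<le> 0" "l \<le> 0" using * by (meson cB_eq_0 not_le_imp_less)+
    have 2: "N \<le> k"
    proof (rule ccontr)
      assume "\<not> N \<le> k"
      with * G N lin_0[OF fld_lin[OF ab(2)]] show False by simp
    qed
    with 1 have "\<not> l < M" using * M[of k l] G by auto
    with 1 2 show "N \<le> k \<and> k \<le> 0 \<and> M \<le> l \<and> l \<le> 0" by auto
  qed
qed

lemma rhoj_rhoj:
  assumes "fld a" "fld b" "fld c"
  shows "rhoj m a (rhoj n b c) p w =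
     (wsum2 (cA m) (cA n) (\<lambda>k l. a k (b l (c (p - k - l) w)))
      - wsum2 (cA m) (cB n) (\<lambda>k l. a k (c (p - k - l) (b l w))))
   - (wsum2 (cB m) (cA n) (\<lambda>k l. b l (c (p - k - l) (a k w)))
      - wsum2 (cB m) (cB n) (\<lambda>k l. c (p - k - l) (b l (a k w))))"
proof -
  note ln = fld_lin[OF assms(1)] fld_lin[OF assms(2)] fld_lin[OF assms(3)]
  note z = lin_0[OF ln(1)] lin_0[OF ln(2)] lin_0[OF ln(3)]
  have f1: "fin2 (cA m) (cA n) (\<lambda>k l. a k (b l (c (p - k - l) w)))"
    by (rule fin2_AA[OF assms(3)]) (simp add: z)
  have f2: "fin2 (cA m) (cB n) (\<lambda>k l. a k (c (p - k - l) (b l w)))"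
    by (rule fin2_AB[OF assms(2,3)]) (simp add: z)
  have f3: "fin2 (cB m) (cA n) (\<lambda>k l. b l (c (p - k - l) (a k w)))"
    using fin2_swap[OF fin2_AB[OF assms(1,3), of b n m p w]] by (simp add: z algebra_simps)
  have f4: "fin2 (cB m) (cB n) (\<lambda>k l. c (p - k - l) (b l (a k w)))"
    by (rule fin2_BB[OF assms(1,2)]) (simp add: z)
  have e1: "a k (rhoj n b c (p - k) w) = wsum (cA n) (\<lambda>l. a k (b l (c (p - k - l) w))) - wsum (cB n) (\<lambda>l. a k (c (p - k - l) (b l w)))" for k
    unfolding rhoj_def lin_Lam[OF upz_LL[OF assms(2,3)] dnz_RR[OF assms(2,3)] ln(1)]
    by (simp add: Lam_def LL_def RR_def)
  have e2: "rhoj n b c (p - k) (a k w) = wsum (cA n) (\<lambda>l. b l (c (p - k - l) (a k w))) - wsum (cB n) (\<lambda>l. c (p - k - l) (b l (a k w)))" for k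
    by (simp add: rhoj_def Lam_def LL_def[abs_def] RR_def[abs_def])
  have "rhoj m a (rhoj n b c) p w = wsum (cA m) (\<lambda>k. a k (rhoj n b c (p - k) w)) - wsum (cB m) (\<lambda>k. rhoj n b c (p - k) (a k w))"
    by (simp add: rhoj_def[of m] Lam_def LL_def[abs_def] RR_def[abs_def])
  then show ?thesis
    unfolding e1 e2 using f1 f2 f3 f4 by (simp add: wsum_diff wsum_wsum)
qed

lemma rhoj_newton:
  assumes "fld a" "fld b" "loc K a b"
  shows "a k (b l w) - b l (a k w) = (\<Sum>i<K. sc (of_int (- k) gchoose i) (rhoj (int i) a b (k + l) w))"
  using gpair_newton[OF gpair_loc[OF assms, of "k + l" w], of k] by (simp add: LL_def RR_def rhoj_def)

text \<open>Since \<open>H\<close> sees only \<open>k + l\<close>, the double sum is a convolution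
  of the weights, and the binomial factor acts on the first weight as a divided derivative. The
  weight \<gamma> is abstract so that one proof serves both expansions.\<close>

lemma wsum2_gchoose:
  assumes absorb: "\<And>k. (of_int (- k) gchoose i) * \<gamma> m k = (of_int m gchoose i) * \<gamma> (m - int i) (k + int i)"
    and conv: "\<And>m n s. Sum_any (\<lambda>k. \<gamma> m k * \<gamma> n (s - k)) = \<gamma> (m + n) s"
    and fin: "\<And>m n s. finite {k. \<gamma> m k * \<gamma> n (s - k) \<noteq> 0}"
    and H: "fin2 (\<gamma> m) (\<gamma> n) (\<lambda>k l. H (k + l))" "fsupp (\<gamma> (m + n - int i)) (\<lambda>s. H (s - int i))"
  shows "wsum2 (\<gamma> m) (\<gamma> n) (\<lambda>k l. sc (of_int (- k) gchoose i) (H (k + l))) =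
    sc (of_int m gchoose i) (wsum (\<lambda>s. \<gamma> (m + n - int i) (s + int i)) H)"
proof -
  let ?b = "of_int m gchoose i :: complex"
  have "wsum2 (\<gamma> m) (\<gamma> n) (\<lambda>k l. sc (of_int (- k) gchoose i) (H (k + l))) =
      wsum2 (\<lambda>k. (of_int (- k) gchoose i) * \<gamma> m k) (\<gamma> n) (\<lambda>k l. H (k + l))"
    by (simp add: wsum2_def mult_ac)
  also have "\<dots> = wsum (\<lambda>s. Sum_any (\<lambda>k. (of_int (- k) gchoose i) * \<gamma> m k * \<gamma> n (s - k))) H"
    by (rule wsum2_convolution, rule fin2_mono[OF H(1)]) auto
  also have "(\<lambda>s. Sum_any (\<lambda>k. (of_int (- k) gchoose i) * \<gamma> m k * \<gamma> n (s - k))) =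
      (\<lambda>s. ?b * \<gamma> (m + n - int i) (s + int i))"
  proof
    fix s
    let ?g = "\<lambda>k. \<gamma> (m - int i) k * \<gamma> n (s + int i - k)"
    have "Sum_any (\<lambda>k. ?b * ?g (k + int i)) = Sum_any (\<lambda>k. ?b * ?g k)"
      by (rule Sum_any_reindex_shift)
    also have "\<dots> = ?b * \<gamma> (m + n - int i) (s + int i)"
      by (simp add: Sum_any_right_distrib[OF fin, symmetric] conv algebra_simps)
    finally show "Sum_any (\<lambda>k. (of_int (- k) gchoose i) * \<gamma> m k * \<gamma> n (s - k)) = ?b * \<gamma> (m + n - int i) (s + int i)"
      unfolding absorb by (simp add: mult.assoc)
  qed
  also have "wsum \<dots> H = sc ?b (wsum (\<lambda>s. \<gamma> (m + n - int i) (s + int i)) H)"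
    by (rule wsum_scale_left) (simp add: fsupp_shift H(2))
  finally show ?thesis .
qed

text \<open>The mixed terms, with one expansion at infinity and one at 0, cancel between the two
  orders. The others contain the commutator of \<open>a\<close> and \<open>b\<close>, which Newton's
  formula expands. The shift by \<open>i\<close> in the result is a factor
  \<open>y^i = (1 + z)^i\<close>.\<close>

lemma rhoj_commutator:
  assumes "fld a" "fld b" "fld c" "loc K a b"
  shows "rhoj m a (rhoj n b c) p w - rhoj n b (rhoj m a c) p w =
    (\<Sum>i<K. sc (of_int m gchoose i)
       (Lam (m + n - int i) (\<lambda>s. LL (rhoj (int i) a b) c p w (s - int i)) (\<lambda>s. RR (rhoj (int i) a b) c p w (s - int i))))"
proof -
  note ln = fld_lin[OF assms(1)] fld_lin[OF assms(2)] fld_lin[OF assms(3)]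
  note z = lin_0[OF ln(1)] lin_0[OF ln(2)] lin_0[OF ln(3)]
  define e where "e i = rhoj (int i) a b" for i
  have fe: "fld (e i)" for i unfolding e_def by (rule fld_rhoj[OF assms(1,2)])
  have sub: "p - l - k = p - k - l" for k l :: int by simp
  let ?A = "wsum2 (cA m) (cA n)" and ?B = "wsum2 (cB m) (cB n)"
  let ?L = "\<lambda>i. LL (e i) c p w" and ?R = "\<lambda>i. RR (e i) c p w"
  have "rhoj m a (rhoj n b c) p w - rhoj n b (rhoj m a c) p w =
      (?A (\<lambda>k l. a k (b l (c (p - k - l) w))) - ?A (\<lambda>k l. b l (a k (c (p - k - l) w))))
      - (?B (\<lambda>k l. c (p - k - l) (a k (b l w))) - ?B (\<lambda>k l. c (p - k - l) (b l (a k w))))"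
    unfolding rhoj_rhoj[OF assms(1-3)] rhoj_rhoj[OF assms(2,1,3)]
    by (simp add: wsum2_swap[of "cA n" "cA m"] wsum2_swap[of "cA n" "cB m"]
        wsum2_swap[of "cB n" "cA m"] wsum2_swap[of "cB n" "cB m"] sub)
  also have "?A (\<lambda>k l. a k (b l (c (p - k - l) w))) - ?A (\<lambda>k l. b l (a k (c (p - k - l) w)))
      = ?A (\<lambda>k l. a k (b l (c (p - k - l) w)) - b l (a k (c (p - k - l) w)))"
    by (rule wsum2_diff[symmetric]; rule fin2_AA[OF assms(3)]) (simp_all add: z)
  also have "\<dots> = ?A (\<lambda>k l. \<Sum>i<K. sc (of_int (- k) gchoose i) (?L i (k + l)))"
    unfolding rhoj_newton[OF assms(1,2,4)] e_def LL_def by (simp add: algebra_simps)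
  also have "\<dots> = (\<Sum>i<K. sc (of_int m gchoose i) (wsum (\<lambda>s. cA (m + n - int i) (s + int i)) (?L i)))"
  proof -
    have f: "fin2 (cA m) (cA n) (\<lambda>k l. ?L i (k + l))" for i
      using fin2_AA[OF assms(3), of "\<lambda>k l. e i (k + l)" m n p w] lin_0[OF fld_lin[OF fe]]
      by (simp add: LL_def algebra_simps)
    have "?A (\<lambda>k l. \<Sum>i<K. sc (of_int (- k) gchoose i) (?L i (k + l))) =
        (\<Sum>i<K. ?A (\<lambda>k l. sc (of_int (- k) gchoose i) (?L i (k + l))))"
      by (rule wsum2_sum[THEN conjunct1, OF finite_lessThan], rule fin2_mono[OF f]) auto
    also have "\<dots> = (\<Sum>i<K. sc (of_int m gchoose i) (wsum (\<lambda>s. cA (m + n - int i) (s + int i)) (?L i)))"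
      using upz_shift[OF upz_LL[OF fe assms(3)], of _ p w "- int _"]
      by (intro sum.cong refl wsum2_gchoose cA_absorb cA_convolution finite_cA_convolution f fsupp_cA) simp
    finally show ?thesis .
  qed
  also have "?B (\<lambda>k l. c (p - k - l) (a k (b l w))) - ?B (\<lambda>k l. c (p - k - l) (b l (a k w)))
      = ?B (\<lambda>k l. c (p - k - l) (a k (b l w)) - c (p - k - l) (b l (a k w)))"
  proof (rule wsum2_diff[symmetric])
    show "fin2 (cB m) (cB n) (\<lambda>k l. c (p - k - l) (b l (a k w)))"
      by (rule fin2_BB[OF assms(1,2)]) (simp add: z)
    show "fin2 (cB m) (cB n) (\<lambda>k l. c (p - k - l) (a k (b l w)))"
      using fin2_swap[OF fin2_BB[OF assms(2,1), of "\<lambda>k l. c (p - k - l)" n m w]] by (simp add: z sub)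
  qed
  also have "\<dots> = ?B (\<lambda>k l. \<Sum>i<K. sc (of_int (- k) gchoose i) (?R i (k + l)))"
    unfolding lin_diff[OF ln(3), symmetric] rhoj_newton[OF assms(1,2,4)] e_def RR_def
    by (simp add: lin_sum[OF ln(3)] lin_scale[OF ln(3)] algebra_simps)
  also have "\<dots> = (\<Sum>i<K. sc (of_int m gchoose i) (wsum (\<lambda>s. cB (m + n - int i) (s + int i)) (?R i)))"
  proof -
    have f: "fin2 (cB m) (cB n) (\<lambda>k l. ?R i (k + l))" for i
    proof -
      obtain N where N: "\<And>k. k < N \<Longrightarrow> e i k w = 0" using fld_dnzE[OF fe] by blast
      show ?thesis
      proof (rule fin2I[of _ _ _ N 0 N 0])
        fix k l assume *: "cB m k \<noteq> 0" "cB n l \<noteq> 0" "?R i (k + l) \<noteq> 0"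
        have "k \<le> 0" "l \<le> 0" using * by (meson cB_eq_0 not_le_imp_less)+
        moreover have "\<not> k + l < N" using * N z by (metis RR_def)
        ultimately show "N \<le> k \<and> k \<le> 0 \<and> N \<le> l \<and> l \<le> 0" by auto
      qed
    qed
    have "?B (\<lambda>k l. \<Sum>i<K. sc (of_int (- k) gchoose i) (?R i (k + l))) =
        (\<Sum>i<K. ?B (\<lambda>k l. sc (of_int (- k) gchoose i) (?R i (k + l))))"
      by (rule wsum2_sum[THEN conjunct1, OF finite_lessThan], rule fin2_mono[OF f]) auto
    also have "\<dots> = (\<Sum>i<K. sc (of_int m gchoose i) (wsum (\<lambda>s. cB (m + n - int i) (s + int i)) (?R i)))"
      using dnz_shift[OF dnz_RR[OF fe assms(3)], of _ p w "- int _"]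
      by (intro sum.cong refl wsum2_gchoose cB_absorb cB_convolution finite_cB_convolution f fsupp_cB) simp
    finally show ?thesis .
  qed
  finally show ?thesis
    using Lam_shift[of "m + n - int i" "?L i" "- int i" "?R i" for i]
    by (simp add: e_def sum_subtractf scale_right_diff_distrib)
qed

text \<open>Cutting \<open>g\<close> off at \<open>hi1\<close> changes the product only in powers
  \<open>z^j\<close> with \<open>j \<ge> K\<close>, which locality kills; the same holds for
  \<open>h\<close> at \<open>hi2\<close>.\<close>

lemma LAM_mult:
  assumes g: "gpair K L R" and lo: "\<And>j. j < lo1 \<Longrightarrow> g $$ j = 0" "\<And>j. j < lo2 \<Longrightarrow> h $$ j = 0"
    and hi: "int K \<le> hi1 + lo2" "int K \<le> hi2 + lo1"
  shows "LAM (g * h) L R = (\<Sum>x\<in>{lo1..<hi1}. \<Sum>y\<in>{lo2..<hi2}. sc (g $$ x * h $$ y) (Lam (x + y) L R))"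
proof -
  define g' where "g' = (\<Sum>x\<in>{lo1..<hi1}. fls_const (g $$ x) * fls_X_intpow x)"
  have g'_nth: "g' $$ j = (if j \<in> {lo1..<hi1} then g $$ j else 0)" for j
  proof -
    have "g' $$ j = (\<Sum>x\<in>{lo1..<hi1}. if x = j then g $$ x else 0)"
      unfolding g'_def fls_nth_sum by (rule sum.cong) auto
    then show ?thesis by simp
  qed
  have "LAM ((g - g') * h) L R = 0"
  proof (rule LAM_eq_0[OF g])
    fix j assume "j < int K"
    then show "((g - g') * h) $$ j = 0"
      by (intro fls_times_nth_below[of hi1 _ lo2]) (use lo hi in \<open>auto simp: g'_nth\<close>)
  qed
  then have "LAM (g * h) L R = LAM (g' * h) L R"
    using LAM_diff_left[OF g, of "g * h" "g' * h"] by (simp add: left_diff_distrib)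
  also have "\<dots> = (\<Sum>x\<in>{lo1..<hi1}. sc (g $$ x) (LAM (fls_X_intpow x * h) L R))"
    by (simp add: g'_def sum_distrib_right LAM_sum_left[OF g] LAM_const_mult[OF g] mult.assoc)
  also have "\<dots> = (\<Sum>x\<in>{lo1..<hi1}. \<Sum>y\<in>{lo2..<hi2}. sc (g $$ x * h $$ y) (Lam (x + y) L R))"
  proof (rule sum.cong[OF refl])
    fix x assume x: "x \<in> {lo1..<hi1}"
    have "LAM (fls_X_intpow x * h) L R = wsum (\<lambda>j. h $$ (j - x)) (\<lambda>j. Lam j L R)"
      unfolding LAM_def by (rule wsum_cong) (simp_all add: fls_X_intpow_times_conv_shift)
    also have "\<dots> = wsum (fls_nth h) (\<lambda>j. Lam (j + x) L R)" by (rule wsum_shift[symmetric])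
    also have "\<dots> = (\<Sum>y\<in>{lo2..<hi2}. sc (h $$ y) (Lam (y + x) L R))"
    proof (rule wsum_eq)
      fix y assume "h $$ y \<noteq> 0" "Lam (y + x) L R \<noteq> 0"
      then show "y \<in> {lo2..<hi2}" using lo(2)[of y] Lam_eq_0[OF g, of "y + x"] x hi
        by (cases "y < lo2"; cases "int K \<le> y + x") auto
    qed simp
    finally show "sc (g $$ x) (LAM (fls_X_intpow x * h) L R) = (\<Sum>y\<in>{lo2..<hi2}. sc (g $$ x * h $$ y) (Lam (x + y) L R))"
      by (simp add: scale_sum_right add.commute)
  qed
  finally show ?thesis .
qed

lemma rho_commutator:
  assumes "fld a" "fld b" "fld c" "loc K a b" "loc K a c" "loc K b c"
  shows "rho (tp m) a (rho (tp n) b c) p w - rho (tp n) b (rho (tp m) a c) p w =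
    (\<Sum>i<K. sc (of_int m gchoose i) (rho (tp (m + n - int i)) (rho (tp (int i)) a b) c p w))"
proof -
  define e where "e i = rhoj (int i) a b" for i
  have fe: "fld (e i)" for i unfolding e_def by (rule fld_rhoj[OF assms(1,2)])
  obtain K1 where K1: "loc K1 (rho (tp n) b c) a"
    using loc_rho[OF assms(2,3,1,6) loc_sym[OF assms(4)] loc_sym[OF assms(5)]] by blast
  obtain K2 where K2: "loc K2 (rho (tp m) a c) b"
    using loc_rho[OF assms(1,3,2,5) assms(4) loc_sym[OF assms(6)]] by blast
  define K' where "K' = Max {K, K1, K2, 3 * K}"
  have K': "K \<le> K'" "K1 \<le> K'" "K2 \<le> K'" "3 * K \<le> K'" by (auto simp: K'_def)
  have le: "loc K' (e i) c" for i
    using loc_mono[OF loc_rhoj[OF assms, of "int i"]] K' by (simp add: e_def)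
  have l1: "loc K' a (rho (tp n) b c)" and l2: "loc K' b (rho (tp m) a c)"
    using loc_sym loc_mono K1 K2 K' by blast+
  have la: "loc K' a c" and lb: "loc K' b c" using loc_mono assms K' by blast+
  define lo where "lo = min (min m n) 0"
  \<comment> \<open>Leaves room for the divided derivatives, which lower the index by some
    \<open>i < K\<close>: even then \<open>hi - i + lo \<ge> K'\<close>, as \<open>LAM_mult\<close>
    demands.\<close>
  define hi where "hi = int K' - lo + int K"
  have lohi: "lo \<le> m" "lo \<le> n" "lo \<le> 0" "int K' \<le> hi" by (auto simp: lo_def hi_def)
  let ?I = "{lo..<hi}"
  have f1: "fld (rho (tp n) b c)" and f2: "fld (rho (tp m) a c)"
    using fld_rho assms by blast+
  have "rho (tp m) a (rho (tp n) b c) p w =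
      (\<Sum>x\<in>?I. \<Sum>y\<in>?I. sc (tp m $$ x * tp n $$ y) (rhoj x a (rhoj y b c) p w))"
  proof -
    have "rho (tp m) a (rho (tp n) b c) = lincomb ?I (fls_nth (tp m)) (\<lambda>x. rhoj x a (rho (tp n) b c))"
      by (rule rho_eq_lincomb[OF assms(1) f1 l1]) (use lohi in \<open>auto simp: tp_subdegree\<close>)
    moreover have D: "rho (tp n) b c = lincomb ?I (fls_nth (tp n)) (\<lambda>y. rhoj y b c)"
      by (rule rho_eq_lincomb[OF assms(2,3) lb]) (use lohi in \<open>auto simp: tp_subdegree\<close>)
    moreover have "rhoj x a (rho (tp n) b c) = lincomb ?I (fls_nth (tp n)) (\<lambda>y. rhoj x a (rhoj y b c))" for x
      unfolding D by (rule rhoj_lincomb_right) (auto intro: assms fld_rhoj)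
    ultimately show ?thesis by (simp add: lincomb_def scale_sum_right)
  qed
  moreover have "rho (tp n) b (rho (tp m) a c) p w =
      (\<Sum>x\<in>?I. \<Sum>y\<in>?I. sc (tp m $$ x * tp n $$ y) (rhoj y b (rhoj x a c) p w))"
  proof -
    have "rho (tp n) b (rho (tp m) a c) = lincomb ?I (fls_nth (tp n)) (\<lambda>x. rhoj x b (rho (tp m) a c))"
      by (rule rho_eq_lincomb[OF assms(2) f2 l2]) (use lohi in \<open>auto simp: tp_subdegree\<close>)
    moreover have D: "rho (tp m) a c = lincomb ?I (fls_nth (tp m)) (\<lambda>y. rhoj y a c)"
      by (rule rho_eq_lincomb[OF assms(1,3) la]) (use lohi in \<open>auto simp: tp_subdegree\<close>)
    moreover have "rhoj x b (rho (tp m) a c) = lincomb ?I (fls_nth (tp m)) (\<lambda>y. rhoj x b (rhoj y a c))" for x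
      unfolding D by (rule rhoj_lincomb_right) (auto intro: assms fld_rhoj)
    ultimately have "rho (tp n) b (rho (tp m) a c) p w =
      (\<Sum>y\<in>?I. \<Sum>x\<in>?I. sc (tp n $$ y * tp m $$ x) (rhoj y b (rhoj x a c) p w))"
      by (simp add: lincomb_def scale_sum_right)
    then show ?thesis by (subst (asm) sum.swap) (simp add: mult.commute)
  qed
  ultimately have "rho (tp m) a (rho (tp n) b c) p w - rho (tp n) b (rho (tp m) a c) p w =
      (\<Sum>x\<in>?I. \<Sum>y\<in>?I. sc (tp m $$ x * tp n $$ y) (rhoj x a (rhoj y b c) p w - rhoj y b (rhoj x a c) p w))"
    by (simp add: sum_subtractf scale_right_diff_distrib)
  also have "\<dots> = (\<Sum>x\<in>?I. \<Sum>y\<in>?I. \<Sum>i<K. sc (tp m $$ x * tp n $$ y * (of_int x gchoose i))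
      (Lam (x + y - int i) (\<lambda>s. LL (e i) c p w (s - int i)) (\<lambda>s. RR (e i) c p w (s - int i))))"
    unfolding rhoj_commutator[OF assms(1-4)] e_def by (simp add: scale_sum_right)
  also have "\<dots> = (\<Sum>i<K. \<Sum>x\<in>?I. \<Sum>y\<in>?I. sc (tp m $$ x * tp n $$ y * (of_int x gchoose i))
      (Lam (x + y - int i) (\<lambda>s. LL (e i) c p w (s - int i)) (\<lambda>s. RR (e i) c p w (s - int i))))"
    (is "_ = (\<Sum>i<K. ?S i)")
    by (rule trans[OF sum.cong[OF refl sum.swap] sum.swap])
  also have "\<dots> = (\<Sum>i<K. \<Sum>r<K. sc ((of_int m gchoose r) * tp (int r) $$ int i) (rho (tp (m + n - int r)) (e i) c p w))"
  proof (rule sum.cong[OF refl])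
    fix i assume i: "i \<in> {..<K}"
    define L R where "L = LL (e i) c p w" and "R = RR (e i) c p w"
    have g: "gpair K' L R" unfolding L_def R_def by (rule gpair_loc[OF fe assms(3) le])
    have gs: "gpair K' (\<lambda>s. L (s - int i)) (\<lambda>s. R (s - int i))"
      using gpair_shift[OF g, of "- int i"] by simp
    have "(\<Sum>x\<in>?I. \<Sum>y\<in>?I. sc (tp m $$ x * tp n $$ y * (of_int x gchoose i)) (Lam (x + y - int i) (\<lambda>s. L (s - int i)) (\<lambda>s. R (s - int i)))) =
        (\<Sum>x\<in>{lo - int i..<hi - int i}. \<Sum>y\<in>?I. sc (hasse i (tp m) $$ x * tp n $$ y) (Lam (x + y) (\<lambda>s. L (s - int i)) (\<lambda>s. R (s - int i))))"
      by (rule sum.reindex_bij_witness[of _ "\<lambda>x. x + int i" "\<lambda>x. x - int i"])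
         (auto simp: hasse_nth algebra_simps intro!: sum.cong)
    also have "\<dots> = LAM (hasse i (tp m) * tp n) (\<lambda>s. L (s - int i)) (\<lambda>s. R (s - int i))"
      by (rule LAM_mult[OF gs, symmetric])
         (use i lohi in \<open>auto simp: hasse_nth tp_nth_below hi_def\<close>)
    also have "\<dots> = LAM ((1 + fls_X) ^ i * (hasse i (tp m) * tp n)) L R"
      by (rule LAM_1_plus_X_power_mult[OF g, symmetric])
    \<comment> \<open>The stray factor \<open>(1 + z)^i\<close> is exactly the one that turns the
      divided derivative of \<open>t^m\<close> into a combination of the powers
      \<open>t^(m - r)\<close>.\<close>
    also have "(1 + fls_X) ^ i * (hasse i (tp m) * tp n) =
        (\<Sum>r\<le>i. fls_const ((of_int m gchoose r) * tp (int r) $$ int i) * tp (m + n - int r))"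
    proof -
      have "tp (m + n - int r) = tp (m - int r) * tp n" for r
        using tp_add[of "m - int r" n] by (simp add: algebra_simps)
      then show ?thesis
        by (simp only: mult.assoc[symmetric] hasse_tp sum_distrib_right)
    qed
    also have "LAM \<dots> L R = (\<Sum>r\<le>i. sc ((of_int m gchoose r) * tp (int r) $$ int i) (rho (tp (m + n - int r)) (e i) c p w))"
      unfolding rho_def L_def[symmetric] R_def[symmetric]
      by (simp add: LAM_sum_left[OF g] LAM_const_mult[OF g])
    also have "\<dots> = (\<Sum>r<K. sc ((of_int m gchoose r) * tp (int r) $$ int i) (rho (tp (m + n - int r)) (e i) c p w))"
      by (rule sum.mono_neutral_left) (use i in \<open>auto simp: tp_nth_below\<close>)
    finally show "?S i = (\<Sum>r<K. sc ((of_int m gchoose r) * tp (int r) $$ int i) (rho (tp (m + n - int r)) (e i) c p w))"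
      by (simp add: L_def R_def)
  qed
  \<comment> \<open>With the sums exchanged, the coefficients of \<open>t^r\<close> recombine the
    products \<open>rhoj i a b\<close> into \<open>rho (tp r) a b\<close>.\<close>
  also have "\<dots> = (\<Sum>r<K. sc (of_int m gchoose r) (\<Sum>i<K. sc (tp (int r) $$ int i) (rho (tp (m + n - int r)) (e i) c p w)))"
    by (subst sum.swap) (simp add: scale_sum_right)
  also have "\<dots> = (\<Sum>r<K. sc (of_int m gchoose r) (rho (tp (m + n - int r)) (rho (tp (int r)) a b) c p w))"
  proof (rule sum.cong[OF refl])
    fix r
    have "rho (tp (int r)) a b = lincomb {0..<int K} (fls_nth (tp (int r))) (\<lambda>j. rhoj j a b)"
      by (rule rho_eq_lincomb[OF assms(1,2,4)]) (auto simp: tp_subdegree)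
    also have "\<dots> = lincomb {..<K} (\<lambda>i. tp (int r) $$ int i) e"
      unfolding lincomb_def e_def
      by (intro ext, rule sum.reindex_bij_witness[of _ int nat]) auto
    finally show "sc (of_int m gchoose r) (\<Sum>i<K. sc (tp (int r) $$ int i) (rho (tp (m + n - int r)) (e i) c p w)) =
        sc (of_int m gchoose r) (rho (tp (m + n - int r)) (rho (tp (int r)) a b) c p w)"
      using rho_lincomb_left[of c "{..<K}" e K', OF assms(3) fe le] by (simp add: lincomb_def)
  qed
  finally show ?thesis .
qed

section \<open>The derivation \<open>x d/dx\<close>\<close>

definition theta :: "'w field \<Rightarrow> int \<Rightarrow> 'w \<Rightarrow> 'w" where
  "theta a k w = sc (of_int k) (a k w)"

lemma fld_theta: "fld a \<Longrightarrow> fld (theta a)"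
  unfolding fld_def theta_def
  by (auto simp: lin_def scale_right_distrib mult.commute intro: dnz_lin[OF lin_sc] dnz_combine)

text \<open>In the coefficient of \<open>x^p\<close> split \<open>p = (p - k) + k\<close>: the first
  part differentiates \<open>b\<close>, the second moves to \<open>g\<close> by integration by
  parts.\<close>

lemma theta_rho:
  assumes "fld a" "fld b" "loc K a b"
  shows "theta (rho g a b) p w = rho g a (theta b) p w - rho (eD g) a b p w"
proof -
  let ?L = "LL a b p w" and ?R = "RR a b p w"
  have g: "gpair K ?L ?R" by (rule gpair_loc[OF assms])
  have gp: "gpair (Suc K) (\<lambda>k. sc (of_int p) (?L k)) (\<lambda>k. sc (of_int p) (?R k))"
    using gpair_mono[OF gpair_lin[OF g lin_sc]] by simp
  have "theta (rho g a b) p w + rho (eD g) a b p w =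
      LAM g (\<lambda>k. sc (of_int p) (?L k)) (\<lambda>k. sc (of_int p) (?R k)) +
      LAM g (\<lambda>k. sc (- of_int k) (?L k)) (\<lambda>k. sc (- of_int k) (?R k))"
    by (simp only: theta_def rho_def lin_LAM[OF g lin_sc] LAM_eD[OF g])
  also have "\<dots> = LAM g (\<lambda>k. sc (of_int p) (?L k) + sc (- of_int k) (?L k)) (\<lambda>k. sc (of_int p) (?R k) + sc (- of_int k) (?R k))"
    by (rule LAM_add[OF gp gpair_mult_index[OF g], symmetric])
  also have "\<dots> = rho g a (theta b) p w"
    unfolding rho_def
  proof (rule arg_cong2[of _ _ _ _ "LAM g"])
    show "(\<lambda>k. sc (of_int p) (?L k) + sc (- of_int k) (?L k)) = LL a (theta b) p w"
      by (auto simp: fun_eq_iff LL_def theta_def lin_scale[OF fld_lin[OF assms(1)]] lin_diff[OF fld_lin[OF assms(1)]] scale_left_diff_distrib)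
    show "(\<lambda>k. sc (of_int p) (?R k) + sc (- of_int k) (?R k)) = RR a (theta b) p w"
      by (auto simp: fun_eq_iff RR_def theta_def scale_left_diff_distrib)
  qed
  finally show ?thesis by (simp add: eq_diff_eq)
qed

lemma loc_theta_left:
  assumes "fld b" "loc K a b"
  shows "loc (Suc K) (theta a) b"
  unfolding loc_def
proof (intro allI)
  fix p w k
  have "(\<lambda>k. LL (theta a) b p w k - RR (theta a) b p w k) =
      (\<lambda>k. sc (-1) (sc (- of_int k) (LL a b p w k - RR a b p w k)))"
    by (auto simp: LL_def RR_def theta_def lin_scale[OF fld_lin[OF assms(1)]] scale_right_diff_distrib)
  then have "(dl ^^ Suc K) (\<lambda>k. LL (theta a) b p w k - RR (theta a) b p w k) k =
      sc (-1) ((dl ^^ Suc K) (\<lambda>k. sc (- of_int k) (LL a b p w k - RR a b p w k)) k)"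
    by (simp only: dl_pow_lin[OF lin_sc])
  also have "\<dots> = 0"
    using dl_pow_mult_index[of K "\<lambda>k. LL a b p w k - RR a b p w k" k] assms(2)
    by (simp add: loc_def del: funpow.simps)
  finally show "(dl ^^ Suc K) (\<lambda>k. LL (theta a) b p w k - RR (theta a) b p w k) k = 0" .
qed

lemma rho_theta_left:
  assumes "fld a" "fld b" "loc K a b"
  shows "rho g (theta a) b p w = - rho (eD g) a b p w"
proof -
  let ?L = "LL a b p w" and ?R = "RR a b p w"
  have g: "gpair K ?L ?R" by (rule gpair_loc[OF assms])
  have "- rho (eD g) a b p w = sc (-1) (LAM g (\<lambda>k. sc (- of_int k) (?L k)) (\<lambda>k. sc (- of_int k) (?R k)))"
    by (simp add: rho_def LAM_eD[OF g])
  also have "\<dots> = LAM g (\<lambda>k. sc (-1) (sc (- of_int k) (?L k))) (\<lambda>k. sc (-1) (sc (- of_int k) (?R k)))"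
    by (rule lin_LAM[OF gpair_mult_index[OF g] lin_sc])
  also have "\<dots> = rho g (theta a) b p w"
    unfolding rho_def
    by (rule arg_cong2[of _ _ _ _ "LAM g"])
       (auto simp: fun_eq_iff LL_def RR_def theta_def lin_scale[OF fld_lin[OF assms(2)]])
  finally show ?thesis by simp
qed

section \<open>The identity field\<close>

definition idf :: "int \<Rightarrow> 'w \<Rightarrow> 'w" where
  "idf k w = (if k = 0 then w else 0)"

lemma fld_idf: "fld idf"
  unfolding fld_def by (auto simp: lin_def idf_def intro!: dnzI[of 0])

lemma LL_idf_left: "LL idf b p w = (\<lambda>k. if k = 0 then b p w else 0)"
  and RR_idf_left: "fld b \<Longrightarrow> RR idf b p w = (\<lambda>k. if k = 0 then b p w else 0)"
  by (auto simp: LL_def RR_def idf_def fun_eq_iff lin_0 fld_lin)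

lemma LL_idf_right: "fld a \<Longrightarrow> LL a idf p w = (\<lambda>k. if k = p then a p w else 0)"
  and RR_idf_right: "RR a idf p w = (\<lambda>k. if k = p then a p w else 0)"
  by (auto simp: LL_def RR_def idf_def fun_eq_iff lin_0 fld_lin)

lemma loc_idf_left: "fld b \<Longrightarrow> loc 0 idf b"
  by (simp add: loc_def LL_idf_left RR_idf_left)

lemma loc_idf_right: "fld b \<Longrightarrow> loc 0 b idf"
  by (simp add: loc_def LL_idf_right RR_idf_right)

lemma LAM_tp_delta:
  "LAM (tp n) (\<lambda>k. if k = q then v else 0) (\<lambda>k. if k = q then v else 0) =
    (if n < 0 then sc (of_int q ^ nat (- n - 1) / fact (nat (- n - 1))) v else 0)"
proof -
  have fin: "finite {k. (if k = q then v else 0) \<noteq> 0}"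
    by (rule finite_subset[of _ "{q}"]) (auto split: if_splits)
  show ?thesis
  proof (cases "n < 0")
    case True
    then have "n = - 1 - int (nat (- n - 1))" by simp
    then have "LAM (tp n) (\<lambda>k. if k = q then v else 0) (\<lambda>k. if k = q then v else 0) =
        Sum_any (\<lambda>k. sc (of_int k ^ nat (- n - 1) / fact (nat (- n - 1))) (if k = q then v else 0))"
      using LAM_tp_diagonal[OF fin, of "nat (- n - 1)"] by simp
    also have "\<dots> = Sum_any (\<lambda>k. if k = q then sc (of_int k ^ nat (- n - 1) / fact (nat (- n - 1))) v else 0)"
      by (rule Sum_any.cong) simp
    finally show ?thesis using True by simp
  next
    case False
    then show ?thesis using LAM_tp_diagonal_nonneg[OF fin, of n] by simp
  qed
qed

lemma rho_idf_left: "fld b \<Longrightarrow> rho (tp n) idf b p w = (if n = -1 then b p w else 0)"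
  by (auto simp: rho_def LL_idf_left RR_idf_left LAM_tp_delta power_0_left)

text \<open>Summed against \<open>t^(-n-1)\<close> this says
  \<open>a(x e^t) = exp (t x d/dx) a(x)\<close>, the creation property for the coordinate
  \<open>x e^t\<close>.\<close>

lemma rho_idf_right:
  "fld a \<Longrightarrow> rho (tp n) a idf p w =
    (if n < 0 then sc (of_int p ^ nat (- n - 1) / fact (nat (- n - 1))) (a p w) else 0)"
  by (simp add: rho_def LL_idf_right RR_idf_right LAM_tp_delta)

end

section \<open>The map from words to fields\<close>

lemma Fin_mono: "Fin (mono p)"
  unfolding Fin_def mono_def by (rule finite_subset[of _ "{p}"]) auto

lemma Fin_add: "Fin u \<Longrightarrow> Fin v \<Longrightarrow> Fin (u + v)"
  unfolding Fin_def by (rule finite_subset[of _ "{w. u w \<noteq> 0} \<union> {w. v w \<noteq> 0}"]) auto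

lemma Fin_diff: "Fin u \<Longrightarrow> Fin v \<Longrightarrow> Fin (u - v)"
  unfolding Fin_def by (rule finite_subset[of _ "{w. u w \<noteq> 0} \<union> {w. v w \<noteq> 0}"]) auto

lemma Fin_smul: "Fin u \<Longrightarrow> Fin (smul c u)"
  unfolding Fin_def smul_def by (erule rev_finite_subset) auto

lemma Fin_0: "Fin 0"
  by (simp add: Fin_def)

lemma Fin_sum_list: "(\<And>x. x \<in> set xs \<Longrightarrow> Fin (f x)) \<Longrightarrow> Fin (\<Sum>x\<leftarrow>xs. f x)"
  by (induction xs) (auto simp: Fin_0 Fin_add)

lemma Fin_sum: "(\<And>x. x \<in> I \<Longrightarrow> Fin (f x)) \<Longrightarrow> Fin (\<Sum>x\<in>I. f x)"
  by (induction I rule: infinite_finite_induct) (auto simp: Fin_0 Fin_add)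

lemma Fin_lmul: "Fin u \<Longrightarrow> Fin (lmul x u)"
proof -
  assume "Fin u"
  then have "finite ((#) x ` {w. u w \<noteq> 0})" by (simp add: Fin_def)
  then show ?thesis unfolding Fin_def
    by (rule rev_finite_subset) (auto simp: lmul_def split: list.split_asm if_split_asm)
qed

lemma lmul_mono: "lmul x (mono p) = mono (x # p)"
  by (auto simp: lmul_def mono_def fun_eq_iff split: list.splits)

lemma lmul_add: "lmul x (u + v) = lmul x u + lmul x v"
  and lmul_diff: "lmul x (u - v) = lmul x u - lmul x v"
  and lmul_smul: "lmul x (smul c u) = smul c (lmul x u)"
  and lmul_0: "lmul x 0 = 0"
  by (auto simp: lmul_def smul_def fun_eq_iff split: list.splits)

lemma lmul_sum_list: "lmul x (\<Sum>y\<leftarrow>ys. f y) = (\<Sum>y\<leftarrow>ys. lmul x (f y))"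
  by (induction ys) (simp_all only: list.map sum_list.Nil sum_list.Cons lmul_0 lmul_add)

section \<open>Locality with unspecified exponent\<close>

context complex_space
begin

definition locl :: "'w field \<Rightarrow> 'w field \<Rightarrow> bool" where
  "locl a b \<longleftrightarrow> (\<exists>K. loc K a b)"

lemma locl_sym: "locl a b \<Longrightarrow> locl b a"
  using loc_sym by (auto simp: locl_def)

lemma locl_rho:
  assumes "fld a" "fld b" "fld c" "locl a b" "locl a c" "locl b c"
  shows "locl (rho g a b) c"
proof -
  from assms(4-6) obtain K1 K2 K3 where "loc K1 a b" "loc K2 a c" "loc K3 b c" by (auto simp: locl_def)
  then have "loc (K1 + K2 + K3) a b" "loc (K1 + K2 + K3) a c" "loc (K1 + K2 + K3) b c"
    by (auto elim: loc_mono)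
  from loc_rho[OF assms(1-3) this] show ?thesis by (simp add: locl_def)
qed

lemma locl_uniform:
  assumes "finite I" "\<And>i. i \<in> I \<Longrightarrow> locl (a i) (b i)"
  shows "\<exists>K. \<forall>i\<in>I. loc K (a i) (b i)"
  using assms
proof (induction I rule: finite_induct)
  case (insert i I)
  then have "locl (a i) (b i)" "\<exists>K. \<forall>i\<in>I. loc K (a i) (b i)" by blast+
  then obtain K K' where "\<forall>i\<in>I. loc K (a i) (b i)" "loc K' (a i) (b i)" by (auto simp: locl_def)
  then have "\<forall>i\<in>insert i I. loc (K + K') (a i) (b i)"
    using loc_mono[of K _ _ "K + K'"] loc_mono[of K' _ _ "K + K'"] by auto
  then show ?case by blast
qed simp

lemma locl_lincomb_left:
  assumes "finite I" "fld c" "\<And>i. i \<in> I \<Longrightarrow> locl (d i) c"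
  shows "locl (lincomb I x d) c"
proof -
  obtain K where "\<forall>i\<in>I. loc K (d i) c" using locl_uniform[of I d "\<lambda>_. c"] assms by blast
  then have "loc K (lincomb I x d) c" by (intro loc_lincomb_left assms(2)) auto
  then show ?thesis by (auto simp: locl_def)
qed

lemma rho_locl_lincomb_left:
  assumes "finite I" "fld c" "\<And>i. i \<in> I \<Longrightarrow> fld (d i)" "\<And>i. i \<in> I \<Longrightarrow> locl (d i) c"
  shows "rho g (lincomb I x d) c = lincomb I x (\<lambda>i. rho g (d i) c)"
proof -
  obtain K where "\<forall>i\<in>I. loc K (d i) c" using locl_uniform[of I d "\<lambda>_. c"] assms by blast
  then show ?thesis by (intro rho_lincomb_left[where K = K] assms(2,3)) auto
qed

lemma rho_locl_lincomb_right:
  assumes "finite I" "fld a" "\<And>i. i \<in> I \<Longrightarrow> fld (d i)" "\<And>i. i \<in> I \<Longrightarrow> locl a (d i)"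
  shows "rho g a (lincomb I x d) = lincomb I x (\<lambda>i. rho g a (d i))"
proof -
  obtain K where "\<forall>i\<in>I. loc K a (d i)" using locl_uniform[of I "\<lambda>_. a" d] assms by blast
  then show ?thesis by (intro rho_lincomb_right[where K = K] assms(2,3)) auto
qed

lemma fld_rho_locl: "fld a \<Longrightarrow> fld b \<Longrightarrow> locl a b \<Longrightarrow> fld (rho g a b)"
  using fld_rho by (auto simp: locl_def)

text \<open>The number of terms is left free beyond a bound, so that this sum can be matched with
  one whose bound comes from the vertex algebra.\<close>

lemma rho_commutator_locl:
  assumes "fld a" "fld b" "fld c" "locl a b" "locl a c" "locl b c"
  shows "\<exists>K. \<forall>M\<ge>K. rho (tp m) a (rho (tp n) b c) p w - rho (tp n) b (rho (tp m) a c) p w =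
    (\<Sum>i<M. sc (of_int m gchoose i) (rho (tp (m + n - int i)) (rho (tp (int i)) a b) c p w))"
proof -
  from assms(4-6) obtain K1 K2 K3 where "loc K1 a b" "loc K2 a c" "loc K3 b c" by (auto simp: locl_def)
  then have "loc M a b \<and> loc M a c \<and> loc M b c" if "M \<ge> K1 + K2 + K3" for M
    using that by (auto elim: loc_mono)
  then show ?thesis by (intro exI[of _ "K1 + K2 + K3"] allI impI rho_commutator assms(1-3)) auto
qed

lemma rho_zero_left: "fld c \<Longrightarrow> rho g (\<lambda>p w. 0) c = (\<lambda>p w. 0)"
  using rho_lincomb_left[of c "{}" _ 0 g] by (simp add: lincomb_def)

lemma rho_zero_right: "fld a \<Longrightarrow> rho g a (\<lambda>p w. 0) = (\<lambda>p w. 0)"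
  using rho_lincomb_right[of a "{}" _ 0 g] by (simp add: lincomb_def)

lemma rho_tp_nat_eq_0:
  assumes "fld a" "fld b" "loc K a b" "K \<le> i"
  shows "rho (tp (int i)) a b = (\<lambda>p w. 0)"
  unfolding rho_def by (intro ext LAM_eq_0[OF gpair_loc[OF assms(1-3)]]) (use assms(4) in \<open>auto simp: tp_nth_below\<close>)

text \<open>With \<open>q = k + l\<close> fixed the bracket is linear in \<open>k\<close>, so
  \<open>(y - 1)^2\<close> kills it: product 0 is its value at \<open>k = 0\<close> and product 1
  its slope in \<open>- k\<close>. The term with \<open>q C q\<close> is \<open>theta C\<close>,
  which on the left of a product lowers the index to \<open>n + s - 1\<close>. The central terms
  with \<open>x\<close> and \<open>y\<close> land in products 0 and 1, hence their different
  conditions \<open>n + s + 1 = 0\<close> and \<open>n + s = 0\<close>.\<close>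

lemma rho_bracket:
  assumes fl: "fld A" "fld B" "fld C" "fld c" and lc: "locl A c" "locl B c" "locl C c"
    and br: "\<And>k l w. A k (B l w) - B l (A k w) =
       sc (of_int (l * m - k * r)) (C (k + l) w) + (if d \<and> k + l = 0 then sc (of_int m * x - of_int k * y) w else 0)"
  shows "locl A B"
    and "rho (tp n) A (rho (tp s) B c) p w - rho (tp s) B (rho (tp n) A c) p w =
      sc (of_int (n * r - m * s)) (rho (tp (n + s - 1)) C c p w) +
      sc ((if d \<and> n + s + 1 = 0 then of_int m * x else 0) + (if d \<and> n + s = 0 then of_int n * y else 0)) (c p w)"
proof -
  define U where "U = lincomb {True, False} (\<lambda>b. if b then of_int m else if d then of_int m * x else 0) (\<lambda>b. if b then theta C else idf)"
  define V where "V = lincomb {True, False} (\<lambda>b. if b then of_int (m + r) else if d then y else 0) (\<lambda>b. if b then C else idf)"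
  have LR: "LL A B q v k - RR A B q v k = U q v + sc (- of_int k) (V q v)" for q v k
  proof -
    have "LL A B q v k - RR A B q v k =
        sc (of_int ((q - k) * m - k * r)) (C q v) + (if d \<and> q = 0 then sc (of_int m * x - of_int k * y) v else 0)"
      using br[of k "q - k" v] by (simp add: LL_def RR_def)
    also have "sc (of_int ((q - k) * m - k * r)) (C q v) = sc (of_int m) (sc (of_int q) (C q v)) + sc (- of_int k) (sc (of_int (m + r)) (C q v))"
      by (simp add: algebra_simps)
    finally show ?thesis
      by (auto simp: U_def V_def lincomb_def theta_def idf_def scale_right_distrib algebra_simps)
  qed
  have dl1: "dl (\<lambda>k. LL A B q v k - RR A B q v k) = (\<lambda>k. V q v)" for q v
    unfolding LR by (auto simp: dl_def fun_eq_iff algebra_simps)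
  have l2: "loc 2 A B"
    unfolding loc_def numeral_2_eq_2 by (simp add: dl1) (simp add: dl_def)
  then show "locl A B" by (auto simp: locl_def)
  have r0: "rhoj 0 A B q v = U q v" for q v
    using Lam_nat[OF upz_LL[OF fl(1,2)] dnz_RR[OF fl(1,2)], of 0 q v] LR[of q v 0] by (simp add: rhoj_def)
  have r1: "rhoj 1 A B q v = V q v" for q v
    using Lam_nat[OF upz_LL[OF fl(1,2)] dnz_RR[OF fl(1,2)], of 1 q v] by (simp add: rhoj_def dl1)
  have I2: "{0..<2} = {0, 1::int}" by auto
  have e0: "rho (tp 0) A B = U"
    using rho_eq_lincomb[OF fl(1,2) l2, of 2 0 "tp 0"]
    by (simp add: lincomb_def I2 r0 fun_eq_iff)
  have e1: "rho (tp 1) A B = V"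
    using rho_eq_lincomb[OF fl(1,2) l2, of 2 0 "tp 1"] tp_nth_lead[of 1]
    by (simp add: tp_subdegree lincomb_def I2 r1 fun_eq_iff tp_nth_below)
  obtain K where K: "\<And>M. M \<ge> K \<Longrightarrow> rho (tp n) A (rho (tp s) B c) p w - rho (tp s) B (rho (tp n) A c) p w =
    (\<Sum>i<M. sc (of_int n gchoose i) (rho (tp (n + s - int i)) (rho (tp (int i)) A B) c p w))"
    using rho_commutator_locl[OF fl(1,2,4) \<open>locl A B\<close> lc(1,2)] by blast
  have "(\<Sum>i<K + 2. sc (of_int n gchoose i) (rho (tp (n + s - int i)) (rho (tp (int i)) A B) c p w)) =
      (\<Sum>i<2. sc (of_int n gchoose i) (rho (tp (n + s - int i)) (rho (tp (int i)) A B) c p w))"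
    by (rule sum.mono_neutral_right)
       (auto simp: rho_tp_nat_eq_0[OF fl(1,2) l2] rho_zero_left[OF fl(4)])
  also have "\<dots> = rho (tp (n + s)) U c p w + sc (of_int n) (rho (tp (n + s - 1)) V c p w)"
    using e0 e1 by (simp add: numeral_2_eq_2)
  also have "rho (tp (n + s)) U c p w = sc (of_int m) (rho (tp (n + s)) (theta C) c p w) +
      sc (if d then of_int m * x else 0) (rho (tp (n + s)) idf c p w)"
  proof -
    have "locl (theta C) c" "locl idf c"
      using lc(3) loc_theta_left[OF fl(4)] loc_idf_left[OF fl(4)] by (auto simp: locl_def)
    then show ?thesis
      unfolding U_def using fld_theta[OF fl(3)] fld_idf fl(4)
      by (subst rho_locl_lincomb_left) (auto simp: lincomb_def)
  qed
  also have "rho (tp (n + s - 1)) V c p w = sc (of_int (m + r)) (rho (tp (n + s - 1)) C c p w) +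
      sc (if d then y else 0) (rho (tp (n + s - 1)) idf c p w)"
  proof -
    have "locl idf c"
      using loc_idf_left[OF fl(4)] by (auto simp: locl_def)
    then show ?thesis
      unfolding V_def using lc(3) fld_idf fl(3,4)
      by (subst rho_locl_lincomb_left) (auto simp: lincomb_def)
  qed
  \<comment> \<open>The two contributions of \<open>C\<close> combine to
    \<open>n (m + r) - m (n + s) = n r - m s\<close>, the structure constant of the affinized
    algebra.\<close>
  also have "rho (tp (n + s)) (theta C) c p w = - sc (of_int (n + s)) (rho (tp (n + s - 1)) C c p w)"
  proof -
    obtain K where K: "loc K C c" using lc(3) by (auto simp: locl_def)
    from rho_theta_left[OF fl(3,4) K] show ?thesis
      by (simp add: eD_tp rho_def LAM_of_int_mult[OF gpair_loc[OF fl(3,4) K]] del: of_int_add)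
  qed
  finally show "rho (tp n) A (rho (tp s) B c) p w - rho (tp s) B (rho (tp n) A c) p w =
      sc (of_int (n * r - m * s)) (rho (tp (n + s - 1)) C c p w) +
      sc ((if d \<and> n + s + 1 = 0 then of_int m * x else 0) + (if d \<and> n + s = 0 then of_int n * y else 0)) (c p w)"
    using K[of "K + 2"] by (auto simp: rho_idf_left[OF fl(4)] algebra_simps)
qed

lemma rho_commute:
  assumes fl: "fld A" "fld B" "fld c" and lc: "locl A c" "locl B c" and "loc 0 A B"
  shows "rho (tp n) A (rho (tp s) B c) p w = rho (tp s) B (rho (tp n) A c) p w"
proof -
  have "locl A B" using assms by (auto simp: locl_def)
  then obtain K where "rho (tp n) A (rho (tp s) B c) p w - rho (tp s) B (rho (tp n) A c) p w =
    (\<Sum>i<K. sc (of_int n gchoose i) (rho (tp (n + s - int i)) (rho (tp (int i)) A B) c p w))"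
    using rho_commutator_locl[OF fl _ lc] by blast
  also have "\<dots> = 0"
    by (simp add: rho_tp_nat_eq_0[OF fl(1,2) assms(6)] rho_zero_left[OF fl(3)])
  finally show ?thesis by simp
qed

end

section \<open>The generating fields of the module\<close>

locale Lstar_module = complex_space sc for sc :: "complex \<Rightarrow> 'w::ab_group_add \<Rightarrow> 'w" +
  fixes l1 l2 l3 l4 :: complex and tact eact :: "int \<Rightarrow> int \<Rightarrow> 'w \<Rightarrow> 'w"
  assumes module: "restricted_Lstar_module sc l1 l2 l3 l4 tact eact"
begin

definition TF :: "int \<Rightarrow> int \<Rightarrow> 'w \<Rightarrow> 'w" where "TF m k w = zact tact m (- k) w"
definition EF :: "int \<Rightarrow> int \<Rightarrow> 'w \<Rightarrow> 'w" where "EF m k w = zact eact m (- k) w"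

lemmas module_TT = module[unfolded restricted_Lstar_module_def, THEN conjunct2, THEN conjunct2, THEN conjunct2, THEN conjunct2, THEN conjunct1, rule_format]
lemmas module_TE = module[unfolded restricted_Lstar_module_def, THEN conjunct2, THEN conjunct2, THEN conjunct2, THEN conjunct2, THEN conjunct2, THEN conjunct1, rule_format]
lemmas module_EE = module[unfolded restricted_Lstar_module_def, THEN conjunct2, THEN conjunct2, THEN conjunct2, THEN conjunct2, THEN conjunct2, THEN conjunct2, THEN conjunct1, rule_format]

lemma restricted: "\<exists>N. \<forall>n\<ge>N. zact tact m n w = 0 \<and> zact eact m n w = 0"
  using module unfolding restricted_Lstar_module_def by blast

lemma zact_0: "zact act 0 0 w = 0"
  by (simp add: zact_def)

lemma lin_zact: "lin (zact tact m n)" "lin (zact eact m n)"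
  using module by (simp_all add: restricted_Lstar_module_def lin_def)

lemma fld_TF: "fld (TF m)" and fld_EF: "fld (EF m)"
proof -
  have "lin (TF m k)" "lin (EF m k)" for k
    using lin_zact by (simp_all add: TF_def[abs_def] EF_def[abs_def] lin_def)
  moreover have "dnz (\<lambda>k. TF m k w)" "dnz (\<lambda>k. EF m k w)" for w
  proof -
    obtain N where N: "\<forall>n\<ge>N. zact tact m n w = 0 \<and> zact eact m n w = 0" using restricted by blast
    show "dnz (\<lambda>k. TF m k w)" "dnz (\<lambda>k. EF m k w)"
      by (rule dnzI[of "- N"]; use N in \<open>simp add: TF_def EF_def\<close>)+
  qed
  ultimately show "fld (TF m)" "fld (EF m)" by (auto simp: fld_def)
qed

lemma TF_TF: "TF m k (TF r l w) = TF r l (TF m k w)"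
proof (cases "(m, - k) = (0, 0) \<or> (r, - l) = (0, 0)")
  case True
  then show ?thesis using lin_0[OF lin_zact(1)] by (auto simp: TF_def zact_0)
next
  case False
  then show ?thesis unfolding TF_def by (intro module_TT) auto
qed

text \<open>The module relations are stated only for indices other than (0, 0). With the omitted
  operators set to 0 they persist, since the structure constants and the central terms vanish
  there.\<close>

lemma TF_EF: "TF m k (EF r l w) - EF r l (TF m k w) =
    sc (of_int (l * m - k * r)) (TF (m + r) (k + l) w) +
    (if m + r = 0 \<and> k + l = 0 then sc (of_int m * l1 - of_int k * l2) w else 0)"
proof (cases "(m, - k) = (0, 0) \<or> (r, - l) = (0, 0)")
  case True
  then show ?thesis using lin_0[OF lin_zact(1)] lin_0[OF lin_zact(2)] by (auto simp: TF_def EF_def zact_0)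
next
  case False
  then have "zact tact m (- k) (zact eact r (- l) w) - zact eact r (- l) (zact tact m (- k) w) =
        sc (of_int (- k * r - m * - l)) (zact tact (m + r) (- k + - l) w) +
        (if m + r = 0 \<and> - k + - l = 0 then sc (of_int m * l1 + of_int (- k) * l2) w else 0)"
    by (intro module_TE) auto
  moreover have "- k + - l = - (k + l)" "(- k + - l = 0) = (k + l = 0)" "- k * r - m * - l = l * m - k * r" by auto
  ultimately show ?thesis by (simp only: TF_def EF_def) simp
qed

lemma EF_EF: "EF m k (EF r l w) - EF r l (EF m k w) =
    sc (of_int (l * m - k * r)) (EF (m + r) (k + l) w) +
    (if m + r = 0 \<and> k + l = 0 then sc (of_int m * l3 - of_int k * l4) w else 0)"
proof (cases "(m, - k) = (0, 0) \<or> (r, - l) = (0, 0)")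
  case True
  then show ?thesis using lin_0[OF lin_zact(2)] by (auto simp: EF_def zact_0)
next
  case False
  then have "zact eact m (- k) (zact eact r (- l) w) - zact eact r (- l) (zact eact m (- k) w) =
        sc (of_int (- k * r - m * - l)) (zact eact (m + r) (- k + - l) w) +
        (if m + r = 0 \<and> - k + - l = 0 then sc (of_int m * l3 + of_int (- k) * l4) w else 0)"
    by (intro module_EE) auto
  moreover have "- k + - l = - (k + l)" "(- k + - l = 0) = (k + l = 0)" "- k * r - m * - l = l * m - k * r" by auto
  ultimately show ?thesis by (simp only: EF_def) simp
qed

inductive gen :: "'w field \<Rightarrow> bool" where
  "gen (TF m)" | "gen (EF m)"

lemma loc_TF_TF: "loc 0 (TF m) (TF r)"
  using TF_TF by (simp add: loc_def LL_def RR_def)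

lemma fld_gen: "gen a \<Longrightarrow> fld a"
  by (auto elim: gen.cases simp: fld_TF fld_EF)

lemma locl_idf_right: "fld a \<Longrightarrow> locl a idf"
  using loc_idf_right by (auto simp: locl_def)

lemma locl_gen: "gen a \<Longrightarrow> gen b \<Longrightarrow> locl a b"
proof -
  have te: "locl (TF m) (EF r)" for m r
    by (rule rho_bracket(1)[OF fld_TF fld_EF fld_TF fld_idf locl_idf_right locl_idf_right locl_idf_right TF_EF])
       (auto simp: fld_TF fld_EF)
  have ee: "locl (EF m) (EF r)" for m r
    by (rule rho_bracket(1)[OF fld_EF fld_EF fld_EF fld_idf locl_idf_right locl_idf_right locl_idf_right EF_EF])
       (auto simp: fld_EF)
  have tt: "locl (TF m) (TF r)" for m r using loc_TF_TF by (auto simp: locl_def)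
  show "gen a \<Longrightarrow> gen b \<Longrightarrow> locl a b"
    using te ee tt locl_sym[OF te] by (auto elim!: gen.cases)
qed

definition scf :: "complex \<Rightarrow> 'w field \<Rightarrow> int \<Rightarrow> 'w \<Rightarrow> 'w" where
  "scf x c = lincomb {()} (\<lambda>_. x) (\<lambda>_. c)"

lemma scf_apply: "scf x c p w = sc x (c p w)"
  by (simp add: scf_def lincomb_def)

text \<open>The intended action of the affinized algebra on fields, with the identity field as
  vacuum vector; that it respects brackets is \<open>opr_bracket\<close>.\<close>

fun opr :: "hb \<Rightarrow> 'w field \<Rightarrow> int \<Rightarrow> 'w \<Rightarrow> 'w" where
  "opr (HT m n) c = rho (tp n) (TF m) c"
| "opr (HE m n) c = rho (tp n) (EF m) c"
| "opr HK1 c = scf l1 c"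
| "opr HK2 c = scf l2 c"
| "opr HK3 c = scf l3 c"
| "opr HK4 c = scf l4 c"

fun fw :: "hb list \<Rightarrow> int \<Rightarrow> 'w \<Rightarrow> 'w" where
  "fw [] = idf"
| "fw (x # q) = opr x (fw q)"

text \<open>The invariant under \<open>opr\<close>: locality against the generators is what the
  products formed by \<open>opr\<close> require, and Dong's lemma preserves it.\<close>

definition good :: "'w field \<Rightarrow> bool" where
  "good c \<longleftrightarrow> fld c \<and> (\<forall>a. gen a \<longrightarrow> locl a c)"

lemma good_idf: "good idf"
  using fld_idf locl_idf_right fld_gen by (auto simp: good_def)

lemma good_lincomb: "finite I \<Longrightarrow> (\<And>i. i \<in> I \<Longrightarrow> good (d i)) \<Longrightarrow> good (lincomb I x d)"
  unfolding good_def by (auto intro!: fld_lincomb locl_sym[OF locl_lincomb_left] simp: fld_gen intro: locl_sym)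

lemma good_scf: "good c \<Longrightarrow> good (scf x c)"
  unfolding scf_def by (rule good_lincomb) auto

lemma good_rho_gen: "gen a \<Longrightarrow> good c \<Longrightarrow> good (rho g a c)"
  unfolding good_def
  by (auto intro!: fld_rho_locl locl_sym[OF locl_rho] simp: fld_gen locl_gen intro: locl_sym)

lemma gen_TF_EF: "gen (TF m)" "gen (EF m)"
  by (auto intro: gen.intros)

lemma good_opr: "good c \<Longrightarrow> good (opr x c)"
  by (cases x) (auto simp: good_rho_gen gen_TF_EF good_scf)

lemma good_fw: "good (fw q)"
  by (induction q) (auto simp: good_idf good_opr)

lemma opr_lincomb:
  assumes "finite I" "\<And>i. i \<in> I \<Longrightarrow> good (d i)"
  shows "opr x (lincomb I u d) = lincomb I u (\<lambda>i. opr x (d i))"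
proof -
  have s: "scf y (lincomb I u d) = lincomb I u (\<lambda>i. scf y (d i))" for y
    by (auto simp: scf_apply lincomb_def fun_eq_iff scale_sum_right mult.commute intro!: sum.cong)
  have "rho g a (lincomb I u d) = lincomb I u (\<lambda>i. rho g a (d i))" if "gen a" for g a
    using assms that by (intro rho_locl_lincomb_right) (auto simp: good_def fld_gen)
  then show ?thesis using s by (cases x) (auto simp: gen_TF_EF)
qed

text \<open>Induction on the left word with the right one fixed. In Dong's lemma, locality to the
  generator comes from \<open>good\<close> and locality of the shorter word from the induction
  hypothesis.\<close>

lemma fw_locl: "locl (fw q) (fw q')"
proof (induction q)
  case Nil
  then show ?case using good_fw[of q'] loc_idf_left by (auto simp: good_def locl_def)
next
  case (Cons x q)
  have g: "fld (fw q)" "fld (fw q')" "gen a \<Longrightarrow> locl a (fw q)" "gen a \<Longrightarrow> locl a (fw q')" for a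
    using good_fw[of q] good_fw[of q'] by (auto simp: good_def)
  have s: "locl (scf y (fw q)) (fw q')" for y
    unfolding scf_def by (rule locl_lincomb_left) (use Cons g in auto)
  have r: "locl (rho h a (fw q)) (fw q')" if "gen a" for h a
    using that g Cons by (intro locl_rho) (auto simp: fld_gen)
  show ?case using s r by (cases x) (auto simp: gen_TF_EF)
qed

section \<open>Linear extension and descent to the vacuum module\<close>

definition Fu :: "tv \<Rightarrow> int \<Rightarrow> 'w \<Rightarrow> 'w" where
  "Fu u = lincomb {q. u q \<noteq> 0} u fw"

lemma Fu_superset: "finite I \<Longrightarrow> {q. u q \<noteq> 0} \<subseteq> I \<Longrightarrow> Fu u = lincomb I u fw"
  unfolding Fu_def lincomb_def by (intro ext sum.mono_neutral_left) auto

lemma Fu_add: "Fin u \<Longrightarrow> Fin v \<Longrightarrow> Fu (u + v) p w = Fu u p w + Fu v p w"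
proof -
  assume *: "Fin u" "Fin v"
  let ?I = "{q. u q \<noteq> 0} \<union> {q. v q \<noteq> 0}"
  have f: "finite ?I" using * by (auto simp: Fin_def)
  show ?thesis
    unfolding Fu_superset[OF f, of u, simplified] Fu_superset[OF f, of v, simplified]
    by (subst Fu_superset[OF f]) (auto simp: lincomb_def scale_left_distrib sum.distrib)
qed

lemma Fu_smul: "Fu (smul c u) p w = sc c (Fu u p w)"
  by (cases "c = 0") (simp_all add: Fu_def lincomb_def smul_def scale_sum_right)

lemma Fu_diff: "Fin u \<Longrightarrow> Fin v \<Longrightarrow> Fu (u - v) p w = Fu u p w - Fu v p w"
proof -
  assume *: "Fin u" "Fin v"
  have "u - v = u + smul (-1) v" by (auto simp: smul_def fun_eq_iff)
  then have "Fu (u - v) p w = Fu (u + smul (-1) v) p w" by (simp only:)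
  also have "\<dots> = Fu u p w - Fu v p w"
    using Fu_add[OF *(1) Fin_smul[OF *(2)]] by (simp add: Fu_smul)
  finally show ?thesis .
qed

lemma Fu_0: "Fu 0 p w = 0"
  by (simp add: Fu_def lincomb_def)

lemma Fu_mono: "Fu (mono q) = fw q"
proof -
  have "Fu (mono q) = lincomb {q} (mono q) fw" by (rule Fu_superset) (auto simp: mono_def)
  then show ?thesis by (simp add: lincomb_def mono_def fun_eq_iff)
qed

lemma Fu_sum_list: "(\<And>x. x \<in> set xs \<Longrightarrow> Fin (f x)) \<Longrightarrow> Fu (\<Sum>x\<leftarrow>xs. f x) p w = (\<Sum>x\<leftarrow>xs. Fu (f x) p w)"
  by (induction xs) (auto simp: Fu_0 Fu_add Fin_sum_list)

lemma Fu_sum: "(\<And>x. x \<in> I \<Longrightarrow> Fin (f x)) \<Longrightarrow> Fu (\<Sum>x\<in>I. f x) p w = (\<Sum>x\<in>I. Fu (f x) p w)"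
  by (induction I rule: infinite_finite_induct) (auto simp: Fu_0 Fu_add Fin_sum)

lemma good_Fu: "Fin u \<Longrightarrow> good (Fu u)"
  unfolding Fu_def by (rule good_lincomb) (auto simp: Fin_def good_fw)

lemma fld_Fu: "Fin u \<Longrightarrow> fld (Fu u)"
  using good_Fu by (simp add: good_def)

lemma Fu_locl: "Fin u \<Longrightarrow> Fin v \<Longrightarrow> locl (Fu u) (Fu v)"
  unfolding Fu_def Fin_def
  by (intro locl_lincomb_left fld_lincomb locl_sym[OF locl_lincomb_left] locl_sym[OF fw_locl])
     (use good_fw in \<open>auto simp: good_def\<close>)

lemma Fu_lmul: "Fin u \<Longrightarrow> Fu (lmul x u) = opr x (Fu u)"
proof -
  assume u: "Fin u"
  let ?I = "{q. u q \<noteq> 0}"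
  have f: "finite ?I" using u by (simp add: Fin_def)
  have "Fu (lmul x u) = lincomb ((#) x ` ?I) (lmul x u) fw"
    by (rule Fu_superset) (use f in \<open>auto simp: lmul_def split: list.split_asm if_split_asm\<close>)
  also have "\<dots> = lincomb ?I u (\<lambda>q. opr x (fw q))"
    unfolding lincomb_def by (intro ext, subst sum.reindex) (auto simp: lmul_def)
  also have "\<dots> = opr x (Fu u)"
    unfolding Fu_def by (rule opr_lincomb[symmetric]) (auto simp: f good_fw)
  finally show ?thesis .
qed

lemma opr_zero: "opr x (\<lambda>p w. 0) = (\<lambda>p w. 0)"
  using opr_lincomb[of "{}"] by (simp add: lincomb_def)

lemma Fu_lmul_eq_0: "Fin u \<Longrightarrow> Fu u = (\<lambda>p w. 0) \<Longrightarrow> Fu (lmul x u) = (\<lambda>p w. 0)"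
  by (simp add: Fu_lmul opr_zero)

text \<open>The reason the map respects the defining relations of the enveloping algebra. The mixed
  case with \<open>E\<close> in front follows from the other one by antisymmetry.\<close>

lemma opr_bracket:
  assumes "good c"
  shows "opr x (opr y c) p w - opr y (opr x c) p w = (\<Sum>(z, t)\<leftarrow>br x y. sc z (opr t c p w))"
proof -
  have fc: "fld c" and lc: "gen a \<Longrightarrow> locl a c" for a using assms by (auto simp: good_def)
  note lg = lc[OF gen_TF_EF(1)] lc[OF gen_TF_EF(2)]
  have sg: "rho g a (scf z c) p w = sc z (rho g a c p w)" if "gen a" for g a z
  proof -
    have "rho g a (scf z c) = scf z (rho g a c)"
      unfolding scf_def by (rule rho_locl_lincomb_right) (use that fc lc in \<open>auto simp: fld_gen\<close>)
    then show ?thesis by (simp add: scf_apply)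
  qed
  note sgs = sg[OF gen_TF_EF(1)] sg[OF gen_TF_EF(2)]
  have TT: "rho (tp n) (TF m) (rho (tp s) (TF r) c) p w = rho (tp s) (TF r) (rho (tp n) (TF m) c) p w" for m n r s
    by (rule rho_commute[OF fld_TF fld_TF fc lg(1) lg(1) loc_TF_TF])
  note TE = rho_bracket(2)[OF fld_TF fld_EF fld_TF fc lg(1) lg(2) lg(1) TF_EF]
  note EE = rho_bracket(2)[OF fld_EF fld_EF fld_EF fc lg(2) lg(2) lg(2) EF_EF]
  have ET: "rho (tp s) (EF r) (rho (tp n) (TF m) c) p w - rho (tp n) (TF m) (rho (tp s) (EF r) c) p w =
      - (rho (tp n) (TF m) (rho (tp s) (EF r) c) p w - rho (tp s) (EF r) (rho (tp n) (TF m) c) p w)" for m n r s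
    by simp
  show ?thesis
  proof (cases x)
    case HT: (HT m n)
    show ?thesis
    proof (cases y)
      case (HT r s) then show ?thesis using \<open>x = HT m n\<close> TT by simp
    next
      case (HE r s) then show ?thesis using HT
        by (simp only: opr.simps TE br.simps) (auto simp: scf_apply scale_left_distrib)
    qed (use HT in \<open>simp_all add: scf_apply sgs\<close>)
  next
    case HE: (HE r s)
    show ?thesis
    proof (cases y)
      case (HT m n) then show ?thesis using HE
        by (simp only: opr.simps ET TE br.simps) (auto simp: scf_apply scale_left_distrib algebra_simps)
    next
      case (HE r' s') then show ?thesis using \<open>x = HE r s\<close>
        by (simp only: opr.simps EE br.simps) (auto simp: scf_apply scale_left_distrib)
    qed (use HE in \<open>simp_all add: scf_apply sgs\<close>)
  qed (cases y; simp add: scf_apply sgs mult.commute)+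
qed

text \<open>A common prefix acts linearly and so preserves 0; what counts is the relation at the
  left end, where it is \<open>opr_bracket\<close> applied to the field of the suffix.\<close>

lemma Fu_Jcomm:
  fixes p q x y
  defines "j \<equiv> mono (p @ [x, y] @ q) - mono (p @ [y, x] @ q) - (\<Sum>(c, z)\<leftarrow>br x y. smul c (mono (p @ [z] @ q)))"
  shows "Fin j \<and> Fu j = (\<lambda>p w. 0)"
  unfolding j_def
proof (induction p)
  case Nil
  have fs: "Fin (\<Sum>(c, z)\<leftarrow>br x y. smul c (mono ([] @ [z] @ q)))"
    by (rule Fin_sum_list) (auto intro: Fin_smul Fin_mono)
  have "Fu (\<Sum>(c, z)\<leftarrow>br x y. smul c (mono ([] @ [z] @ q))) p w = (\<Sum>(c, z)\<leftarrow>br x y. sc c (opr z (fw q) p w))" for p w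
    by (subst Fu_sum_list) (auto intro!: Fin_smul Fin_mono arg_cong[of _ _ sum_list] simp: Fu_smul Fu_mono)
  moreover have "Fu (mono ([] @ [x, y] @ q) - mono ([] @ [y, x] @ q) - (\<Sum>(c, z)\<leftarrow>br x y. smul c (mono ([] @ [z] @ q)))) p w =
      opr x (opr y (fw q)) p w - opr y (opr x (fw q)) p w - Fu (\<Sum>(c, z)\<leftarrow>br x y. smul c (mono ([] @ [z] @ q))) p w" for p w
    unfolding Fu_diff[OF Fin_diff[OF Fin_mono Fin_mono] fs] Fu_diff[OF Fin_mono Fin_mono] Fu_mono by simp
  ultimately have "Fu (mono ([] @ [x, y] @ q) - mono ([] @ [y, x] @ q) - (\<Sum>(c, z)\<leftarrow>br x y. smul c (mono ([] @ [z] @ q)))) = (\<lambda>p w. 0)"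
    using opr_bracket[OF good_fw, of x y q] by (intro ext) (simp only: diff_self)
  then show ?case using fs by (intro conjI Fin_diff Fin_mono)
next
  case (Cons t p)
  have "mono ((t # p) @ [x, y] @ q) - mono ((t # p) @ [y, x] @ q) - (\<Sum>(c, z)\<leftarrow>br x y. smul c (mono ((t # p) @ [z] @ q))) =
     lmul t (mono (p @ [x, y] @ q) - mono (p @ [y, x] @ q) - (\<Sum>(c, z)\<leftarrow>br x y. smul c (mono (p @ [z] @ q))))"
    by (simp only: lmul_diff lmul_mono lmul_sum_list lmul_smul case_prod_unfold append_Cons)
  then show ?case using Cons Fu_lmul_eq_0 Fin_lmul by (simp only:)
qed

lemma Fu_Jpos: "nonneg_mode x \<Longrightarrow> Fu (mono (p @ [x])) = (\<lambda>p w. 0)"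
proof (induction p)
  case Nil
  then show ?case
    by (cases x) (auto simp: Fu_mono rho_idf_right fld_TF fld_EF fun_eq_iff)
next
  case (Cons t p)
  then show ?case using Fu_lmul_eq_0[OF Fin_mono, of "p @ [x]" t] by (simp add: lmul_mono)
qed

lemma Fu_JK:
  assumes "opr x idf = scf l idf"
  shows "Fu (mono (p @ [x]) - smul l (mono p)) = (\<lambda>p w. 0)"
proof (induction p)
  case Nil
  show ?case using fun_cong[OF fun_cong[OF assms]]
    by (intro ext) (simp only: append_Nil Fu_diff[OF Fin_mono Fin_smul[OF Fin_mono]] Fu_mono Fu_smul scf_apply fw.simps diff_self)
next
  case (Cons t p)
  show ?case using Fu_lmul_eq_0[OF Fin_diff[OF Fin_mono Fin_smul[OF Fin_mono]] Cons, of t]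
    by (simp only: lmul_mono lmul_diff lmul_smul append_Cons)
qed

lemma Fu_Jset: "j \<in> Jset l1 l2 l3 l4 \<Longrightarrow> Fin j \<and> Fu j = (\<lambda>p w. 0)"
proof (induction rule: Jset.induct)
  case J0 then show ?case using Fin_0 Fu_0 by (simp add: zero_fun_def)
next
  case (Jadd a b)
  then show ?case using Fin_add[of a b] Fu_add[of a b] by (auto simp: plus_fun_def)
next
  case (Jsmul a c) then show ?case using Fu_smul[of c a] by (auto simp: Fin_smul)
next
  case (Jcomm p x y q) then show ?case by (rule Fu_Jcomm)
next
  case (Jpos x p) then show ?case by (simp add: Fin_mono Fu_Jpos)
qed (intro conjI Fin_diff Fin_mono Fin_smul Fu_JK; simp)+

lemma Fu_veq: "veq l1 l2 l3 l4 u v \<Longrightarrow> Fin u \<Longrightarrow> Fin v \<Longrightarrow> Fu u = Fu v"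
proof (intro ext)
  fix p w assume "veq l1 l2 l3 l4 u v" "Fin u" "Fin v"
  then show "Fu u p w = Fu v p w"
    using Fu_Jset[of "u - v"] Fu_diff[of u v p w] by (simp add: veq_def)
qed

end

section \<open>Compatibility with the vertex algebra structure\<close>

lemma tv_expand: "Fin v \<Longrightarrow> v = (\<Sum>q\<in>{q. v q \<noteq> 0}. smul (v q) (mono q))"
proof
  fix w assume "Fin v"
  have sum_apply: "(\<Sum>q\<in>I. f q) w = (\<Sum>q\<in>I. f q w)" for I :: "hb list set" and f :: "hb list \<Rightarrow> tv"
    by (induction I rule: infinite_finite_induct) auto
  have "(\<Sum>q\<in>{q. v q \<noteq> 0}. smul (v q) (mono q) w) = (\<Sum>q\<in>{q. v q \<noteq> 0}. if q = w then v q else 0)"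
    by (rule sum.cong) (auto simp: smul_def mono_def)
  also have "\<dots> = v w" using \<open>Fin v\<close> by (simp add: Fin_def)
  finally show "v w = (\<Sum>q\<in>{q. v q \<noteq> 0}. smul (v q) (mono q)) w" unfolding sum_apply by (rule sym)
qed

lemma smul_0: "smul 0 u = 0"
  by (auto simp: smul_def)

lemma Fin_induct [consumes 1, case_names add smul_mono]:
  assumes "Fin v" and add: "\<And>u v. Fin u \<Longrightarrow> Fin v \<Longrightarrow> P u \<Longrightarrow> P v \<Longrightarrow> P (u + v)"
    and m: "\<And>c q. P (smul c (mono q))"
  shows "P v"
proof -
  have 0: "P 0" using m[of 0 "[]"] by (simp only: smul_0)
  have "P (\<Sum>q\<in>I. smul (v q) (mono q))" for I
  proof (induction I rule: infinite_finite_induct)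
    case (infinite I) then show ?case using 0 by (simp only: sum.infinite not_False_eq_True)
  next
    case empty then show ?case using 0 by (simp only: sum.empty)
  next
    case (insert q I)
    then have "P (smul (v q) (mono q) + (\<Sum>q\<in>I. smul (v q) (mono q)))"
      by (intro add m Fin_sum Fin_smul Fin_mono)
    then show ?case using insert.hyps by (simp only: sum.insert not_False_eq_True)
  qed
  then show ?thesis using tv_expand[OF assms(1)] by metis
qed

lemma veq_refl: "veq l1 l2 l3 l4 u u"
  unfolding veq_def diff_self by (rule Jset.J0)

lemma veq_sym: "veq l1 l2 l3 l4 u v \<Longrightarrow> veq l1 l2 l3 l4 v u"
proof -
  assume "veq l1 l2 l3 l4 u v"
  then have "smul (-1) (u - v) \<in> Jset l1 l2 l3 l4" unfolding veq_def by (rule Jset.Jsmul)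
  moreover have "smul (-1) (u - v) = v - u" by (auto simp: smul_def)
  ultimately show ?thesis by (simp only: veq_def)
qed

text \<open>The relations for the \<open>K_i\<close> evaluate a central letter only at the right end
  of a word; \<open>Jcomm\<close> with empty bracket moves it there past \<open>q\<close>.\<close>

lemma central_Jset:
  assumes "\<And>p. mono (p @ [x]) - smul l (mono p) \<in> Jset l1 l2 l3 l4" "\<And>y. br x y = []"
  shows "mono (p @ [x] @ q) - smul l (mono (p @ q)) \<in> Jset l1 l2 l3 l4"
proof (induction q arbitrary: p)
  case Nil
  then show ?case using assms(1)[of p] by (simp only: append_Nil2)
next
  case (Cons y q)
  have "mono (p @ [x, y] @ q) - mono (p @ [y, x] @ q) - (\<Sum>(c, z)\<leftarrow>br x y. smul c (mono (p @ [z] @ q))) \<in> Jset l1 l2 l3 l4"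
    by (rule Jset.Jcomm)
  then have "mono (p @ [x, y] @ q) - mono (p @ [y, x] @ q) \<in> Jset l1 l2 l3 l4"
    by (simp only: assms(2) list.map sum_list.Nil diff_0_right)
  from Jset.Jadd[OF this Cons.IH[of "p @ [y]"]]
  show ?case by (simp only: append_assoc append_Cons append_Nil diff_add_cancel add_diff_eq)
qed

lemma central_veq:
  "veq l1 l2 l3 l4 (mono (HK1 # q)) (smul l1 (mono q))" "veq l1 l2 l3 l4 (mono (HK2 # q)) (smul l2 (mono q))"
  "veq l1 l2 l3 l4 (mono (HK3 # q)) (smul l3 (mono q))" "veq l1 l2 l3 l4 (mono (HK4 # q)) (smul l4 (mono q))"
proof -
  have "br HK1 y = []" "br HK2 y = []" "br HK3 y = []" "br HK4 y = []" for y by (cases y; simp)+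
  then have "mono ([] @ [HK1] @ q) - smul l1 (mono ([] @ q)) \<in> Jset l1 l2 l3 l4"
      "mono ([] @ [HK2] @ q) - smul l2 (mono ([] @ q)) \<in> Jset l1 l2 l3 l4"
      "mono ([] @ [HK3] @ q) - smul l3 (mono ([] @ q)) \<in> Jset l1 l2 l3 l4"
      "mono ([] @ [HK4] @ q) - smul l4 (mono ([] @ q)) \<in> Jset l1 l2 l3 l4"
    by (intro central_Jset Jset.intros; simp)+
  then show "veq l1 l2 l3 l4 (mono (HK1 # q)) (smul l1 (mono q))" "veq l1 l2 l3 l4 (mono (HK2 # q)) (smul l2 (mono q))"
    "veq l1 l2 l3 l4 (mono (HK3 # q)) (smul l3 (mono q))" "veq l1 l2 l3 l4 (mono (HK4 # q)) (smul l4 (mono q))"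
    by (simp_all only: veq_def append_Nil append_Cons)
qed

section \<open>The vertex algebra axioms\<close>

locale V_structure =
  fixes l1 l2 l3 l4 :: complex and Yv :: "tv \<Rightarrow> int \<Rightarrow> tv \<Rightarrow> tv"
  assumes V: "is_V_structure l1 l2 l3 l4 Yv"
begin

abbreviation eq :: "tv \<Rightarrow> tv \<Rightarrow> bool" (infix "\<sim>" 50) where "u \<sim> v \<equiv> veq l1 l2 l3 l4 u v"

lemmas V_conj = V[unfolded is_V_structure_def Let_def]
lemmas Fin_Yv = V_conj[THEN conjunct1, rule_format]
lemmas V2 = V_conj[THEN conjunct2]
lemmas Yv_cong = V2[THEN conjunct1, rule_format]
lemmas V3 = V2[THEN conjunct2]
lemmas Yv_add_left = V3[THEN conjunct1, rule_format]
lemmas V4 = V3[THEN conjunct2]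
lemmas Yv_add_right = V4[THEN conjunct1, rule_format]
lemmas V5 = V4[THEN conjunct2]
lemmas Yv_smul_left = V5[THEN conjunct1, rule_format]
lemmas V6 = V5[THEN conjunct2]
lemmas Yv_smul_right = V6[THEN conjunct1, rule_format]
lemmas V7 = V6[THEN conjunct2]
lemmas Yv_truncation = V7[THEN conjunct1, rule_format]
lemmas V8 = V7[THEN conjunct2]
lemmas Yv_vac = V8[THEN conjunct1, rule_format]
lemmas V9 = V8[THEN conjunct2]
lemmas Yv_creation_nonneg = V9[THEN conjunct1, rule_format]
lemmas V10 = V9[THEN conjunct2]
lemmas Yv_creation = V10[THEN conjunct1, rule_format]
lemmas V11 = V10[THEN conjunct2]
lemmas Yv_jacobi = V11[THEN conjunct1, rule_format]
lemmas V12 = V11[THEN conjunct2]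
lemmas Yv_HT = V12[THEN conjunct1, rule_format]
lemmas Yv_HE = V12[THEN conjunct2, rule_format]

lemma Fin_vac: "Fin vac"
  by (simp add: vac_def Fin_mono)

lemma mono_HT_veq: "mono (HT m n # q) \<sim> Yv (mono [HT m (-1)]) n (mono q)"
  using veq_sym[OF Yv_HT[OF Fin_mono]] unfolding lmul_mono .

lemma mono_HE_veq: "mono (HE m n # q) \<sim> Yv (mono [HE m (-1)]) n (mono q)"
  using veq_sym[OF Yv_HE[OF Fin_mono]] unfolding lmul_mono .

end

section \<open>Images of the axioms under the field map\<close>

locale Lstar_V_module = Lstar_module sc l1 l2 l3 l4 tact eact + V_structure l1 l2 l3 l4 Yv
  for sc :: "complex \<Rightarrow> 'w::ab_group_add \<Rightarrow> 'w" and l1 l2 l3 l4 tact eact Yv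
begin

lemma Fu_vac: "Fu vac = idf"
  by (simp add: vac_def Fu_mono)

lemma FY_cong: "Fin u \<Longrightarrow> Fin u' \<Longrightarrow> Fin v \<Longrightarrow> Fin v' \<Longrightarrow> u \<sim> u' \<Longrightarrow> v \<sim> v' \<Longrightarrow> Fu (Yv u n v) = Fu (Yv u' n v')"
  by (intro Fu_veq Yv_cong Fin_Yv)

lemma FY_add_left: "Fin u \<Longrightarrow> Fin u' \<Longrightarrow> Fin v \<Longrightarrow> Fu (Yv (u + u') n v) p w = Fu (Yv u n v) p w + Fu (Yv u' n v) p w"
  using Fu_veq[OF Yv_add_left] Fu_add by (metis Fin_Yv Fin_add)

lemma FY_add_right: "Fin u \<Longrightarrow> Fin v \<Longrightarrow> Fin v' \<Longrightarrow> Fu (Yv u n (v + v')) p w = Fu (Yv u n v) p w + Fu (Yv u n v') p w"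
  using Fu_veq[OF Yv_add_right] Fu_add by (metis Fin_Yv Fin_add)

lemma FY_smul_left: "Fin u \<Longrightarrow> Fin v \<Longrightarrow> Fu (Yv (smul c u) n v) p w = sc c (Fu (Yv u n v) p w)"
  using Fu_veq[OF Yv_smul_left] Fu_smul by (metis Fin_Yv Fin_smul)

lemma FY_smul_right: "Fin u \<Longrightarrow> Fin v \<Longrightarrow> Fu (Yv u n (smul c v)) p w = sc c (Fu (Yv u n v) p w)"
  using Fu_veq[OF Yv_smul_right] Fu_smul by (metis Fin_Yv Fin_smul)

lemma FY_zero_right: "Fin u \<Longrightarrow> Fin v \<Longrightarrow> v \<sim> 0 \<Longrightarrow> Fu (Yv u n v) p w = 0"
proof -
  assume *: "Fin u" "Fin v" "v \<sim> 0"
  have "Fu (Yv u n v) = Fu (Yv u n (smul 0 v))"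
    unfolding smul_0 by (rule FY_cong) (use * veq_refl Fin_0 in auto)
  then show ?thesis using FY_smul_right[OF *(1,2), of n 0] by simp
qed

text \<open>The Jacobi identity holds modulo \<open>Jset\<close>; applying \<open>Fu\<close> makes
  it an equation between operators, with one bound for all coefficients and vectors.\<close>

lemma FY_jacobi:
  assumes "Fin u" "Fin v" "Fin x"
  shows "\<exists>M. \<forall>M'\<ge>M. \<forall>P w.
    (\<Sum>i<M'. sc (of_int p gchoose i) (Fu (Yv (Yv u (r + int i) v) (p + q - int i) x) P w)) =
    (\<Sum>i<M'. sc ((-1) ^ i * (of_int r gchoose i))
       (Fu (Yv u (p + r - int i) (Yv v (q + int i) x)) P w
        - sc ((-1) powi r) (Fu (Yv v (q + r - int i) (Yv u (p + int i) x)) P w)))"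
proof -
  let ?S = "\<lambda>M'. \<Sum>i<M'. smul (of_int p gchoose i) (Yv (Yv u (r + int i) v) (p + q - int i) x)"
  let ?T = "\<lambda>M'. \<Sum>i<M'. smul ((-1) ^ i * (of_int r gchoose i)) (Yv u (p + r - int i) (Yv v (q + int i) x)
        - smul ((-1) powi r) (Yv v (q + r - int i) (Yv u (p + int i) x)))"
  obtain M where M: "\<forall>M'\<ge>M. ?S M' \<sim> ?T M'"
    using Yv_jacobi[OF assms, of p r q] by (rule exE)
  have F: "Fin (Yv (Yv u a v) b x)" "Fin (Yv u a (Yv v b x))" "Fin (Yv v a (Yv u b x))" for a b
    by (intro Fin_Yv assms)+
  have "Fu (?S M') P w = Fu (?T M') P w" if "M' \<ge> M" for M' P w
    by (rule fun_cong[OF fun_cong[OF Fu_veq[OF M[rule_format, OF that]]]]) (intro Fin_sum Fin_smul Fin_diff F)+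
  then show ?thesis
    unfolding Fu_sum[OF Fin_smul[OF F(1)]] Fu_sum[OF Fin_smul[OF Fin_diff[OF F(2) Fin_smul[OF F(3)]]]] Fu_smul
      Fu_diff[OF F(2) Fin_smul[OF F(3)]] by blast
qed

lemma sum_gchoose_0:
  assumes "M > 0"
  shows "(\<Sum>i<M. sc (x i * (of_int 0 gchoose i)) (f i)) = sc (x 0) (f 0)"
proof -
  have "(\<Sum>i<M. sc (x i * (of_int 0 gchoose i)) (f i)) = (\<Sum>i\<in>{0}. sc (x i * (of_int 0 gchoose i)) (f i))"
    by (rule sum.mono_neutral_right) (use assms in \<open>auto simp: gbinomial_0_left\<close>)
  then show ?thesis by simp
qed

text \<open>The Jacobi identity at \<open>p = 0\<close>, where the left side collapses to its first
  term.\<close>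

lemma FY_iterate:
  assumes "Fin u" "Fin v" "Fin x"
  shows "\<exists>M. \<forall>M'\<ge>M. \<forall>P w. Fu (Yv (Yv u r v) q x) P w =
    (\<Sum>i<M'. sc ((-1) ^ i * (of_int r gchoose i))
       (Fu (Yv u (r - int i) (Yv v (q + int i) x)) P w
        - sc ((-1) powi r) (Fu (Yv v (q + r - int i) (Yv u (int i) x)) P w)))"
proof -
  obtain M where M: "\<forall>M'\<ge>M. \<forall>P w.
    (\<Sum>i<M'. sc (of_int 0 gchoose i) (Fu (Yv (Yv u (r + int i) v) (0 + q - int i) x) P w)) =
    (\<Sum>i<M'. sc ((-1) ^ i * (of_int r gchoose i))
       (Fu (Yv u (0 + r - int i) (Yv v (q + int i) x)) P w
        - sc ((-1) powi r) (Fu (Yv v (q + r - int i) (Yv u (0 + int i) x)) P w)))"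
    using FY_jacobi[OF assms, of 0 r q] by blast
  show ?thesis
  proof (intro exI[of _ "Suc M"] allI impI)
    fix M' P w assume "M' \<ge> Suc M"
    then show "Fu (Yv (Yv u r v) q x) P w =
      (\<Sum>i<M'. sc ((-1) ^ i * (of_int r gchoose i))
       (Fu (Yv u (r - int i) (Yv v (q + int i) x)) P w
        - sc ((-1) powi r) (Fu (Yv v (q + r - int i) (Yv u (int i) x)) P w)))"
      using M[rule_format, of M' P w]
        sum_gchoose_0[of M' "\<lambda>_. 1" "\<lambda>i. Fu (Yv (Yv u (r + int i) v) (q - int i) x) P w"] by simp
  qed
qed

text \<open>The Jacobi identity at \<open>r = 0\<close>, where the right side collapses to its first
  term.\<close>

lemma FY_commutator:
  assumes "Fin u" "Fin v" "Fin x"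
  shows "\<exists>M. \<forall>M'\<ge>M. \<forall>P w.
    (\<Sum>i<M'. sc (of_int p gchoose i) (Fu (Yv (Yv u (int i) v) (p + q - int i) x) P w)) =
       Fu (Yv u p (Yv v q x)) P w - Fu (Yv v q (Yv u p x)) P w"
proof -
  obtain M where "\<forall>M'\<ge>M. \<forall>P w.
    (\<Sum>i<M'. sc (of_int p gchoose i) (Fu (Yv (Yv u (0 + int i) v) (p + q - int i) x) P w)) =
    (\<Sum>i<M'. sc ((-1) ^ i * (of_int 0 gchoose i))
       (Fu (Yv u (p + 0 - int i) (Yv v (q + int i) x)) P w
        - sc ((-1) powi 0) (Fu (Yv v (q + 0 - int i) (Yv u (p + int i) x)) P w)))"
    using FY_jacobi[OF assms, of p 0 q] by blast
  then show ?thesis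
    using sum_gchoose_0[where x = "\<lambda>i. (-1) ^ i"] by (intro exI[of _ "Suc M"]) simp
qed

text \<open>Couples a generating vector with its field for both families at once, so that inductions
  on words have a single case for generators.\<close>

definition vgen :: "tv \<Rightarrow> 'w field \<Rightarrow> bool" where
  "vgen a A \<longleftrightarrow> Fin a \<and> gen A \<and> (\<forall>k x. Fin x \<longrightarrow> Fu (Yv a k x) = rho (tp k) A (Fu x))"

lemma vgen_HT: "vgen (mono [HT m (-1)]) (TF m)"
  unfolding vgen_def
  using Fu_veq[OF Yv_HT] by (auto simp: Fin_mono gen_TF_EF Fin_Yv Fin_lmul Fu_lmul)

lemma vgen_HE: "vgen (mono [HE m (-1)]) (EF m)"
  unfolding vgen_def
  using Fu_veq[OF Yv_HE] by (auto simp: Fin_mono gen_TF_EF Fin_Yv Fin_lmul Fu_lmul)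

text \<open>Modulo \<open>Jset\<close>, a letter in front of a word is either a scalar or a mode of
  a generator, so inductions can work with the abstract product \<open>Yv\<close>.\<close>

lemma word_induct [case_names Nil central gen]:
  assumes "P vac"
    and "\<And>c x q. P (mono q) \<Longrightarrow> mono (x # q) \<sim> smul c (mono q) \<Longrightarrow> P (mono (x # q))"
    and "\<And>a A n x q. vgen a A \<Longrightarrow> P (mono q) \<Longrightarrow> mono (x # q) \<sim> Yv a n (mono q) \<Longrightarrow> P (mono (x # q))"
  shows "P (mono q)"
proof (induction q)
  case Nil then show ?case using assms(1) by (simp only: vac_def)
next
  case (Cons x q)
  show ?case
  proof (cases x)
    case (HT m n) then show ?thesis using assms(3)[OF vgen_HT Cons] mono_HT_veq by blast
  next
    case (HE m n) then show ?thesis using assms(3)[OF vgen_HE Cons] mono_HE_veq by blast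
  next
    case HK1 then show ?thesis using assms(2)[OF Cons] central_veq(1) by blast
  next
    case HK2 then show ?thesis using assms(2)[OF Cons] central_veq(2) by blast
  next
    case HK3 then show ?thesis using assms(2)[OF Cons] central_veq(3) by blast
  next
    case HK4 then show ?thesis using assms(2)[OF Cons] central_veq(4) by blast
  qed
qed

text \<open>\<open>v_(-2) 1\<close> is the translate of \<open>v\<close>. The iterate formula gives
  \<open>(a_n v)_(-2) 1 = a_n (v_(-2) 1) - n a_(n-1) v\<close>, the same rule that
  \<open>theta_rho\<close> yields for \<open>g = t^n\<close>, so the claim passes from
  \<open>v\<close> to \<open>a_n v\<close>.\<close>

lemma Fu_translation_mono: "Fu (Yv (mono q) (-2) vac) = theta (Fu (mono q))"
proof (induction q rule: word_induct)
  case Nil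
  have "Fu (Yv vac (-2) vac) = Fu (if (-2::int) = -1 then vac else 0)"
    by (rule Fu_veq[OF Yv_vac]) (auto simp: Fin_vac Fin_Yv Fin_0)
  moreover have "theta (Fu vac) = (\<lambda>p w. 0)"
    by (simp add: Fu_vac theta_def idf_def fun_eq_iff)
  ultimately show ?case by (simp add: Fu_0 fun_eq_iff)
next
  case (central c x q)
  have "Fu (Yv (mono (x # q)) (-2) vac) = Fu (Yv (smul c (mono q)) (-2) vac)"
    by (rule FY_cong) (intro Fin_mono Fin_smul Fin_vac central.hyps veq_refl)+
  moreover have "Fu (mono (x # q)) = Fu (smul c (mono q))"
    by (rule Fu_veq) (intro Fin_mono Fin_smul central.hyps)+
  ultimately show ?case using central.IH
    by (intro ext) (simp add: FY_smul_left Fin_mono Fin_vac Fu_smul theta_def mult.commute)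
next
  case (gen a A n x q)
  have a: "Fin a" "fld A" "\<And>k x. Fin x \<Longrightarrow> Fu (Yv a k x) = rho (tp k) A (Fu x)"
    using gen(1) fld_gen by (auto simp: vgen_def)
  define c where "c = Fu (mono q)"
  have c: "good c" "fld c" unfolding c_def using good_Fu[OF Fin_mono] by (auto simp: good_def)
  obtain K where K: "loc K A c" using c gen(1) by (auto simp: good_def vgen_def locl_def)
  have e1: "Fu (Yv (mono (x # q)) (-2) vac) = Fu (Yv (Yv a n (mono q)) (-2) vac)"
    by (rule FY_cong) (intro Fin_mono Fin_Yv Fin_vac gen a veq_refl)+
  have e2: "Fu (mono (x # q)) = rho (tp n) A c"
    unfolding c_def a(3)[OF Fin_mono, symmetric] by (rule Fu_veq) (intro Fin_mono Fin_Yv gen a)+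
  obtain M where M: "\<And>M' P w. M' \<ge> M \<Longrightarrow> Fu (Yv (Yv a n (mono q)) (-2) vac) P w =
    (\<Sum>i<M'. sc ((-1) ^ i * (of_int n gchoose i))
       (Fu (Yv a (n - int i) (Yv (mono q) (-2 + int i) vac)) P w
        - sc ((-1) powi n) (Fu (Yv (mono q) (-2 + n - int i) (Yv a (int i) vac)) P w)))"
    using FY_iterate[OF a(1) Fin_mono Fin_vac] by blast
  have z: "Fu (Yv (mono q) k (Yv a (int i) vac)) P w = 0" for k i P w
    by (rule FY_zero_right) (intro Fin_mono Fin_Yv Fin_vac a Yv_creation_nonneg of_nat_0_le_iff)+
  have pos: "Fu (Yv (mono q) (-2 + int i) vac) = (\<lambda>p w. 0)" if "i \<ge> 2" for i
  proof -
    have "Fu (Yv (mono q) (-2 + int i) vac) = Fu 0"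
      by (rule Fu_veq[OF Yv_creation_nonneg]) (use that in \<open>auto simp: Fin_mono Fin_vac Fin_Yv Fin_0\<close>)
    then show ?thesis by (simp add: Fu_0 fun_eq_iff)
  qed
  have m1: "Fu (Yv (mono q) (-1) vac) = c"
    unfolding c_def by (rule Fu_veq[OF Yv_creation]) (intro Fin_mono Fin_vac Fin_Yv)+
  show ?case
  proof (intro ext)
    fix P w
    have "Fu (Yv (mono (x # q)) (-2) vac) P w =
        (\<Sum>i<M + 2. sc ((-1) ^ i * (of_int n gchoose i)) (rho (tp (n - int i)) A (Fu (Yv (mono q) (-2 + int i) vac)) P w))"
      unfolding e1 by (subst M[of "M + 2"]) (simp_all add: z a(3) Fin_Yv Fin_mono Fin_vac)
    \<comment> \<open>The vectors \<open>v_(-2+i) 1\<close> vanish for \<open>i \<ge> 2\<close>; for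
      \<open>i = 0\<close> the vector is the translate of \<open>v\<close>, for \<open>i = 1\<close>
      it is \<open>v\<close> itself.\<close>
    also have "\<dots> = (\<Sum>i<2. sc ((-1) ^ i * (of_int n gchoose i)) (rho (tp (n - int i)) A (Fu (Yv (mono q) (-2 + int i) vac)) P w))"
    proof (rule sum.mono_neutral_right)
      show "\<forall>i\<in>{..<M + 2} - {..<2}. sc ((-1) ^ i * (of_int n gchoose i)) (rho (tp (n - int i)) A (Fu (Yv (mono q) (-2 + int i) vac)) P w) = 0"
        by (intro ballI, subst pos) (auto simp: rho_zero_right[OF a(2)])
    qed auto
    also have "\<dots> = rho (tp n) A (theta c) P w - sc (of_int n) (rho (tp (n - 1)) A c P w)"
      using gen.IH m1 by (simp add: numeral_2_eq_2 c_def)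
    also have "\<dots> = theta (rho (tp n) A c) P w"
      unfolding theta_rho[OF a(2) c(2) K] eD_tp
      by (simp add: rho_def LAM_of_int_mult[OF gpair_loc[OF a(2) c(2) K]])
    finally show "Fu (Yv (mono (x # q)) (-2) vac) P w = theta (Fu (mono (x # q))) P w"
      by (simp add: e2)
  qed
qed

lemma Fu_translation: "Fin u \<Longrightarrow> Fu (Yv u (-2) vac) = theta (Fu u)"
proof (induction u rule: Fin_induct)
  case (add u v)
  then show ?case
    by (intro ext) (simp only: theta_def FY_add_left[OF add(1,2) Fin_vac] Fu_add[OF add(1,2)] scale_right_distrib)
next
  case (smul_mono c q)
  show ?case
    by (intro ext) (simp add: FY_smul_left[OF Fin_mono Fin_vac] Fu_smul Fu_translation_mono theta_def mult.commute)
qed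

text \<open>The axioms give \<open>(u_n 1)_(-2) 1 = - n u_(n-1) 1\<close>, so the creation modes are
  iterated translates divided by factorials, and each translation contributes a factor
  \<open>P\<close> to the coefficient of \<open>x^P\<close>.\<close>

lemma Fu_creation_neg: "Fin u \<Longrightarrow> Fu (Yv u (- 1 - int N) vac) P w = sc (of_int P ^ N / fact N) (Fu u P w)"
proof (induction N)
  case 0
  have "Fu (Yv u (-1) vac) = Fu u"
    by (rule Fu_veq[OF Yv_creation]) (use 0 in \<open>auto simp: Fin_vac Fin_Yv\<close>)
  then show ?case by simp
next
  case (Suc N)
  define n where "n = - 1 - int N"
  have n: "- 1 - int (Suc N) = n - 1" by (simp add: n_def)
  have n0: "of_int n \<noteq> (0::complex)" by (simp add: n_def del: of_int_diff)
  have F: "Fin (Yv u k vac)" for k using Suc.prems Fin_vac by (rule Fin_Yv)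
  obtain M where M: "\<And>M'. M' \<ge> M \<Longrightarrow> Fu (Yv (Yv u n vac) (-2) vac) P w =
    (\<Sum>i<M'. sc ((-1) ^ i * (of_int n gchoose i))
       (Fu (Yv u (n - int i) (Yv vac (-2 + int i) vac)) P w
        - sc ((-1) powi n) (Fu (Yv vac (-2 + n - int i) (Yv u (int i) vac)) P w)))"
    using FY_iterate[OF Suc.prems Fin_vac Fin_vac] by blast
  have z: "Fu (Yv vac k (Yv u (int i) vac)) P w = 0" for k i
    by (rule FY_zero_right) (use Suc.prems in \<open>auto intro: Fin_vac F Yv_creation_nonneg\<close>)
  have v0: "Fu (Yv u k (Yv vac (-2 + int i) vac)) P w = 0" if "i \<noteq> 1" for i k
  proof (rule FY_zero_right[OF Suc.prems])
    show "Fin (Yv vac (-2 + int i) vac)" by (intro Fin_Yv Fin_vac)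
    show "Yv vac (-2 + int i) vac \<sim> 0" using Yv_vac[OF Fin_vac, of "-2 + int i"] that by auto
  qed
  have v1: "Fu (Yv u k (Yv vac (-1) vac)) P w = Fu (Yv u k vac) P w" for k
  proof -
    have "Yv vac (-1) vac \<sim> vac" using Yv_vac[OF Fin_vac, of "-1"] by simp
    then have "Fu (Yv u k (Yv vac (-1) vac)) = Fu (Yv u k vac)"
      by (intro FY_cong Suc.prems Fin_Yv Fin_vac veq_refl)
    then show ?thesis by simp
  qed
  have "Fu (Yv (Yv u n vac) (-2) vac) P w =
      (\<Sum>i<M + 2. sc ((-1) ^ i * (of_int n gchoose i)) (Fu (Yv u (n - int i) (Yv vac (-2 + int i) vac)) P w))"
    by (subst M[of "M + 2"]) (simp_all add: z)
  also have "\<dots> = (\<Sum>i\<in>{1}. sc ((-1) ^ i * (of_int n gchoose i)) (Fu (Yv u (n - int i) (Yv vac (-2 + int i) vac)) P w))"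
  proof (rule sum.mono_neutral_right)
    show "\<forall>i\<in>{..<M + 2} - {1}. sc ((-1) ^ i * (of_int n gchoose i)) (Fu (Yv u (n - int i) (Yv vac (-2 + int i) vac)) P w) = 0"
      using v0 by (metis DiffD2 scale_zero_right singletonI)
  qed auto
  also have "\<dots> = - sc (of_int n) (Fu (Yv u (n - 1) vac) P w)" by (simp add: v1)
  finally have "sc (of_int n) (Fu (Yv u (n - 1) vac) P w) = - theta (Fu (Yv u n vac)) P w"
    using Fu_translation[OF F] by simp
  also have "\<dots> = sc (- of_int P) (sc (of_int P ^ N / fact N) (Fu u P w))"
    using Suc by (simp add: theta_def n_def)
  also have "\<dots> = sc (of_int n) (sc (of_int P ^ Suc N / fact (Suc N)) (Fu u P w))"
  proof -
    have "fact (Suc N) = - of_int n * (fact N :: complex)" by (simp add: n_def)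
    then have "- of_int P * (of_int P ^ N / fact N) = of_int n * (of_int P ^ Suc N / fact (Suc N) :: complex)"
      using n0 by (simp add: field_simps del: fact_Suc)
    then show ?thesis by (simp only: scale_scale)
  qed
  finally have "Fu (Yv u (n - 1) vac) P w = sc (of_int P ^ Suc N / fact (Suc N)) (Fu u P w)"
    using n0 scale_left_imp_eq by blast
  then show ?case by (simp only: n)
qed

lemma Fu_creation: "Fin u \<Longrightarrow> Fu (Yv u n vac) = rho (tp n) (Fu u) idf"
proof (intro ext)
  fix P w assume u: "Fin u"
  show "Fu (Yv u n vac) P w = rho (tp n) (Fu u) idf P w"
  proof (cases "n < 0")
    case True
    then show ?thesis
      using Fu_creation_neg[OF u, of "nat (- n - 1)" P w] by (simp add: rho_idf_right[OF fld_Fu[OF u]])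
  next
    case False
    then have "Fu (Yv u n vac) = Fu 0"
      by (intro Fu_veq[OF Yv_creation_nonneg]) (use u in \<open>auto simp: Fin_vac Fin_Yv Fin_0\<close>)
    then show ?thesis using False by (simp add: Fu_0 rho_idf_right[OF fld_Fu[OF u]])
  qed
qed

text \<open>Solving the commutator formula for \<open>u_n (a_m v)\<close> leaves
  \<open>a_m (u_n v)\<close> and products \<open>(a_i u)_k v\<close>, all with the shorter word
  \<open>v\<close>. The left factor changes to \<open>a_i u\<close>, hence the quantification over
  \<open>u\<close> inside the induction.\<close>

lemma Fu_Yv_mono: "\<forall>u n. Fin u \<longrightarrow> Fu (Yv u n (mono q)) = rho (tp n) (Fu u) (Fu (mono q))"
proof (induction q rule: word_induct)
  case Nil
  then show ?case by (simp add: Fu_vac Fu_creation)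
next
  case (central c x q)
  show ?case
  proof (intro allI impI)
    fix u n assume u: "Fin u"
    have "Fu (Yv u n (mono (x # q))) = Fu (Yv u n (smul c (mono q)))"
      by (rule FY_cong) (intro u Fin_mono Fin_smul central.hyps veq_refl)+
    also have "\<dots> = scf c (rho (tp n) (Fu u) (Fu (mono q)))"
      using central.IH u by (intro ext) (simp add: FY_smul_right Fin_mono scf_apply)
    also have "\<dots> = rho (tp n) (Fu u) (scf c (Fu (mono q)))"
      unfolding scf_def by (rule rho_locl_lincomb_right[symmetric]) (auto intro: fld_Fu u Fin_mono Fu_locl)
    also have "scf c (Fu (mono q)) = Fu (smul c (mono q))"
      by (intro ext) (simp add: scf_apply Fu_smul)
    also have "\<dots> = Fu (mono (x # q))"
      by (rule Fu_veq) (intro veq_sym[OF central.hyps] Fin_mono Fin_smul)+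
    finally show "Fu (Yv u n (mono (x # q))) = rho (tp n) (Fu u) (Fu (mono (x # q)))" .
  qed
next
  case (gen a A m x q)
  have a: "Fin a" "fld A" "\<And>k x. Fin x \<Longrightarrow> Fu (Yv a k x) = rho (tp k) A (Fu x)"
    and gA: "gen A"
    using gen(1) fld_gen by (auto simp: vgen_def)
  have IH: "Fu (Yv u n (mono q)) = rho (tp n) (Fu u) (Fu (mono q))" if "Fin u" for u n
    using gen.IH that by blast
  show ?case
  proof (intro allI impI ext)
    fix u n P w assume u: "Fin u"
    have l: "locl A (Fu u)" "locl A (Fu (mono q))" "locl (Fu u) (Fu (mono q))"
      using good_Fu[OF u] good_Fu[OF Fin_mono] gA Fu_locl[OF u Fin_mono] by (auto simp: good_def)
    have e: "Fu (mono (x # q)) = rho (tp m) A (Fu (mono q))"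
      unfolding a(3)[OF Fin_mono, symmetric] by (rule Fu_veq) (intro gen Fin_mono Fin_Yv a)+
    have "Fu (Yv u n (mono (x # q))) P w = Fu (Yv u n (Yv a m (mono q))) P w"
      by (rule fun_cong[OF fun_cong[OF FY_cong]]) (intro u a gen Fin_mono Fin_Yv veq_refl)+
    moreover obtain M1 where M1: "\<And>M'. M' \<ge> M1 \<Longrightarrow>
      (\<Sum>i<M'. sc (of_int m gchoose i) (Fu (Yv (Yv a (int i) u) (m + n - int i) (mono q)) P w)) =
       Fu (Yv a m (Yv u n (mono q))) P w - Fu (Yv u n (Yv a m (mono q))) P w"
      using FY_commutator[OF a(1) u Fin_mono] by blast
    moreover obtain M2 where M2: "\<And>M'. M' \<ge> M2 \<Longrightarrow>
      rho (tp m) A (rho (tp n) (Fu u) (Fu (mono q))) P w - rho (tp n) (Fu u) (rho (tp m) A (Fu (mono q))) P w =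
      (\<Sum>i<M'. sc (of_int m gchoose i) (rho (tp (m + n - int i)) (rho (tp (int i)) A (Fu u)) (Fu (mono q)) P w))"
      using rho_commutator_locl[OF a(2) fld_Fu[OF u] fld_Fu[OF Fin_mono] l] by blast
    moreover have "Fu (Yv (Yv a (int i) u) k (mono q)) P w = rho (tp k) (rho (tp (int i)) A (Fu u)) (Fu (mono q)) P w" for i k
      using IH[OF Fin_Yv[OF a(1) u]] a(3)[OF u] by simp
    moreover have "Fu (Yv a m (Yv u n (mono q))) P w = rho (tp m) A (rho (tp n) (Fu u) (Fu (mono q))) P w"
      using a(3)[OF Fin_Yv[OF u Fin_mono]] IH[OF u] by simp
    \<comment> \<open>Both commutator sums are taken up to the common bound
      \<open>M1 + M2\<close>.\<close>
    ultimately show "Fu (Yv u n (mono (x # q))) P w = rho (tp n) (Fu u) (Fu (mono (x # q))) P w"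
      using M1[of "M1 + M2"] M2[of "M1 + M2"] by (simp add: e)
  qed
qed

lemma Fu_Yv: "Fin v \<Longrightarrow> Fin u \<Longrightarrow> Fu (Yv u n v) = rho (tp n) (Fu u) (Fu v)"
proof -
  assume v: "Fin v" and u: "Fin u"
  have FS: "Fin (\<Sum>q\<in>I. smul (v q) (mono q))" for I by (intro Fin_sum Fin_smul Fin_mono)
  have "Fu (Yv u n (\<Sum>q\<in>I. smul (v q) (mono q))) = lincomb I v (\<lambda>q. rho (tp n) (Fu u) (fw q))" if "finite I" for I
    using that
  proof (induction I rule: finite_induct)
    case empty
    have "Fu (Yv u n 0) P w = 0" for P w by (rule FY_zero_right[OF u Fin_0 veq_refl])
    then show ?case by (intro ext) (simp only: sum.empty lincomb_def)
  next
    case (insert q I)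
    have "(\<Sum>q\<in>insert q I. smul (v q) (mono q)) = smul (v q) (mono q) + (\<Sum>q\<in>I. smul (v q) (mono q))"
      using insert.hyps by (simp only: sum.insert not_False_eq_True)
    then show ?case
      using insert Fu_Yv_mono[of q] u
      by (intro ext) (simp only: FY_add_right[OF u Fin_smul[OF Fin_mono] FS] FY_smul_right[OF u Fin_mono],
          simp add: Fu_mono lincomb_def)
  qed
  from this[of "{q. v q \<noteq> 0}"] have "Fu (Yv u n v) = lincomb {q. v q \<noteq> 0} v (\<lambda>q. rho (tp n) (Fu u) (fw q))"
    using tv_expand[OF v] v by (simp add: Fin_def)
  also have "\<dots> = rho (tp n) (Fu u) (Fu v)"
  proof -
    have "fld (fw q)" "locl (Fu u) (fw q)" for q
      using good_fw[of q] Fu_locl[OF u Fin_mono, of q] by (auto simp: good_def Fu_mono)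
    then show ?thesis
      unfolding Fu_def[of v] using v by (intro rho_locl_lincomb_right[symmetric] fld_Fu u) (auto simp: Fin_def)
  qed
  finally show ?thesis .
qed

end

section \<open>The coordinated module axioms\<close>

context complex_space
begin

lemma dl_pow_binomial:
  "(dl ^^ n) L k = (\<Sum>i\<le>n. sc (of_int ((-1) ^ (n - i) * int (n choose i))) (L (k - int i)))"
proof (induction n arbitrary: k)
  case (Suc n)
  define c where "c n i = (of_int ((-1) ^ (n - i) * int (n choose i)) :: complex)" for n i
  have c0: "c (Suc n) 0 = - c n 0" by (simp add: c_def)
  have cS: "c (Suc n) (Suc i) = c n i - (if Suc i \<le> n then c n (Suc i) else 0)" if "i \<le> n" for i
  proof (cases "Suc i \<le> n")
    case True
    then have "n - i = Suc (n - Suc i)" by simp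
    then show ?thesis using True by (simp add: c_def algebra_simps)
  qed (use that in \<open>auto simp: c_def binomial_eq_0\<close>)
  have "(dl ^^ Suc n) L k = (\<Sum>i\<le>n. sc (c n i) (L (k - 1 - int i))) - (\<Sum>i\<le>n. sc (c n i) (L (k - int i)))"
    by (simp add: dl_def Suc c_def)
  also have "(\<Sum>i\<le>n. sc (c n i) (L (k - int i))) =
      sc (c n 0) (L k) + (\<Sum>i\<le>n. sc (if Suc i \<le> n then c n (Suc i) else 0) (L (k - int (Suc i))))"
  proof -
    have "(\<Sum>i\<le>n. sc (c n i) (L (k - int i))) = (\<Sum>i\<le>Suc n. sc (if i \<le> n then c n i else 0) (L (k - int i)))"
      by simp
    also have "\<dots> = sc (c n 0) (L k) + (\<Sum>i\<le>n. sc (if Suc i \<le> n then c n (Suc i) else 0) (L (k - int (Suc i))))"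
      by (subst sum.atMost_Suc_shift) simp
    finally show ?thesis .
  qed
  also have "(\<Sum>i\<le>n. sc (c n i) (L (k - 1 - int i))) = (\<Sum>i\<le>n. sc (c n i) (L (k - int (Suc i))))"
    by (simp add: algebra_simps)
  also have "\<dots> - (sc (c n 0) (L k) + (\<Sum>i\<le>n. sc (if Suc i \<le> n then c n (Suc i) else 0) (L (k - int (Suc i))))) =
      sc (c (Suc n) 0) (L k) + (\<Sum>i\<le>n. sc (c (Suc n) (Suc i)) (L (k - int (Suc i))))"
    by (simp add: c0 cS scale_left_diff_distrib sum_subtractf del: of_nat_Suc)
  also have "\<dots> = (\<Sum>i\<le>Suc n. sc (c (Suc n) i) (L (k - int i)))"
    by (subst sum.atMost_Suc_shift) simp
  finally show ?case by (simp only: c_def)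
qed simp

end

context Lstar_V_module
begin

lemma Pc_eq:
  "Pc sc Fu K u v w a b = (dl ^^ K) (LL (Fu u) (Fu v) (a + b - int K) w) a"
  unfolding Pc_def dl_pow_binomial LL_def
  by (rule sum.cong) (auto simp: of_nat_diff algebra_simps)

text \<open>Truncation in \<open>x2\<close> comes from \<open>v\<close>, which acts first.
  Truncation in \<open>x1\<close> comes from the opposite order of the factors, which locality
  provides after multiplication by \<open>(x1 - x2)^K\<close>.\<close>

lemma Pc_truncated:
  assumes "Fin u" "Fin v" "loc K (Fu u) (Fu v)"
  shows "\<exists>N. \<forall>a b. a < N \<or> b < N \<longrightarrow> Pc sc Fu K u v w a b = 0"
proof -
  note f = fld_Fu[OF assms(1)] fld_Fu[OF assms(2)]
  obtain M where M: "\<And>k. k < M \<Longrightarrow> Fu u k w = 0" using fld_dnzE[OF f(1)] by blast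
  obtain N where N: "\<And>k. k < N \<Longrightarrow> Fu v k w = 0" using fld_dnzE[OF f(2)] by blast
  have "Pc sc Fu K u v w a b = 0" if "b < N" for a b
    unfolding Pc_def by (rule sum.neutral) (use that in \<open>auto simp: N lin_0[OF fld_lin[OF f(1)]]\<close>)
  moreover have "Pc sc Fu K u v w a b = 0" if "a < M" for a b
  proof -
    have "Pc sc Fu K u v w a b = (dl ^^ K) (RR (Fu u) (Fu v) (a + b - int K) w) a"
      using assms(3) by (simp add: Pc_eq loc_def dl_pow_diff)
    also have "\<dots> = 0"
      unfolding dl_pow_binomial RR_def
      by (rule sum.neutral) (use that in \<open>auto simp: M lin_0[OF fld_lin[OF f(2)]]\<close>)
    finally show ?thesis .
  qed
  ultimately show ?thesis by (intro exI[of _ "min M N"]) auto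
qed

lemma phi_associativity:
  assumes "Fin u" "Fin v" "loc K (Fu u) (Fu v)"
    and N: "\<forall>a b. a < N \<or> b < N \<longrightarrow> Pc sc Fu K u v w a b = 0" and N': "\<forall>j\<ge>N'. Yv u j v \<sim> 0"
  shows "phiL sc Yv Fu K u v w N' c p = phiR sc Fu K u v w N c p"
proof -
  define L R where "L = LL (Fu u) (Fu v) (p - int K) w" and "R = RR (Fu u) (Fu v) (p - int K) w"
  have g: "gpair K L R" unfolding L_def R_def by (rule gpair_loc[OF fld_Fu[OF assms(1)] fld_Fu[OF assms(2)] assms(3)])
  have FY: "Fu (Yv u j v) (p - int K) w = LAM (tp j) L R" for j
    using Fu_Yv[OF assms(2,1)] by (simp add: rho_def L_def R_def)
  have z: "LAM (tp j) L R = 0" if "j \<ge> N'" for j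
  proof -
    have "Fu (Yv u j v) = Fu 0" using N' that by (intro Fu_veq Fin_Yv assms Fin_0) auto
    then show ?thesis using FY[of j] by (simp add: Fu_0)
  qed
  \<comment> \<open>Replacing \<open>z^K\<close> by its expansion \<open>S\<close> costs an error of
    order \<open>M\<close>; times \<open>t^(-c-1)\<close> it has order at least
    \<open>N2 \<ge> K\<close>, so locality kills it. Raising \<open>N'\<close> to \<open>N2\<close>
    adds only products that vanish.\<close>
  define N2 where "N2 = max N' (int K)"
  define M where "M = c + 1 + N2"
  define S where "S = (\<Sum>d<nat M. fls_const (ek K d) * tp (int d))"
  have "phiL sc Yv Fu K u v w N' c p = (\<Sum>j\<in>{-c-1..<N'}. sc (ek K (nat (c + j + 1))) (LAM (tp j) L R))"
    by (simp add: phiL_def FY)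
  also have "\<dots> = (\<Sum>j\<in>{-c-1..<N2}. sc (ek K (nat (c + j + 1))) (LAM (tp j) L R))"
    by (rule sum.mono_neutral_left) (auto simp: N2_def z)
  also have "\<dots> = (\<Sum>d<nat M. sc (ek K d) (LAM (tp (int d - c - 1)) L R))"
    by (rule sum.reindex_bij_witness[of _ "\<lambda>d. int d - c - 1" "\<lambda>j. nat (c + j + 1)"])
       (auto simp: M_def)
  also have "\<dots> = LAM (S * tp (- c - 1)) L R"
  proof -
    have "tp (int d - c - 1) = tp (int d) * tp (- c - 1)" for d
      using tp_add[of "int d" "- c - 1"] by (simp add: algebra_simps)
    then show ?thesis
      by (simp add: S_def sum_distrib_right LAM_sum_left[OF g] LAM_const_mult[OF g] mult.assoc)
  qed
  also have "\<dots> = LAM (fls_X ^ K * tp (- c - 1)) L R"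
  proof -
    have "LAM ((fls_X ^ K - S) * tp (- c - 1)) L R = 0"
    proof (rule LAM_eq_0[OF g])
      fix j assume "j < int K"
      then show "((fls_X ^ K - S) * tp (- c - 1)) $$ j = 0"
        unfolding S_def
        by (intro fls_times_nth_below[of M _ "- c - 1"] X_power_tp_expansion tp_nth_below)
           (auto simp: M_def N2_def)
    qed
    then show ?thesis
      using LAM_diff_left[OF g, of "fls_X ^ K * tp (- c - 1)" "S * tp (- c - 1)"] by (simp add: left_diff_distrib)
  qed
  also have "\<dots> = LAM (tp (- c - 1)) ((dl ^^ K) L) ((dl ^^ K) R)"
    by (rule LAM_X_power_mult[OF g])
  \<comment> \<open>After multiplication by \<open>(y - 1)^K\<close> both orders coincide and form a
    Laurent polynomial, so pairing with \<open>t^(-c-1)\<close> reads off the coefficient of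
    \<open>t^c\<close> at \<open>y = e^t\<close>.\<close>
  also have "(dl ^^ K) R = (dl ^^ K) L"
    using g by (auto simp: gpair_def dl_pow_diff fun_eq_iff)
  finally have 1: "phiL sc Yv Fu K u v w N' c p = LAM (tp (- c - 1)) ((dl ^^ K) L) ((dl ^^ K) L)" .
  have D: "(dl ^^ K) L k = Pc sc Fu K u v w k (p - k)" for k
    by (simp add: Pc_eq L_def)
  have supp: "{k. (dl ^^ K) L k \<noteq> 0} \<subseteq> {N..p - N}"
    using N by (auto simp: D intro: ccontr) (meson N not_le_imp_less, smt (verit) N)
  then have fin: "finite {k. (dl ^^ K) L k \<noteq> 0}" by (rule finite_subset) simp
  show ?thesis
  proof (cases "c < 0")
    case True
    then show ?thesis using LAM_tp_diagonal_nonneg[OF fin, of "- c - 1"] by (simp add: 1 phiR_def)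
  next
    case False
    then have "- c - 1 = - 1 - int (nat c)" by simp
    then have "LAM (tp (- c - 1)) ((dl ^^ K) L) ((dl ^^ K) L) =
        Sum_any (\<lambda>k. sc (of_int k ^ nat c / fact (nat c)) ((dl ^^ K) L k))"
      using LAM_tp_diagonal[OF fin, of "nat c"] by (simp only:)
    also have "\<dots> = (\<Sum>k\<in>{N..p - N}. sc (of_int k ^ nat c / fact (nat c)) ((dl ^^ K) L k))"
      by (rule Sum_any.expand_superset) (use supp in auto)
    finally show ?thesis using False by (simp add: 1 phiR_def D)
  qed
qed

lemma Fu_phi_coord_module: "phi_coord_module sc l1 l2 l3 l4 Yv Fu"
  unfolding phi_coord_module_def Let_def
proof (intro conjI allI impI)
  fix u u' assume "Fin u" "Fin u'" "u \<sim> u'"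
  then show "Fu u = Fu u'" by (intro Fu_veq)
next
  fix u u' k w assume "Fin u" "Fin u'"
  then show "Fu (u + u') k w = Fu u k w + Fu u' k w" by (rule Fu_add)
next
  fix u c k w
  show "Fu (smul c u) k w = sc c (Fu u k w)" by (rule Fu_smul)
next
  fix u k w w' assume "Fin u"
  then show "Fu u k (w + w') = Fu u k w + Fu u k w'" by (rule lin_add[OF fld_lin[OF fld_Fu]])
next
  fix u k c w assume "Fin u"
  then show "Fu u k (sc c w) = sc c (Fu u k w)" by (rule lin_scale[OF fld_lin[OF fld_Fu]])
next
  fix u w assume "Fin u"
  then show "\<exists>N. \<forall>k<N. Fu u k w = 0" using fld_dnzE[OF fld_Fu] by metis
next
  fix k w
  show "Fu vac k w = (if k = 0 then w else 0)" by (simp add: Fu_vac idf_def)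
next
  fix u v assume uv: "Fin u" "Fin v"
  obtain K where K: "loc K (Fu u) (Fu v)" using Fu_locl[OF uv] by (auto simp: locl_def)
  show "\<exists>K. \<forall>w. (\<exists>N. \<forall>a b. a < N \<or> b < N \<longrightarrow> Pc sc Fu K u v w a b = 0) \<and>
      (\<forall>N N'. (\<forall>a b. a < N \<or> b < N \<longrightarrow> Pc sc Fu K u v w a b = 0) \<longrightarrow> (\<forall>j\<ge>N'. Yv u j v \<sim> 0) \<longrightarrow>
        (\<forall>c p. phiL sc Yv Fu K u v w N' c p = phiR sc Fu K u v w N c p))"
    using Pc_truncated[OF uv K] phi_associativity[OF uv K] by blast
qed

lemma Fu_gen_fields: "gen_fields tact eact Fu"
  unfolding gen_fields_def
  by (simp add: Fu_mono rho_idf_right fld_TF fld_EF TF_def EF_def)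

end

section \<open>Uniqueness\<close>

text \<open>Coefficients of \<open>(e^z - 1) (e^z - 1)^K\<close>; the first factor has no constant
  term, so the sum starts at 1.\<close>

lemma ek_Suc: "ek (Suc K) d = (\<Sum>i=1..d. ek K (d - i) / fact i)"
proof -
  have "ek (Suc K) d = (\<Sum>i=0..d. fps_nth (fps_exp 1 - 1 :: complex fps) i * ek K (d - i))"
    by (simp add: ek_fps fps_mult_nth)
  also have "\<dots> = (\<Sum>i=1..d. fps_nth (fps_exp 1 - 1 :: complex fps) i * ek K (d - i))"
    by (rule sum.mono_neutral_right) (auto simp: not_le)
  also have "\<dots> = (\<Sum>i=1..d. ek K (d - i) / fact i)"
    by (rule sum.cong) auto
  finally show ?thesis .
qed

section \<open>Raising the exponent in associativity\<close>

context complex_space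
begin

text \<open>The locality and associativity condition for one exponent and one vector, isolated so
  that exponents belonging to different modules can be made equal.\<close>

definition phi_assoc :: "complex \<Rightarrow> complex \<Rightarrow> complex \<Rightarrow> complex \<Rightarrow> (tv \<Rightarrow> int \<Rightarrow> tv \<Rightarrow> tv) \<Rightarrow> (tv \<Rightarrow> 'w field) \<Rightarrow>
    nat \<Rightarrow> tv \<Rightarrow> tv \<Rightarrow> 'w \<Rightarrow> bool" where
  "phi_assoc l1 l2 l3 l4 Yv YW K u v w \<longleftrightarrow>
    (\<exists>N. \<forall>a b. a < N \<or> b < N \<longrightarrow> Pc sc YW K u v w a b = 0) \<and>
    (\<forall>N N'. (\<forall>a b. a < N \<or> b < N \<longrightarrow> Pc sc YW K u v w a b = 0) \<longrightarrow>
       (\<forall>j\<ge>N'. veq l1 l2 l3 l4 (Yv u j v) 0) \<longrightarrow>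
       (\<forall>c p. phiL sc Yv YW K u v w N' c p = phiR sc YW K u v w N c p))"

lemma Pc_Suc: "Pc sc YW (Suc K) u v w a b = Pc sc YW K u v w (a - 1) b - Pc sc YW K u v w a (b - 1)"
proof -
  have Pc_dl: "Pc sc YW K u v w a b = (dl ^^ K) (\<lambda>k. YW u k (YW v (a + b - int K - k) w)) a" for K a b
    unfolding Pc_def dl_pow_binomial by (rule sum.cong) (auto simp: of_nat_diff algebra_simps)
  show ?thesis unfolding Pc_dl by (simp add: dl_def algebra_simps)
qed

lemma phiR_bound_indep:
  assumes "\<forall>a b. a < N \<or> b < N \<longrightarrow> Pc sc YW K u v w a b = 0" "\<forall>a b. a < M \<or> b < M \<longrightarrow> Pc sc YW K u v w a b = 0"
  shows "phiR sc YW K u v w N c p = phiR sc YW K u v w M c p"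
proof -
  have "(\<Sum>a\<in>{N..p-N}. sc (of_int a ^ nat c / fact (nat c)) (Pc sc YW K u v w a (p - a))) =
      (\<Sum>a\<in>{min N M..p - min N M}. sc (of_int a ^ nat c / fact (nat c)) (Pc sc YW K u v w a (p - a)))"
    by (rule sum.mono_neutral_left) (use assms(1) in \<open>auto simp: not_le\<close>)
  moreover have "(\<Sum>a\<in>{M..p-M}. sc (of_int a ^ nat c / fact (nat c)) (Pc sc YW K u v w a (p - a))) =
      (\<Sum>a\<in>{min N M..p - min N M}. sc (of_int a ^ nat c / fact (nat c)) (Pc sc YW K u v w a (p - a)))"
    by (rule sum.mono_neutral_left) (use assms(2) in \<open>auto simp: not_le\<close>)
  ultimately show ?thesis by (simp add: phiR_def)
qed

text \<open>At \<open>x1 = x2 e^z\<close> the extra factor \<open>x1 - x2\<close> is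
  \<open>x2 (e^z - 1)\<close>, which lowers \<open>p\<close> by one and convolves in
  \<open>z\<close>. Terms with \<open>i > c\<close> vanish, so any upper limit from \<open>c\<close>
  on will do.\<close>

lemma phiR_Suc:
  assumes N: "\<forall>a b. a < N \<or> b < N \<longrightarrow> Pc sc YW K u v w a b = 0" and c: "c \<ge> 0" "c \<le> int I"
  shows "phiR sc YW (Suc K) u v w N c p = (\<Sum>i=1..I. sc (1 / fact i) (phiR sc YW K u v w N (c - int i) (p - 1)))"
proof -
  define n where "n = nat c"
  have n: "c = int n" "n \<le> I" using c by (auto simp: n_def)
  define P where "P a = Pc sc YW K u v w a (p - 1 - a)" for a
  have P0: "P a = 0" if "a < N \<or> a > p - 1 - N" for a using N that by (auto simp: P_def)
  have "phiR sc YW (Suc K) u v w N c p = (\<Sum>a\<in>{N..p-N}. sc (of_int a ^ n / fact n) (P (a - 1) - P a))"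
    using c by (simp add: phiR_def Pc_Suc P_def n_def algebra_simps)
  also have "\<dots> = (\<Sum>a\<in>{N..p-N}. sc (of_int a ^ n / fact n) (P (a - 1))) - (\<Sum>a\<in>{N..p-N}. sc (of_int a ^ n / fact n) (P a))"
    by (simp add: scale_right_diff_distrib sum_subtractf)
  also have "(\<Sum>a\<in>{N..p-N}. sc (of_int a ^ n / fact n) (P (a - 1))) =
      (\<Sum>a\<in>{N-1..p-1-N}. sc (of_int (a + 1) ^ n / fact n) (P a))"
    by (rule sum.reindex_bij_witness[of _ "\<lambda>a. a + 1" "\<lambda>a. a - 1"]) auto
  also have "\<dots> = (\<Sum>a\<in>{N..p-1-N}. sc (of_int (a + 1) ^ n / fact n) (P a))"
    by (rule sum.mono_neutral_right) (auto simp: P0)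
  also have "(\<Sum>a\<in>{N..p-N}. sc (of_int a ^ n / fact n) (P a)) = (\<Sum>a\<in>{N..p-1-N}. sc (of_int a ^ n / fact n) (P a))"
    by (rule sum.mono_neutral_right) (auto simp: P0)
  also have "(\<Sum>a\<in>{N..p-1-N}. sc (of_int (a + 1) ^ n / fact n) (P a)) - (\<Sum>a\<in>{N..p-1-N}. sc (of_int a ^ n / fact n) (P a)) =
      (\<Sum>a\<in>{N..p-1-N}. sc (of_int (a + 1) ^ n / fact n - of_int a ^ n / fact n) (P a))"
    by (simp only: scale_left_diff_distrib sum_subtractf)
  also have "\<dots> = (\<Sum>a\<in>{N..p-1-N}. \<Sum>i=1..n. sc (1 / fact i) (sc (of_int a ^ (n - i) / fact (n - i)) (P a)))"
  proof (rule sum.cong[OF refl])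
    fix a
    \<comment> \<open>The coefficient of \<open>z^n\<close> in
      \<open>e^((a+1)z) = e^z e^(az)\<close>; the term \<open>i = 0\<close> is the one
      subtracted.\<close>
    have "of_int (a + 1) ^ n / fact n = (\<Sum>i\<le>n. 1 / fact i * (of_int a ^ (n - i) / fact (n - i)) :: complex)"
    proof -
      have "of_int (a + 1) ^ n = (\<Sum>i\<le>n. of_nat (n choose i) * 1 ^ i * of_int a ^ (n - i) :: complex)"
        using binomial_ring[of 1 "of_int a :: complex" n] by (simp add: add.commute)
      then have "of_int (a + 1) ^ n / fact n = (\<Sum>i\<le>n. of_nat (n choose i) * of_int a ^ (n - i) / fact n :: complex)"
        by (simp add: sum_divide_distrib)
      also have "\<dots> = (\<Sum>i\<le>n. 1 / fact i * (of_int a ^ (n - i) / fact (n - i)))"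
        by (rule sum.cong) (auto simp: binomial_fact)
      finally show ?thesis .
    qed
    also have "\<dots> = of_int a ^ n / fact n + (\<Sum>i=1..n. 1 / fact i * (of_int a ^ (n - i) / fact (n - i)))"
      by (simp add: atMost_atLeast0 sum.atLeast_Suc_atMost)
    finally show "sc (of_int (a + 1) ^ n / fact n - of_int a ^ n / fact n) (P a) =
        (\<Sum>i=1..n. sc (1 / fact i) (sc (of_int a ^ (n - i) / fact (n - i)) (P a)))"
      by (simp add: scale_sum_left)
  qed
  also have "\<dots> = (\<Sum>i=1..n. sc (1 / fact i) (\<Sum>a\<in>{N..p-1-N}. sc (of_int a ^ (n - i) / fact (n - i)) (P a)))"
    by (subst sum.swap) (simp only: scale_sum_right)
  also have "\<dots> = (\<Sum>i=1..n. sc (1 / fact i) (phiR sc YW K u v w N (c - int i) (p - 1)))"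
    by (rule sum.cong) (auto simp: phiR_def n P_def nat_diff_distrib)
  also have "\<dots> = (\<Sum>i=1..I. sc (1 / fact i) (phiR sc YW K u v w N (c - int i) (p - 1)))"
    by (rule sum.mono_neutral_left) (use n in \<open>auto simp: phiR_def\<close>)
  finally show ?thesis .
qed

text \<open>The same factor \<open>x2 (e^z - 1)\<close>, entering here through
  \<open>ek_Suc\<close>; indices \<open>i\<close> beyond \<open>c + N'\<close> contribute empty
  sums.\<close>

lemma phiL_Suc:
  assumes "c + N' \<le> int I"
  shows "phiL sc Yv YW (Suc K) u v w N' c p = (\<Sum>i=1..I. sc (1 / fact i) (phiL sc Yv YW K u v w N' (c - int i) (p - 1)))"
proof -
  define Y where "Y j = YW (Yv u j v) (p - 1 - int K) w" for j
  have "phiL sc Yv YW (Suc K) u v w N' c p = (\<Sum>j\<in>{-c-1..<N'}. sc (ek (Suc K) (nat (c + j + 1))) (Y j))"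
    by (simp add: phiL_def Y_def algebra_simps)
  also have "\<dots> = (\<Sum>j\<in>{-c-1..<N'}. \<Sum>i=1..I. sc (1 / fact i) (if int i \<le> c + j + 1 then sc (ek K (nat (c - int i + j + 1))) (Y j) else 0))"
  proof (rule sum.cong[OF refl])
    fix j assume j: "j \<in> {-c-1..<N'}"
    define d where "d = nat (c + j + 1)"
    have d: "int d = c + j + 1" using j by (simp add: d_def)
    have "sc (ek (Suc K) d) (Y j) = (\<Sum>i=1..d. sc (1 / fact i) (sc (ek K (d - i)) (Y j)))"
      by (simp add: ek_Suc scale_sum_left)
    also have "\<dots> = (\<Sum>i=1..d. sc (1 / fact i) (if int i \<le> c + j + 1 then sc (ek K (nat (c - int i + j + 1))) (Y j) else 0))"
    proof (rule sum.cong[OF refl])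
      fix i assume i: "i \<in> {1..d}"
      then have "nat (c - int i + j + 1) = d - i" "int i \<le> c + j + 1" using d by auto
      then show "sc (1 / fact i) (sc (ek K (d - i)) (Y j)) =
          sc (1 / fact i) (if int i \<le> c + j + 1 then sc (ek K (nat (c - int i + j + 1))) (Y j) else 0)" by simp
    qed
    also have "\<dots> = (\<Sum>i=1..I. sc (1 / fact i) (if int i \<le> c + j + 1 then sc (ek K (nat (c - int i + j + 1))) (Y j) else 0))"
      by (rule sum.mono_neutral_left) (use d j assms in auto)
    finally show "sc (ek (Suc K) (nat (c + j + 1))) (Y j) =
        (\<Sum>i=1..I. sc (1 / fact i) (if int i \<le> c + j + 1 then sc (ek K (nat (c - int i + j + 1))) (Y j) else 0))"
      by (simp only: d_def)
  qed
  also have "\<dots> = (\<Sum>i=1..I. sc (1 / fact i) (\<Sum>j\<in>{-c-1..<N'}. if int i \<le> c + j + 1 then sc (ek K (nat (c - int i + j + 1))) (Y j) else 0))"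
    by (subst sum.swap) (simp only: scale_sum_right)
  also have "\<dots> = (\<Sum>i=1..I. sc (1 / fact i) (phiL sc Yv YW K u v w N' (c - int i) (p - 1)))"
  proof (rule sum.cong[OF refl])
    fix i
    have "(\<Sum>j\<in>{-c-1..<N'}. if int i \<le> c + j + 1 then sc (ek K (nat (c - int i + j + 1))) (Y j) else 0) =
        (\<Sum>j\<in>{-(c - int i)-1..<N'}. if int i \<le> c + j + 1 then sc (ek K (nat (c - int i + j + 1))) (Y j) else 0)"
      by (rule sum.mono_neutral_right) auto
    also have "\<dots> = phiL sc Yv YW K u v w N' (c - int i) (p - 1)"
      unfolding phiL_def by (rule sum.cong) (auto simp: Y_def)
    finally show "sc (1 / fact i) (\<Sum>j\<in>{-c-1..<N'}. if int i \<le> c + j + 1 then sc (ek K (nat (c - int i + j + 1))) (Y j) else 0) =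
        sc (1 / fact i) (phiL sc Yv YW K u v w N' (c - int i) (p - 1))" by simp
  qed
  finally show ?thesis .
qed

lemma phi_assoc_Suc:
  assumes "phi_assoc l1 l2 l3 l4 Yv YW K u v w"
  shows "phi_assoc l1 l2 l3 l4 Yv YW (Suc K) u v w"
proof -
  obtain N0 where N0: "\<forall>a b. a < N0 \<or> b < N0 \<longrightarrow> Pc sc YW K u v w a b = 0"
    using assms by (auto simp: phi_assoc_def)
  have N0': "\<forall>a b. a < N0 \<or> b < N0 \<longrightarrow> Pc sc YW (Suc K) u v w a b = 0"
    using N0 by (auto simp: Pc_Suc)
  show ?thesis
    unfolding phi_assoc_def
  proof (intro conjI exI[of _ N0] N0' allI impI)
    fix N N' c p
    assume N: "\<forall>a b. a < N \<or> b < N \<longrightarrow> Pc sc YW (Suc K) u v w a b = 0"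
      and N': "\<forall>j\<ge>N'. veq l1 l2 l3 l4 (Yv u j v) 0"
    have LR: "phiL sc Yv YW K u v w N' c p = phiR sc YW K u v w N0 c p" for c p
      using assms N0 N' unfolding phi_assoc_def by blast
    \<comment> \<open>A common upper limit for both recursions: at least \<open>c\<close> for the
      right side and at least \<open>c + N'\<close> for the left.\<close>
    define I where "I = nat c + nat (c + N')"
    have I: "c + N' \<le> int I" unfolding I_def by linarith
    have "phiL sc Yv YW (Suc K) u v w N' c p = phiR sc YW (Suc K) u v w N0 c p"
    proof (cases "c \<ge> 0")
      case True
      then have "c \<le> int I" unfolding I_def by linarith
      from phiR_Suc[OF N0 True this] phiL_Suc[OF I] show ?thesis by (simp add: LR)
    next
      \<comment> \<open>\<open>phiR_Suc\<close> covers \<open>c \<ge> 0\<close>. For negative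
        \<open>c\<close> the right side is 0 by definition, and the old associativity makes every
        term of the left recursion 0.\<close>
      case False
      then have "phiL sc Yv YW K u v w N' (c - int i) (p - 1) = 0" for i
        by (simp add: LR phiR_def)
      then show ?thesis using False phiL_Suc[OF I] by (simp add: phiR_def)
    qed
    then show "phiL sc Yv YW (Suc K) u v w N' c p = phiR sc YW (Suc K) u v w N c p"
      using phiR_bound_indep[OF N N0'] by simp
  qed
qed

lemma phi_assoc_mono:
  assumes "phi_assoc l1 l2 l3 l4 Yv YW K u v w" "K \<le> K'"
  shows "phi_assoc l1 l2 l3 l4 Yv YW K' u v w"
  using assms(2,1) by (induction K' rule: dec_induct) (auto intro: phi_assoc_Suc)

lemma phi_coord_moduleD:
  assumes "phi_coord_module sc l1 l2 l3 l4 Yv Y"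
  shows "Fin u \<Longrightarrow> Fin u' \<Longrightarrow> veq l1 l2 l3 l4 u u' \<Longrightarrow> Y u = Y u'"
    and "Fin u \<Longrightarrow> Fin u' \<Longrightarrow> Y (u + u') k w = Y u k w + Y u' k w"
    and "Fin u \<Longrightarrow> Y (smul c u) k w = sc c (Y u k w)"
    and "Y vac k w = (if k = 0 then w else 0)"
proof -
  note d = assms[unfolded phi_coord_module_def Let_def]
  show "Fin u \<Longrightarrow> Fin u' \<Longrightarrow> veq l1 l2 l3 l4 u u' \<Longrightarrow> Y u = Y u'"
    using d[THEN conjunct1] by blast
  note d = d[THEN conjunct2]
  show "Fin u \<Longrightarrow> Fin u' \<Longrightarrow> Y (u + u') k w = Y u k w + Y u' k w"
    using d[THEN conjunct1] by blast
  note d = d[THEN conjunct2]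
  show "Fin u \<Longrightarrow> Y (smul c u) k w = sc c (Y u k w)"
    using d[THEN conjunct1] by blast
  show "Y vac k w = (if k = 0 then w else 0)"
    using d[THEN conjunct2, THEN conjunct2, THEN conjunct2, THEN conjunct2, THEN conjunct1] by blast
qed

lemma phi_coord_module_assoc:
  assumes "phi_coord_module sc l1 l2 l3 l4 Yv YW" "Fin u" "Fin v"
  shows "\<exists>K. \<forall>w. phi_assoc l1 l2 l3 l4 Yv YW K u v w"
  using assms unfolding phi_coord_module_def Let_def phi_assoc_def by blast

end

section \<open>Modules with the same generating fields agree\<close>

context Lstar_V_module
begin

text \<open>The coefficients of \<open>(e^z - 1)^K\<close> start with \<open>z^K\<close>, so associativity is a triangular system for the
  products \<open>u_n v\<close>, solved downwards from the truncation bound.\<close>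

lemma phi_coord_module_determined:
  assumes m1: "phi_coord_module sc l1 l2 l3 l4 Yv Y1" and m2: "phi_coord_module sc l1 l2 l3 l4 Yv Y2"
    and uv: "Fin u" "Fin v" and eq: "Y1 u = Y2 u" "Y1 v = Y2 v"
  shows "Y1 (Yv u n v) = Y2 (Yv u n v)"
proof (intro ext)
  fix p w
  obtain K1 K2 where "phi_assoc l1 l2 l3 l4 Yv Y1 K1 u v w" "phi_assoc l1 l2 l3 l4 Yv Y2 K2 u v w"
    using phi_coord_module_assoc[OF m1 uv] phi_coord_module_assoc[OF m2 uv] by blast
  then obtain K where K: "phi_assoc l1 l2 l3 l4 Yv Y1 K u v w" "phi_assoc l1 l2 l3 l4 Yv Y2 K u v w"
    using phi_assoc_mono[of _ _ _ _ _ _ _ _ _ _ "max K1 K2"] by (meson max.cobounded1 max.cobounded2)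
  have PP: "Pc sc Y1 K u v w a b = Pc sc Y2 K u v w a b" for a b
    by (simp add: Pc_def eq)
  obtain N where N: "\<forall>a b. a < N \<or> b < N \<longrightarrow> Pc sc Y1 K u v w a b = 0"
    using K(1) by (auto simp: phi_assoc_def)
  obtain N' where N': "\<forall>j\<ge>N'. Yv u j v \<sim> 0" using Yv_truncation[OF uv] by blast
  have "phiL sc Yv Y1 K u v w N' c p = phiR sc Y1 K u v w N c p" for c p
    using K(1) N N' unfolding phi_assoc_def by blast
  moreover have "phiL sc Yv Y2 K u v w N' c p = phiR sc Y2 K u v w N c p" for c p
    using K(2) N N' unfolding phi_assoc_def PP by blast
  ultimately have LL: "phiL sc Yv Y1 K u v w N' c p = phiL sc Yv Y2 K u v w N' c p" for c p
    by (simp add: phiR_def PP)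
  have Y0: "Y (Yv u j v) p w = 0" if "phi_coord_module sc l1 l2 l3 l4 Yv Y" "j \<ge> N'" for Y j p
  proof -
    have "Y (Yv u j v) = Y 0" using N' that(2) by (intro phi_coord_moduleD(1)[OF that(1)] Fin_Yv[OF uv] Fin_0) auto
    moreover have "Y (smul 0 0) p w = sc 0 (Y 0 p w)" by (rule phi_coord_moduleD(3)[OF that(1) Fin_0])
    ultimately show ?thesis by (simp only: smul_0 scale_zero_left)
  qed
  have "Y1 (Yv u (N' - int i) v) p w = Y2 (Yv u (N' - int i) v) p w" for i p
  proof (induction i arbitrary: p rule: less_induct)
    case (less i)
    show ?case
    proof (cases "i = 0")
      case True
      then show ?thesis using Y0[OF m1] Y0[OF m2] by simp
    next
      case False
      define j where "j = N' - int i"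
      \<comment> \<open>At this power of \<open>z\<close> the product \<open>u_j v\<close> has
        coefficient \<open>ek K K = 1\<close>, and the \<open>u_k v\<close> with
        \<open>k < j\<close> drop out. Evaluating at \<open>p + int K\<close> undoes the factor
        \<open>x2^K\<close>.\<close>
      define c where "c = int K - j - 1"
      have L: "phiL sc Yv Y K u v w N' c (p + int K) =
          Y (Yv u j v) p w + (\<Sum>k\<in>{j<..<N'}. sc (ek K (nat (c + k + 1))) (Y (Yv u k v) p w))" for Y
      proof -
        have "phiL sc Yv Y K u v w N' c (p + int K) = (\<Sum>k\<in>{-c-1..<N'}. sc (ek K (nat (c + k + 1))) (Y (Yv u k v) p w))"
          by (simp add: phiL_def)
        also have "\<dots> = (\<Sum>k\<in>{j..<N'}. sc (ek K (nat (c + k + 1))) (Y (Yv u k v) p w))"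
          by (rule sum.mono_neutral_right) (auto simp: c_def ek_eq_0)
        also have "{j..<N'} = insert j {j<..<N'}" using False by (auto simp: j_def)
        finally show ?thesis by (simp add: c_def ek_lead)
      qed
      have "Y1 (Yv u k v) p w = Y2 (Yv u k v) p w" if "k \<in> {j<..<N'}" for k
      proof -
        have "nat (N' - k) < i" "N' - int (nat (N' - k)) = k" using that by (auto simp: j_def)
        with less[of "nat (N' - k)" p] show ?thesis by simp
      qed
      then have "(\<Sum>k\<in>{j<..<N'}. sc (ek K (nat (c + k + 1))) (Y1 (Yv u k v) p w)) =
          (\<Sum>k\<in>{j<..<N'}. sc (ek K (nat (c + k + 1))) (Y2 (Yv u k v) p w))"
        by (intro sum.cong) auto
      then show ?thesis using L[of Y1] L[of Y2] LL[of c "p + int K"] by (simp add: j_def)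
    qed
  qed
  from this[of "nat (N' - n)"] show "Y1 (Yv u n v) p w = Y2 (Yv u n v) p w"
    using Y0[OF m1, of n p] Y0[OF m2, of n p] by (cases "n \<ge> N'") auto
qed

text \<open>Modulo \<open>Jset\<close> a nonempty word is a scalar multiple of a shorter word or a
  product of a generator with one, so agreement on the generators and the vacuum spreads to all
  words and, by linearity, to all vectors.\<close>

lemma phi_coord_module_unique:
  assumes m1: "phi_coord_module sc l1 l2 l3 l4 Yv Y1" "gen_fields tact eact Y1"
    and m2: "phi_coord_module sc l1 l2 l3 l4 Yv Y2" "gen_fields tact eact Y2" and u: "Fin u"
  shows "Y1 u = Y2 u"
proof -
  note c = phi_coord_moduleD
  have g: "Y1 (mono [HT m (-1)]) = Y2 (mono [HT m (-1)])" "Y1 (mono [HE m (-1)]) = Y2 (mono [HE m (-1)])" for m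
    using m1(2) m2(2) by (auto simp: gen_fields_def fun_eq_iff)
  have w: "Y1 (mono q) = Y2 (mono q)" for q
  proof (induction q)
    case Nil
    show ?case using c(4)[OF m1(1)] c(4)[OF m2(1)] by (auto simp: vac_def fun_eq_iff)
  next
    case (Cons x q)
    have G: "Y1 (mono (x # q)) = Y2 (mono (x # q))"
      if "mono (x # q) \<sim> Yv a n (mono q)" "Fin a" "Y1 a = Y2 a" for a n
      using phi_coord_module_determined[OF m1(1) m2(1) that(2) Fin_mono that(3) Cons]
        c(1)[OF m1(1) Fin_mono Fin_Yv[OF that(2) Fin_mono] that(1)]
        c(1)[OF m2(1) Fin_mono Fin_Yv[OF that(2) Fin_mono] that(1)] by simp
    have C: "Y1 (mono (x # q)) = Y2 (mono (x # q))" if "mono (x # q) \<sim> smul l (mono q)" for l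
      using c(1)[OF m1(1) Fin_mono Fin_smul[OF Fin_mono] that]
        c(1)[OF m2(1) Fin_mono Fin_smul[OF Fin_mono] that] Cons
        c(3)[OF m1(1) Fin_mono] c(3)[OF m2(1) Fin_mono]
      by (intro ext) simp
    show ?case
    proof (cases x)
      case (HT m n) show ?thesis by (rule G[OF _ Fin_mono g(1)]) (unfold HT, rule mono_HT_veq)
    next
      case (HE m n) show ?thesis by (rule G[OF _ Fin_mono g(2)]) (unfold HE, rule mono_HE_veq)
    next
      case HK1 show ?thesis by (rule C) (unfold HK1, rule central_veq)
    next
      case HK2 show ?thesis by (rule C) (unfold HK2, rule central_veq)
    next
      case HK3 show ?thesis by (rule C) (unfold HK3, rule central_veq)
    next
      case HK4 show ?thesis by (rule C) (unfold HK4, rule central_veq)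
    qed
  qed
  show ?thesis
    using u
  proof (induction u rule: Fin_induct)
    case (add u v)
    then show ?case by (intro ext) (simp only: c(2)[OF m1(1) add(1,2)] c(2)[OF m2(1) add(1,2)])
  next
    case (smul_mono l q)
    show ?case using c(3)[OF m1(1) Fin_mono] c(3)[OF m2(1) Fin_mono] w[of q] by (intro ext) simp
  qed
qed

end

theorem theorem4p5:
  fixes sc :: "complex \<Rightarrow> 'w::ab_group_add \<Rightarrow> 'w"
    and tact eact :: "int \<Rightarrow> int \<Rightarrow> 'w \<Rightarrow> 'w"
    and l1 l2 l3 l4 :: complex
    and Yv :: "tv \<Rightarrow> int \<Rightarrow> tv \<Rightarrow> tv"
  assumes "vector_space sc"
    and "restricted_Lstar_module sc l1 l2 l3 l4 tact eact"
    and "is_V_structure l1 l2 l3 l4 Yv"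
  shows "(\<exists>YW. phi_coord_module sc l1 l2 l3 l4 Yv YW \<and> gen_fields tact eact YW) \<and>
         (\<forall>YW1 YW2. phi_coord_module sc l1 l2 l3 l4 Yv YW1 \<and> gen_fields tact eact YW1 \<and>
                    phi_coord_module sc l1 l2 l3 l4 Yv YW2 \<and> gen_fields tact eact YW2 \<longrightarrow>
                    (\<forall>u. Fin u \<longrightarrow> YW1 u = YW2 u))"
proof -
  interpret vector_space sc by (rule assms(1))
  interpret Lstar_V_module sc l1 l2 l3 l4 tact eact Yv
    by unfold_locales (fact assms)+
  show ?thesis
    using Fu_phi_coord_module Fu_gen_fields phi_coord_module_unique by blast
qed

end
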